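(* Let $Z$ be a JB*-triple with open unit ball $B$. For any $v\in\partial B$, $$\overline{B}=\overline{\operatorname{co}}(G_v^0)=\overline{\operatorname{co}}(G_v),$$ where $G_v=\{g(v): g\in\mathrm{Aut}(B)\}$ and $G_v^0=\{g(v): g\in\mathrm{Aut}(B)^0\}$.
   Context: A JB*-triple is a complex Banach space $Z$ with a real trilinear map $\{\cdot,\cdot,\cdot\}:Z\times Z\times Z\to Z$ such that: (i) $\{x,y,z\}$ is complex linear and symmetric in the outer variables $x,z$ and complex anti-linear in $y$; (ii) for every $x\in Z$ the map $x\square x: z\mapsto\{x,x,z\}$ is a Hermitian operator with spectrum contained in $[0,\infty)$ and $\|x\square x\|=\|x\|^2$; (iii) $\{a,b,\{x,y,z\}\}=\{\{a,b,x\},y,z\}-\{x,\{b,a,y\},z\}+\{x,y,\{a,b,z\}\}$ for all $a,b,x,y,z\in Z$. $\mathrm{Aut}(B)$ is the group of biholomorphic maps of $B$ onto itself; every $g\in\mathrm{Aut}(B)$ extends continuously to $\overline B$ (indeed holomorphically to a neighbourhood of $\overline B$), and the extension is also denoted $g$. $\mathrm{Aut}(B)^0$ is the connected component of the identity in $\mathrm{Aut}(B)$, where $\mathrm{Aut}(B)$ carries its usual topology of locally uniform convergence on $B$. $\overline{\operatorname{co}}(S)$ denotes the norm-closed convex hull of $S$. *)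

theory Defs
  imports "HOL-Analysis.Analysis"
begin

section \<open>Complex Banach spaces and bounded operators\<close>

class complex_banach = banach +
  fixes scaleC :: "complex \<Rightarrow> 'a \<Rightarrow> 'a" (infixr "*\<^sub>C" 75)
  assumes scaleC_add_right: "a *\<^sub>C (x + y) = a *\<^sub>C x + a *\<^sub>C y"
    and scaleC_add_left: "(a + b) *\<^sub>C x = a *\<^sub>C x + b *\<^sub>C x"
    and scaleC_scaleC: "a *\<^sub>C (b *\<^sub>C x) = (a * b) *\<^sub>C x"
    and scaleR_scaleC: "r *\<^sub>R x = complex_of_real r *\<^sub>C x"
    and norm_scaleC: "norm (a *\<^sub>C x) = cmod a * norm x"

lemma scaleC_one: "1 *\<^sub>C x = x" for x :: "'a::complex_banach"
  using scaleR_scaleC[of 1 x] by simp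

definition clinear :: "('a::complex_banach \<Rightarrow> 'b::complex_banach) \<Rightarrow> bool" where
  "clinear f \<longleftrightarrow> (\<forall>x y. f (x + y) = f x + f y) \<and> (\<forall>c x. f (c *\<^sub>C x) = c *\<^sub>C f x)"

definition bounded_clinear :: "('a::complex_banach \<Rightarrow> 'b::complex_banach) \<Rightarrow> bool" where
  "bounded_clinear f \<longleftrightarrow> clinear f \<and> bounded_linear f"

definition spectrum :: "('a::complex_banach \<Rightarrow> 'a) \<Rightarrow> complex set" where
  "spectrum A = {c. \<not> (\<exists>S. bounded_clinear S \<and>
     S \<circ> (\<lambda>z. A z - c *\<^sub>C z) = id \<and> (\<lambda>z. A z - c *\<^sub>C z) \<circ> S = id)}"

definition op_exp :: "('a::complex_banach \<Rightarrow> 'a) \<Rightarrow> 'a \<Rightarrow> 'a" where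
  "op_exp A z = (\<Sum>n. (1 / fact n) *\<^sub>R (A ^^ n) z)"

text \<open>
  A bounded operator on a complex Banach space is Hermitian when the operators
  \<open>exp (i t A)\<close>, for \<open>t\<close> real, are isometries.  They are then automatically onto,
  with inverse \<open>exp (- i t A)\<close>.
\<close>

definition hermitian :: "('a::complex_banach \<Rightarrow> 'a) \<Rightarrow> bool" where
  "hermitian A \<longleftrightarrow> bounded_clinear A \<and>
     (\<forall>(t::real) z. norm (op_exp (\<lambda>w. (\<i> * complex_of_real t) *\<^sub>C A w) z) = norm z)"


section \<open>JB*-triples\<close>

text \<open>
  Complex linearity of \<open>T\<close> in the third variable follows from \<open>symmetric\<close>; real
  trilinearity follows from (anti-)linearity.
\<close>

locale jb_star_triple =
  fixes T :: "'a::complex_banach \<Rightarrow> 'a \<Rightarrow> 'a \<Rightarrow> 'a"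
  assumes linear_left: "clinear (\<lambda>x. T x y z)"
    and symmetric: "T x y z = T z y x"
    and add_mid: "T x (y + y') z = T x y z + T x y' z"
    and antilinear_mid: "T x (c *\<^sub>C y) z = cnj c *\<^sub>C T x y z"
    and box_hermitian: "hermitian (\<lambda>z. T x x z)"
    and box_spectrum: "spectrum (\<lambda>z. T x x z) \<subseteq> complex_of_real ` {0..}"
    and box_norm: "onorm (\<lambda>z. T x x z) = (norm x)\<^sup>2"
    and jordan: "T a b (T x y z) = T (T a b x) y z - T x (T b a y) z + T x y (T a b z)"


section \<open>The automorphism group of the open unit ball\<close>

text \<open>Complex Frechet differentiability at every point; used for open \<open>S\<close>.\<close>

definition holo_on :: "('a::complex_banach \<Rightarrow> 'b::complex_banach) \<Rightarrow> 'a set \<Rightarrow> bool" where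
  "holo_on f S \<longleftrightarrow> (\<forall>x\<in>S. \<exists>f'. clinear f' \<and> (f has_derivative f') (at x))"

text \<open>
  Automorphisms are maps on the ball only; they are represented by functions that are
  \<open>undefined\<close> off the ball, so that each automorphism is represented exactly once.
\<close>

definition Aut_ball :: "('a::complex_banach \<Rightarrow> 'a) set" where
  "Aut_ball = {g \<in> extensional (ball 0 1). bij_betw g (ball 0 1) (ball 0 1) \<and>
     holo_on g (ball 0 1) \<and> holo_on (inv_into (ball 0 1) g) (ball 0 1)}"

definition locally_uniform_limit ::
    "'a::metric_space set \<Rightarrow> ('i \<Rightarrow> 'a \<Rightarrow> 'b::metric_space) \<Rightarrow> ('a \<Rightarrow> 'b) \<Rightarrow> 'i filter \<Rightarrow> bool" where
  "locally_uniform_limit S f l F \<longleftrightarrow> (\<forall>x\<in>S. \<exists>e>0. uniform_limit (ball x e \<inter> S) f l F)"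

text \<open>
  The topology of locally uniform convergence: a set is open iff, whenever a filter
  (equivalently, a net) of automorphisms converges locally uniformly to one of its members,
  it eventually lies in the set.
\<close>

definition Aut_top :: "('a::complex_banach \<Rightarrow> 'a) topology" where
  "Aut_top = topology (\<lambda>U. U \<subseteq> Aut_ball \<and>
     (\<forall>g\<in>U. \<forall>F. (\<forall>\<^sub>F h in F. h \<in> Aut_ball) \<longrightarrow> locally_uniform_limit (ball 0 1) (\<lambda>h. h) g F
        \<longrightarrow> (\<forall>\<^sub>F h in F. h \<in> U)))"

lemma openin_Aut_top:
  "openin Aut_top U \<longleftrightarrow> U \<subseteq> Aut_ball \<and>
     (\<forall>g\<in>U. \<forall>F. (\<forall>\<^sub>F h in F. h \<in> Aut_ball) \<longrightarrow> locally_uniform_limit (ball 0 1) (\<lambda>h. h) g F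
        \<longrightarrow> (\<forall>\<^sub>F h in F. h \<in> U))"
proof -
  let ?P = "\<lambda>U :: ('a \<Rightarrow> 'a) set. U \<subseteq> Aut_ball \<and>
     (\<forall>g\<in>U. \<forall>F. (\<forall>\<^sub>F h in F. h \<in> Aut_ball) \<longrightarrow> locally_uniform_limit (ball 0 1) (\<lambda>h. h) g F
        \<longrightarrow> (\<forall>\<^sub>F h in F. h \<in> U))"
  have inter: "?P (U \<inter> V)" if "?P U" "?P V" for U V
    using that by (auto simp: eventually_conj_iff)
  have union: "?P (\<Union>\<K>)" if K: "\<forall>K\<in>\<K>. ?P K" for \<K>
  proof (intro conjI ballI allI impI)
    show "\<Union>\<K> \<subseteq> Aut_ball" using K by blast
  next
    fix g and F :: "('a \<Rightarrow> 'a) filter"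
    assume "g \<in> \<Union>\<K>" and F: "\<forall>\<^sub>F h in F. h \<in> Aut_ball"
      "locally_uniform_limit (ball 0 1) (\<lambda>h. h) g F"
    then obtain K where "K \<in> \<K>" "g \<in> K" by blast
    with K F have "\<forall>\<^sub>F h in F. h \<in> K" by blast
    then show "\<forall>\<^sub>F h in F. h \<in> \<Union>\<K>"
      by (rule eventually_mono) (use \<open>K \<in> \<K>\<close> in blast)
  qed
  have "istopology ?P"
    unfolding istopology_def using inter union by blast
  then show ?thesis
    unfolding Aut_top_def by (simp only: topology_inverse')
qed

lemma topspace_Aut_top: "topspace Aut_top = Aut_ball"
proof -
  have "openin Aut_top Aut_ball" by (simp add: openin_Aut_top)
  moreover have "U \<subseteq> Aut_ball" if "openin Aut_top U" for U :: "('a \<Rightarrow> 'a) set"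
    using that by (simp add: openin_Aut_top)
  ultimately show ?thesis unfolding topspace_def by blast
qed

definition Aut_ball_0 :: "('a::complex_banach \<Rightarrow> 'a) set" where
  "Aut_ball_0 = connected_component_of_set Aut_top (restrict id (ball 0 1))"

text \<open>
  The continuous extension of a map on the open unit ball to the closed unit ball, whenever
  there is one (as there is for automorphisms of the unit ball of a JB*-triple).
\<close>

definition cball_ext :: "('a::complex_banach \<Rightarrow> 'a) \<Rightarrow> 'a \<Rightarrow> 'a" where
  "cball_ext g x = (if x \<in> ball 0 1 then g x else Lim (at x within ball 0 1) g)"

definition orbit :: "'a::complex_banach \<Rightarrow> 'a set" where
  "orbit v = {cball_ext g v |g. g \<in> Aut_ball}"

definition orbit_0 :: "'a::complex_banach \<Rightarrow> 'a set" where
  "orbit_0 v = {cball_ext g v |g. g \<in> Aut_ball_0}"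

end

theory Submission
  imports Defs "HOL-Complex_Analysis.Complex_Analysis"
begin

text \<open>
Both inclusions rest on the fact that the open unit ball \<open>B\<close> is homogeneous, and homogeneous
under a very concrete family of maps.  For an element \<open>a\<close> consider the vector field
\<open>X a z = a - {z,a,z}\<close>.  If its flow preserves \<open>B\<close>, then the time-one maps of short flows and
their finite compositions (the set \<open>moves\<close>) are automorphisms of \<open>B\<close> that are
continuous on the closed ball, and scaling the fields to \<open>0\<close> joins each of them to the identity,
so they lie in the identity component.  They carry \<open>0\<close> to every point of \<open>B\<close>.

\<^item> Lower bound.  For a composition \<open>g\<close> of flow maps and \<open>v\<close> of norm one, the map
\<open>\<lambda> \<mapsto> g (\<lambda> v)\<close> is continuous on the closed unit disc and holomorphic inside, so
\<open>g 0\<close> is the mean of the points \<open>g (cis \<theta> v)\<close>, which all belong to the orbit of \<open>v\<close> under the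
identity component because rotations lie in that component (\<open>mean_value_in_convex_hull\<close>).
As \<open>g 0\<close> runs through \<open>B\<close>, the closed convex hull of the orbit contains \<open>B\<close>.

\<^item> Upper bound.  By Cartan's uniqueness theorem an automorphism fixing \<open>0\<close> is the restriction of
a linear contraction (\<open>Aut_ball_fixing_0_linear\<close>), so every automorphism is such a map followed
by a composition of flow maps; hence it extends continuously to the closed ball and maps it into
itself.

The substance is that field lines of \<open>X a\<close> that start in \<open>B\<close> never reach the unit sphere
(\<open>field_line_stays_in_ball\<close>).  This is seen on the Bergman operators, which send \<open>w\<close> to
\<open>w - 2 {z,z,w} + {z,{z,w,z},z}\<close> and are called \<open>bergman z\<close> below.  Write \<open>x \<box> y\<close> for the operator
\<open>w \<mapsto> {x,y,w}\<close>.

\<^item> Along a field line \<open>z t\<close> the Jordan identity shows that the derivative of \<open>P = bergman (z t)\<close> is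
\<open>- 2 (z \<box> a) P - 2 P (a \<box> z)\<close>, so invertibility propagates along the line
(\<open>bergman_invertible_along_path\<close>).

\<^item> The operator \<open>bergman z\<close> is invertible for \<open>norm z < 1\<close>: the segment from \<open>0\<close> to \<open>z\<close> is itself
an integral curve of fields \<open>X (a s)\<close> that depend on time, where \<open>a s\<close> is the sum of
\<open>s^(2k) z^(2k+1)\<close> over all \<open>k\<close> (\<open>radial_field\<close>).

\<^item> The operator \<open>bergman u\<close> is not even bounded below for \<open>norm u = 1\<close>
(\<open>bergman_not_bounded_below\<close>).  Put \<open>L = u \<box> u\<close> and \<open>Q w = {u,w,u}\<close>.  On the closed span of the
odd powers of \<open>u\<close> the operators \<open>L\<^sup>2\<close> and \<open>Q\<^sup>2\<close> agree, so \<open>bergman u\<close> is \<open>(1 - L)\<^sup>2\<close> there.  If it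
were bounded below, the spectral axiom would make \<open>1 - \<zeta> L\<close> boundedly invertible there for all \<open>\<zeta>\<close> in a
disc of radius greater than \<open>1\<close>, and Cauchy's estimates would give
\<open>norm (u^(2k+1)) \<le> C q^k\<close> with \<open>q < 1\<close> (\<open>odd_power_decay\<close>).  The operators
\<open>u^(2i+1) \<box> u^(2j+1)\<close> behave like the power means \<open>(\<alpha>^k + \<beta>^k) / 2\<close>, \<open>k = i + j + 1\<close>, of two roots
with \<open>\<alpha> + \<beta> = 2 L\<close> and \<open>\<alpha> \<beta> = Q\<^sup>2\<close>; expanding \<open>(\<alpha> + \<beta>)^n\<close> then bounds the powers of \<open>L\<close> by a
multiple of \<open>q^n\<close> (\<open>box_power_decay\<close>).  For a Hermitian operator this forces the norm to be at most
\<open>q\<close>, which is Sinclair's theorem, deduced from Bernstein's inequality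
(\<open>hermitian_norm_le_of_power_bound\<close>); but the norm of \<open>L\<close> is \<open>(norm u)\<^sup>2 = 1\<close>.
\<close>

section \<open>Linear functionals on complex Banach spaces\<close>

lemma scaleC_zero_left [simp]: "0 *\<^sub>C (x::'a::complex_banach) = 0"
  using scaleR_scaleC[of 0 x] by simp

lemma scaleC_minus_left: "(- a) *\<^sub>C (x::'a::complex_banach) = - (a *\<^sub>C x)"
  using scaleC_add_left[of "-a" a x] by (simp add: eq_neg_iff_add_eq_0)

lemma scaleC_minus_right: "a *\<^sub>C (- x) = - (a *\<^sub>C (x::'a::complex_banach))"
proof -
  have "a *\<^sub>C (0::'a) = 0"
    using norm_scaleC[of a "0::'a"] by simp
  then show ?thesis
    using scaleC_add_right[of a "-x" x] by (simp add: eq_neg_iff_add_eq_0)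
qed

lemma scaleC_scaleR: "a *\<^sub>C (r *\<^sub>R x) = r *\<^sub>R (a *\<^sub>C (x::'a::complex_banach))"
  by (simp add: scaleR_scaleC scaleC_scaleC mult.commute)

lemma scaleC_diff_right: "a *\<^sub>C (x - y) = a *\<^sub>C x - a *\<^sub>C (y::'a::complex_banach)"
  using scaleC_add_right[of a x "-y"] by (simp add: scaleC_minus_right)

lemma bounded_bilinear_scaleC: "bounded_bilinear (\<lambda>a (x::'a::complex_banach). a *\<^sub>C x)"
proof
  show "\<exists>K. \<forall>a (b::'a). norm (a *\<^sub>C b) \<le> norm a * norm b * K"
    by (rule exI[of _ 1]) (simp add: norm_scaleC)
  fix r a and b :: 'a
  show "(r *\<^sub>R a) *\<^sub>C b = r *\<^sub>R (a *\<^sub>C b)"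
    by (simp add: scaleR_scaleC scaleC_scaleC scaleR_conv_of_real)
qed (simp_all add: scaleC_add_left scaleC_add_right scaleC_scaleR)

lemma bounded_linear_scaleC_right: "bounded_linear (\<lambda>x::'a::complex_banach. a *\<^sub>C x)"
  by (rule bounded_bilinear.bounded_linear_right[OF bounded_bilinear_scaleC])

text \<open>
Complex linear functionals of norm at most one.  They reduce statements about holomorphic
functions with values in a Banach space to scalar complex analysis.
\<close>

definition "cfunctional f \<longleftrightarrow> (\<forall>x y. f (x + y) = f x + f y) \<and>
   (\<forall>c x. f (c *\<^sub>C x) = c * f x) \<and> (\<forall>x::'a::complex_banach. cmod (f x) \<le> norm x)"

text \<open>
One step of the Hahn--Banach extension.  A functional that is only defined on a subspace is given by
its graph, a linear subspace of the product with the reals; the bound \<open>r \<le> norm x\<close> on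
the graph already makes it single-valued.  An admissible value at the new point is any number
between the supremum of \<open>s - norm (y - x0)\<close> and the infimum of \<open>norm (z + x0) - r\<close>.
\<close>

lemma real_extension_step:
  fixes G :: "('a::real_normed_vector \<times> real) set"
  assumes sub: "subspace G" and bnd: "\<And>x r. (x, r) \<in> G \<Longrightarrow> r \<le> norm x"
  obtains \<xi> where "\<And>x r. (x, r) \<in> span (insert (x0, \<xi>) G) \<Longrightarrow> r \<le> norm x"
proof -
  define A where "A = {s - norm (y - x0) |y s. (y, s) \<in> G}"
  have zero: "(0, 0) \<in> G"
    using subspace_0[OF sub] by (simp add: zero_prod_def)
  have key: "s - norm (y - x0) \<le> norm (z + x0) - r" if "(y, s) \<in> G" "(z, r) \<in> G" for y s z r
  proof -
    have "(y + z, s + r) \<in> G"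
      using subspace_add[OF sub that] by simp
    then have "s + r \<le> norm (y + z)"
      by (rule bnd)
    also have "\<dots> \<le> norm (y - x0) + norm (z + x0)"
      using norm_triangle_ineq[of "y - x0" "z + x0"] by simp
    finally show ?thesis by linarith
  qed
  have A_bdd: "bdd_above A" and A_ne: "A \<noteq> {}"
    using key zero unfolding A_def bdd_above_def by blast+
  define \<xi> where "\<xi> = Sup A"
  have lo: "s - norm (y - x0) \<le> \<xi>" if "(y, s) \<in> G" for y s
    unfolding \<xi>_def by (rule cSup_upper[OF _ A_bdd]) (use that A_def in blast)
  have hi: "\<xi> \<le> norm (z + x0) - r" if "(z, r) \<in> G" for z r
    unfolding \<xi>_def by (rule cSup_least[OF A_ne]) (use key that A_def in blast)
  have "r \<le> norm x" if mem: "(x, r) \<in> span (insert (x0, \<xi>) G)" for x r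
  proof -
    obtain k where "(x, r) - k *\<^sub>R (x0, \<xi>) \<in> span G"
      using mem by (auto simp: span_insert)
    then have k: "(x - k *\<^sub>R x0, r - k * \<xi>) \<in> G"
      using sub by (simp add: span_eq_iff[THEN iffD2])
    define y s where "y = x - k *\<^sub>R x0" and "s = r - k * \<xi>"
    have ys: "(c *\<^sub>R y, c * s) \<in> G" for c
      using subspace_scale[OF sub k, of c] by (simp add: y_def s_def)
    consider "k = 0" | "k > 0" | "k < 0" by linarith
    then show ?thesis
    proof cases
      case 1
      then show ?thesis using bnd[OF k] by simp
    next
      case 2
      have "k * \<xi> \<le> k * (norm ((1/k) *\<^sub>R y + x0) - (1/k) * s)"
        using hi[OF ys, of "1/k"] 2 by (intro mult_left_mono) auto
      also have "\<dots> = norm (k *\<^sub>R ((1/k) *\<^sub>R y + x0)) - s"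
        using 2 by (simp add: right_diff_distrib del: scaleR_right_distrib)
      also have "k *\<^sub>R ((1/k) *\<^sub>R y + x0) = x"
        using 2 by (simp add: y_def scaleR_right_distrib)
      finally show ?thesis by (simp add: s_def)
    next
      case 3
      have "(-k) * ((-1/k) * s - norm ((-1/k) *\<^sub>R y - x0)) \<le> (-k) * \<xi>"
        using lo[OF ys, of "-1/k"] 3 by (intro mult_left_mono) auto
      also have "(-k) * ((-1/k) * s - norm ((-1/k) *\<^sub>R y - x0))
          = s - norm ((-k) *\<^sub>R ((-1/k) *\<^sub>R y - x0))"
        using 3 by (simp add: right_diff_distrib del: scaleR_right_diff_distrib)
      also have "(-k) *\<^sub>R ((-1/k) *\<^sub>R y - x0) = x"
        using 3 by (simp add: y_def scaleR_right_diff_distrib)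
      finally show ?thesis by (simp add: s_def)
    qed
  qed
  then show thesis by (rule that)
qed

text \<open>
Zorn's lemma on graphs.  A maximal graph is total, since otherwise
\<open>real_extension_step\<close> would enlarge it.
\<close>

lemma real_norming_functional:
  fixes x0 :: "'a::real_normed_vector"
  obtains f :: "'a \<Rightarrow> real" where "linear f" "\<And>x. f x \<le> norm x" "f x0 = norm x0"
proof -
  define \<G> where "\<G> = {G :: ('a \<times> real) set. subspace G \<and> (x0, norm x0) \<in> G \<and>
     (\<forall>x r. (x, r) \<in> G \<longrightarrow> r \<le> norm x)}"
  have start: "span {(x0, norm x0)} \<in> \<G>"
  proof -
    have "r \<le> norm x" if mem: "(x, r) \<in> span {(x0, norm x0)}" for x r
    proof -
      obtain k where "x = k *\<^sub>R x0" "r = k * norm x0"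
        using mem by (auto simp: span_singleton)
      then show ?thesis by (simp add: mult_right_mono)
    qed
    then show ?thesis unfolding \<G>_def by (auto intro: span_base)
  qed
  have "\<exists>M\<in>\<G>. \<forall>X\<in>\<G>. M \<subseteq> X \<longrightarrow> X = M"
  proof (rule subset_Zorn_nonempty)
    show "\<G> \<noteq> {}" using start by blast
  next
    fix \<C> assume ne: "\<C> \<noteq> {}" and ch: "subset.chain \<G> \<C>"
    then have in\<G>: "\<And>G. G \<in> \<C> \<Longrightarrow> G \<in> \<G>"
      unfolding subset_chain_def by blast
    have two: "\<exists>G\<in>\<C>. a \<in> G \<and> b \<in> G" if "a \<in> \<Union>\<C>" "b \<in> \<Union>\<C>" for a b
      using that ch unfolding subset_chain_def by blast
    have "subspace (\<Union>\<C>)"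
    proof (rule subspaceI)
      show "0 \<in> \<Union>\<C>"
        using ne in\<G> subspace_0 unfolding \<G>_def by blast
      show "x + y \<in> \<Union>\<C>" if "x \<in> \<Union>\<C>" "y \<in> \<Union>\<C>" for x y
        using two[OF that] in\<G> subspace_add unfolding \<G>_def by blast
      show "c *\<^sub>R x \<in> \<Union>\<C>" if "x \<in> \<Union>\<C>" for c x
        using that in\<G> subspace_scale unfolding \<G>_def by blast
    qed
    then show "\<Union>\<C> \<in> \<G>"
      using ne in\<G> unfolding \<G>_def by blast
  qed
  then obtain G where G: "G \<in> \<G>" and max: "\<And>X. X \<in> \<G> \<Longrightarrow> G \<subseteq> X \<Longrightarrow> X = G"
    by blast
  have sub: "subspace G" and x0: "(x0, norm x0) \<in> G" and bnd: "\<And>x r. (x, r) \<in> G \<Longrightarrow> r \<le> norm x"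
    using G unfolding \<G>_def by auto
  have total: "\<exists>r. (x, r) \<in> G" for x
  proof -
    obtain \<xi> where \<xi>: "\<And>y r. (y, r) \<in> span (insert (x, \<xi>) G) \<Longrightarrow> r \<le> norm y"
      using real_extension_step[OF sub bnd] by metis
    have "G \<subseteq> span (insert (x, \<xi>) G)"
      by (meson span_superset subset_insertI subset_trans)
    moreover have "span (insert (x, \<xi>) G) \<in> \<G>"
      unfolding \<G>_def using \<xi> x0 span_superset by blast
    ultimately have "span (insert (x, \<xi>) G) = G"
      using max by blast
    then show ?thesis by (metis insertI1 span_base)
  qed
  have unique: "r = s" if "(x, r) \<in> G" "(x, s) \<in> G" for x r s
    using bnd[of 0 "r - s"] bnd[of 0 "s - r"] subspace_diff[OF sub that]
      subspace_diff[OF sub that(2,1)] by simp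
  define f where "f x = (SOME r. (x, r) \<in> G)" for x
  have f: "(x, f x) \<in> G" for x
    unfolding f_def using total by (rule someI_ex)
  show thesis
  proof (rule that)
    show "linear f"
    proof (rule linearI)
      show "f (x + y) = f x + f y" for x y
        using unique[OF f] subspace_add[OF sub f f, of x y] by auto
      show "f (c *\<^sub>R x) = c *\<^sub>R f x" for c x
        using unique[OF f] subspace_scale[OF sub f, of c x] by auto
    qed
    show "f x \<le> norm x" for x using bnd[OF f] .
    show "f x0 = norm x0" using unique[OF f x0] .
  qed
qed

text \<open>
The complex functional is recovered from its real part \<open>f\<close> as
\<open>f x - \<i> f (\<i> x)\<close>; rotating \<open>x\<close> so that the value becomes real shows that the
bound is inherited.
\<close>

lemma norming_functional:
  fixes x0 :: "'a::complex_banach"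
  obtains \<phi> where "cfunctional \<phi>" "\<phi> x0 = norm x0"
proof -
  obtain f where f: "linear f" "\<And>x::'a. f x \<le> norm x" "f x0 = norm x0"
    using real_norming_functional by blast
  define \<phi> where "\<phi> x = Complex (f x) (- f (\<i> *\<^sub>C x))" for x
  have add: "\<phi> (x + y) = \<phi> x + \<phi> y" for x y
    by (simp add: \<phi>_def scaleC_add_right linear_add[OF f(1)] complex_eq_iff)
  have scale: "\<phi> (c *\<^sub>C x) = c * \<phi> x" for c x
  proof -
    have c: "c *\<^sub>C y = Re c *\<^sub>R y + Im c *\<^sub>R (\<i> *\<^sub>C y)" for y :: 'a
    proof -
      have "c *\<^sub>C y = (complex_of_real (Re c) + complex_of_real (Im c) * \<i>) *\<^sub>C y"
        using complex_eq[of c] by (simp add: mult.commute)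
      then show ?thesis by (simp add: scaleC_add_left scaleR_scaleC scaleC_scaleC)
    qed
    have "\<i> *\<^sub>C (\<i> *\<^sub>C y) = - y" for y :: 'a
      using scaleC_minus_left[of 1 y] by (simp add: scaleC_scaleC scaleC_one)
    then have ic: "\<i> *\<^sub>C (c *\<^sub>C x) = Re c *\<^sub>R (\<i> *\<^sub>C x) - Im c *\<^sub>R x"
      unfolding c by (simp add: scaleC_add_right scaleC_scaleR)
    show ?thesis
      unfolding \<phi>_def ic
      by (simp add: c linear_add[OF f(1)] linear_diff[OF f(1)] linear_cmul[OF f(1)] complex_eq_iff)
  qed
  have bound: "cmod (\<phi> x) \<le> norm x" for x
  proof (cases "\<phi> x = 0")
    case False
    define c where "c = cnj (\<phi> x) / cmod (\<phi> x)"
    have "\<phi> (c *\<^sub>C x) = cmod (\<phi> x)"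
      using False complex_norm_square[of "\<phi> x"]
      by (simp add: scale c_def field_simps power2_eq_square)
    then have "cmod (\<phi> x) = f (c *\<^sub>C x)"
      by (simp add: \<phi>_def complex_eq_iff)
    also have "\<dots> \<le> norm (c *\<^sub>C x)" by (rule f)
    also have "\<dots> = norm x"
      using False by (simp add: norm_scaleC c_def norm_divide)
    finally show ?thesis .
  qed simp
  show thesis
  proof (rule that)
    show cf: "cfunctional \<phi>" using add scale bound by (simp add: cfunctional_def)
    have re: "Re (\<phi> x0) = norm x0" by (simp add: \<phi>_def f)
    moreover have "cmod (\<phi> x0) \<le> norm x0" by (rule bound)
    ultimately have "(norm x0)\<^sup>2 + (Im (\<phi> x0))\<^sup>2 \<le> (norm x0)\<^sup>2"
      by (metis cmod_power2 norm_ge_zero power_mono)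
    then have "Im (\<phi> x0) = 0" by simp
    then show "\<phi> x0 = norm x0" using re by (simp add: complex_eq_iff)
  qed
qed

lemma cfunctional_add: "cfunctional \<phi> \<Longrightarrow> \<phi> (x + y) = \<phi> x + \<phi> y"
  and cfunctional_scaleC: "cfunctional \<phi> \<Longrightarrow> \<phi> (c *\<^sub>C x) = c * \<phi> x"
  and cfunctional_bound: "cfunctional \<phi> \<Longrightarrow> cmod (\<phi> x) \<le> norm x"
  by (auto simp: cfunctional_def)

lemma cfunctional_bounded_linear: "cfunctional \<phi> \<Longrightarrow> bounded_linear \<phi>"
proof (rule bounded_linear_intro[where K = 1])
  assume \<phi>: "cfunctional \<phi>"
  show "\<phi> (r *\<^sub>R x) = r *\<^sub>R \<phi> x" for r x
    using cfunctional_scaleC[OF \<phi>, of "of_real r" x]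
    by (simp add: scaleR_scaleC scaleR_conv_of_real[where 'a=complex])
qed (simp_all add: cfunctional_add cfunctional_bound)

lemma norm_le_by_functionals:
  assumes "\<And>\<phi>. cfunctional \<phi> \<Longrightarrow> cmod (\<phi> x) \<le> K"
  shows "norm (x::'a::complex_banach) \<le> K"
proof -
  obtain \<phi> where "cfunctional \<phi>" "\<phi> x = norm x"
    using norming_functional by blast
  then show ?thesis using assms[of \<phi>] by simp
qed

section \<open>Bernstein's inequality\<close>

text \<open>
The sum over odd numbers is the full sum \<open>pi\<^sup>2 / 6\<close> minus its even part, which is a quarter of it.
\<close>

lemma sum_odd_inverse_squares_le: "(\<Sum>k<N. 1 / (2 * real k + 1)\<^sup>2) \<le> pi\<^sup>2 / 8"
proof -
  define O' where "O' n = (\<Sum>k<n. 1 / (2 * real k + 1)\<^sup>2)" for n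
  define H where "H n = (\<Sum>k<n. 1 / (real k + 1)\<^sup>2)" for n
  have H: "H \<longlonglongrightarrow> pi\<^sup>2 / 6"
    using inverse_squares_sums unfolding sums_def H_def by (simp add: add.commute)
  have O_eq: "O' n = H (2 * n) - H n / 4" for n
  proof (induction n)
    case (Suc n)
    have "(2 * real n + 2)\<^sup>2 = 4 * (real n + 1)\<^sup>2"
      by (simp add: power2_eq_square algebra_simps)
    then have "H (2 * Suc n) - H (Suc n) / 4 = (H (2 * n) - H n / 4) + 1 / (2 * real n + 1)\<^sup>2"
      by (simp add: H_def add.commute add_divide_distrib)
    then show ?case using Suc by (simp add: O'_def)
  qed (simp add: O'_def H_def)
  have "(\<lambda>n. H (2 * n) - H n / 4) \<longlonglongrightarrow> pi\<^sup>2 / 6 - (pi\<^sup>2 / 6) / 4"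
    using LIMSEQ_subseq_LIMSEQ[OF H, of "\<lambda>n. 2 * n"]
    by (intro tendsto_intros H) (auto simp: strict_mono_def o_def)
  then have "O' \<longlonglongrightarrow> pi\<^sup>2 / 8"
    unfolding O_eq[symmetric] by (simp add: field_simps)
  moreover have "incseq O'"
    unfolding O'_def by (rule incseq_SucI) simp
  ultimately show ?thesis
    using incseq_le[of O' "pi\<^sup>2 / 8" N] by (simp add: O'_def)
qed

text \<open>
The two cases are the horizontal and the vertical sides of the squares with half side
\<open>N * pi\<close> on which the contour integral below is estimated.
\<close>

lemma cmod_cos_lower_bound:
  assumes "1 \<le> \<bar>Im z\<bar> \<or> cos (Re z) ^ 2 = 1"
  shows "exp \<bar>Im z\<bar> / 4 \<le> cmod (cos z)"
proof -
  define e where "e = exp \<bar>Im z\<bar>"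
  have e: "1 \<le> e" by (simp add: e_def)
  have sq: "(exp (Im z) - inverse (exp (Im z)))\<^sup>2 = (e - inverse e)\<^sup>2"
    by (cases "Im z \<ge> 0") (auto simp: e_def exp_minus power2_commute)
  have n: "(cmod (cos z))\<^sup>2 = (cos (Re z))\<^sup>2 + (e - inverse e)\<^sup>2 / 4"
    by (simp add: norm_cos_squared sq)
  have ie: "e * inverse e = 1" "0 < inverse e" "inverse e \<le> 1"
    using e by (auto simp: field_simps)
  have "(e / 4)\<^sup>2 \<le> (cos (Re z))\<^sup>2 + (e - inverse e)\<^sup>2 / 4"
    using assms
  proof
    assume "1 \<le> \<bar>Im z\<bar>"
    then have "2 \<le> e"
      using exp_ge_add_one_self[of "\<bar>Im z\<bar>"] unfolding e_def by linarith
    then have "e / 2 \<le> e - inverse e" using ie by linarith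
    then have "(e / 2)\<^sup>2 \<le> (e - inverse e)\<^sup>2" using e by (intro power_mono) auto
    then have "(e / 4)\<^sup>2 \<le> (e - inverse e)\<^sup>2 / 4" by (simp add: power_divide)
    then show ?thesis using zero_le_power2[of "cos (Re z)"] by linarith
  next
    assume c: "(cos (Re z))\<^sup>2 = 1"
    have "(e - inverse e)\<^sup>2 = e\<^sup>2 - 2 + (inverse e)\<^sup>2"
      using ie by (simp add: power2_eq_square algebra_simps)
    moreover have "(e / 4)\<^sup>2 = e\<^sup>2 / 16" by (simp add: power_divide)
    ultimately show ?thesis using c zero_le_power2[of e] zero_le_power2[of "inverse e"]
      by linarith
  qed
  then have "(e / 4)\<^sup>2 \<le> (cmod (cos z))\<^sup>2" using n by simp
  then show ?thesis using e unfolding e_def by (meson norm_ge_zero power2_le_imp_le)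
qed

lemma contour_integral_rectpath_bound:
  assumes "f contour_integrable_on rectpath a b" "0 \<le> B"
    and "\<And>z. z \<in> path_image (rectpath a b) \<Longrightarrow> cmod (f z) \<le> B"
    and "Re a \<le> Re b" "Im a \<le> Im b"
  shows "cmod (contour_integral (rectpath a b) f) \<le> B * (2 * (Re b - Re a) + 2 * (Im b - Im a))"
proof -
  define a2 a4 where "a2 = Complex (Re b) (Im a)" and "a4 = Complex (Re a) (Im b)"
  have rp: "rectpath a b = linepath a a2 +++ linepath a2 b +++ linepath b a4 +++ linepath a4 a"
    by (simp add: rectpath_def Let_def a2_def a4_def)
  have int: "f contour_integrable_on linepath a a2" "f contour_integrable_on linepath a2 b"
    "f contour_integrable_on linepath b a4" "f contour_integrable_on linepath a4 a"
    using assms(1) unfolding rp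
    by (auto dest: contour_integrable_joinD1 contour_integrable_joinD2)
  have im: "path_image (rectpath a b) = closed_segment a a2 \<union> closed_segment a2 b
      \<union> closed_segment b a4 \<union> closed_segment a4 a"
    unfolding rp by (simp add: path_image_join Un_assoc)
  have "contour_integral (rectpath a b) f = contour_integral (linepath a a2) f
     + contour_integral (linepath a2 b) f + contour_integral (linepath b a4) f
     + contour_integral (linepath a4 a) f"
    unfolding rp using int by simp
  also have "cmod \<dots> \<le> B * norm (a2 - a) + B * norm (b - a2) + B * norm (a4 - b) + B * norm (a - a4)"
    using int assms(2,3) unfolding im
    by (intro norm_triangle_mono contour_integral_bound_linepath) auto
  also have "\<dots> = B * (2 * (Re b - Re a) + 2 * (Im b - Im a))"
  proof -
    have "norm (a2 - a) = Re b - Re a" "norm (a4 - b) = Re b - Re a"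
      "norm (b - a2) = Im b - Im a" "norm (a - a4) = Im b - Im a"
      using assms(4,5) by (auto simp: a2_def a4_def cmod_def)
    then show ?thesis by (simp only:) (simp add: algebra_simps)
  qed
  finally show ?thesis .
qed

text \<open>
Integrate \<open>f z / (z\<^sup>2 cos z)\<close> over the boundary of the square with half side \<open>N * pi\<close>.
The growth of \<open>cos\<close> beats that of \<open>f\<close>, so the integral tends to \<open>0\<close>.  The residue
at \<open>0\<close> is \<open>f' 0\<close>, and the residue at a zero \<open>t\<close> of \<open>cos\<close> is
\<open>f t / t\<^sup>2\<close> up to sign.  Hence \<open>f' 0\<close> is a combination of values of \<open>f\<close> on the real
line whose coefficients \<open>1 / t\<^sup>2\<close> sum to \<open>1\<close>.
\<close>

lemma bernstein_inequality:
  fixes f :: "complex \<Rightarrow> complex"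
  assumes hol: "f holomorphic_on UNIV"
    and growth: "\<And>z. cmod (f z) \<le> C * exp \<bar>Im z\<bar>"
    and real_le: "\<And>x::real. cmod (f (of_real x)) \<le> 1"
  shows "cmod (deriv f 0) \<le> 1"
proof -
  have C0: "0 \<le> C"
    using order_trans[OF norm_ge_zero growth[of 0]] by simp
  \<comment> \<open>its poles are \<open>0\<close> and the zeros \<open>p k\<close>, \<open>- p k\<close> of \<open>cos\<close>\<close>
  define g where "g z = (f z / cos z) / z\<^sup>2" for z
  define p where "p k = complex_of_real ((real k + 1/2) * pi)" for k :: nat
  have cosp: "cos (p k) = 0" "cos (- p k) = 0" for k
  proof -
    have "p k = complex_of_real (of_int (int k) * pi) + of_real pi / 2"
      by (simp add: p_def algebra_simps)
    then show "cos (p k) = 0" unfolding cos_eq_0 by blast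
    then show "cos (- p k) = 0" by simp
  qed
  have cos0: "\<exists>k. z = p k \<or> z = - p k" if "cos z = 0" for z
  proof -
    obtain n :: int where n: "z = complex_of_real (n * pi) + of_real pi / 2"
      using \<open>cos z = 0\<close> unfolding cos_eq_0 by blast
    show ?thesis
    proof (cases "n \<ge> 0")
      case True
      then have "z = p (nat n)" by (simp add: n p_def algebra_simps)
      then show ?thesis by blast
    next
      case False
      then have "z = - p (nat (- n - 1))" by (simp add: n p_def algebra_simps)
      then show ?thesis by blast
    qed
  qed
  have p_inj: "p k = p j \<longleftrightarrow> k = j" "p k \<noteq> - p j" "p k \<noteq> 0" for k j
  proof -
    show "p k = p j \<longleftrightarrow> k = j" by (auto simp: p_def of_real_eq_iff simp del: of_real_mult of_real_add)
    have pos: "0 < (real i + 1/2) * pi" for i by (simp add: add_pos_pos)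
    show "p k \<noteq> - p j"
      using pos[of k] pos[of j] unfolding p_def of_real_minus[symmetric] of_real_eq_iff by linarith
    show "p k \<noteq> 0"
      using pos[of k] unfolding p_def of_real_eq_0_iff by linarith
  qed
  have g_hol: "g holomorphic_on S" if "\<And>z. z \<in> S \<Longrightarrow> z \<noteq> 0 \<and> cos z \<noteq> 0" for S
    unfolding g_def using that by (intro holomorphic_intros holomorphic_on_subset[OF hol]) auto
  have res0: "residue g 0 = deriv f 0"
  proof -
    have cne: "cos z \<noteq> 0" if "z \<in> ball 0 1" for z :: complex
    proof
      assume "cos z = 0"
      then obtain k where k: "z = p k \<or> z = - p k" using cos0 by blast
      have "1 \<le> (real k + 1/2) * pi"
        using pi_gt3 mult_right_mono[of "1/2" "real k + 1/2" pi] by linarith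
      then have "1 \<le> cmod (p k)" unfolding p_def norm_of_real by linarith
      then show False using that k by auto
    qed
    have h: "(\<lambda>z. f z / cos z) holomorphic_on ball 0 1"
      using cne by (intro holomorphic_intros holomorphic_on_subset[OF hol]) auto
    have "residue g 0 = (deriv ^^ 1) (\<lambda>z. f z / cos z) 0 / fact 1"
      using residue_holomorphic_over_power'[OF _ _ h, of 1]
      by (simp add: g_def[abs_def] power2_eq_square)
    also have "\<dots> = deriv (\<lambda>z. f z / cos z) 0" by simp
    also have "\<dots> = deriv f 0"
    proof (rule DERIV_imp_deriv)
      have "(f has_field_derivative deriv f 0) (at 0)"
        using hol by (simp add: holomorphic_derivI)
      then show "((\<lambda>z. f z / cos z) has_field_derivative deriv f 0) (at 0)"
        by (auto intro!: derivative_eq_intros)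
    qed
    finally show ?thesis .
  qed
  have resp: "cmod (residue g t) \<le> 4 / pi\<^sup>2 * (1 / (2 * real k + 1)\<^sup>2)" if t: "t = p k \<or> t = - p k" for t k
  proof -
    have ct: "cos t = 0" and t0: "t \<noteq> 0" using t cosp p_inj by auto
    have st: "cmod (sin t) = 1"
    proof -
      have "sin t ^ 2 = 1" using sin_cos_squared_add[of t] ct by simp
      then show ?thesis by (metis norm_one norm_power power2_eq_1_iff norm_minus_cancel)
    qed
    have ne: "z \<noteq> 0 \<and> cos z \<noteq> 0" if z: "z \<in> ball t 1 - {t}" for z
    proof -
      have away: "1 \<le> \<bar>x * pi\<bar>" if "\<bar>x\<bar> \<ge> 1/2" for x
        using that pi_gt3 mult_mono[of "1/2" "\<bar>x\<bar>" 3 pi] by (simp add: abs_mult)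
      have pr: "cmod (p i - p j) = \<bar>(real i - real j) * pi\<bar>"
        "cmod (p i + p j) = \<bar>(real i + real j + 1) * pi\<bar>"
        "cmod (p i) = \<bar>(real i + 1/2) * pi\<bar>" for i j
        unfolding p_def of_real_diff[symmetric] of_real_add[symmetric] norm_of_real
        by (auto simp: algebra_simps)
      have 1: "i = j \<or> 1 \<le> cmod (p i - p j)" for i j
      proof (cases "i = j")
        case False
        then have "1 \<le> \<bar>real i - real j\<bar>" by linarith
        then show ?thesis unfolding pr by (intro disjI2 away) linarith
      qed simp
      have 2: "1 \<le> cmod (p i + p j)" for i j
        unfolding pr by (rule away) auto
      have 3: "1 \<le> cmod (p i)" for i unfolding pr by (rule away) auto
      have "z \<noteq> 0" using z t 3[of k] by (auto simp: dist_norm)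
      moreover have "cos z \<noteq> 0"
      proof
        assume "cos z = 0"
        then obtain j where "z = p j \<or> z = - p j" using cos0 by blast
        moreover have "cmod (- p k - p j) = cmod (p k + p j)" "cmod (- p k + p j) = cmod (p k - p j)"
          using norm_minus_cancel[of "p k + p j"] norm_minus_cancel[of "p k - p j"] by simp_all
        ultimately show False
          using z t 1[of k j] 2[of k j] by (auto simp: dist_norm)
      qed
      ultimately show ?thesis by blast
    qed
    have lim: "((\<lambda>w. g w * (w - t)) \<longlongrightarrow> f t / (t\<^sup>2 * (- sin t))) (at t)"
    proof -
      have "((\<lambda>w. (cos w - cos t) / (w - t)) \<longlongrightarrow> - sin t) (at t)"
        using DERIV_cos[of t] by (simp add: has_field_derivative_iff)
      then have "((\<lambda>w. cos w / (w - t)) \<longlongrightarrow> - sin t) (at t)" using ct by simp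
      moreover have "(f \<longlongrightarrow> f t) (at t)"
        using hol by (metis UNIV_I continuous_on_eq_continuous_at holomorphic_on_imp_continuous_on
            isContD open_UNIV)
      ultimately have "((\<lambda>w. f w / (w\<^sup>2 * (cos w / (w - t)))) \<longlongrightarrow> f t / (t\<^sup>2 * (- sin t))) (at t)"
        using t0 st by (intro tendsto_intros) auto
      then show ?thesis
        by (rule Lim_transform_eventually) (auto simp: eventually_at_filter g_def field_simps)
    qed
    have "residue g t = f t / (t\<^sup>2 * (- sin t))"
      by (rule residue_simple'[of "ball t 1"]) (use lim g_hol[of "ball t 1 - {t}"] ne in auto)
    then have "cmod (residue g t) = cmod (f t) / (cmod t)\<^sup>2"
      by (simp add: norm_divide norm_mult norm_power st)
    also have "\<dots> \<le> 1 / (cmod t)\<^sup>2"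
    proof (rule divide_right_mono)
      show "cmod (f t) \<le> 1"
        using t real_le[of "(real k + 1/2) * pi"] real_le[of "- ((real k + 1/2) * pi)"]
        unfolding p_def of_real_minus by metis
    qed simp
    also have "(cmod t)\<^sup>2 = ((2 * real k + 1) * (pi / 2))\<^sup>2"
    proof -
      have "cmod t = \<bar>(2 * real k + 1) * (pi / 2)\<bar>"
      proof -
        have "cmod t = \<bar>(real k + 1/2) * pi\<bar>"
          using t unfolding p_def by (metis norm_minus_cancel norm_of_real)
        then show ?thesis by (simp add: field_simps)
      qed
      then show ?thesis by (simp only: power2_abs)
    qed
    also have "1 / ((2 * real k + 1) * (pi / 2))\<^sup>2 = 4 / pi\<^sup>2 * (1 / (2 * real k + 1)\<^sup>2)"
      by (simp add: power_mult_distrib power_divide)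
    finally show ?thesis .
  qed
  have main: "cmod (deriv f 0) \<le> 1 + (32 * C / pi) / real N" if N: "N \<ge> 1" for N :: nat
  proof -
    define R where "R = real N * pi"
    have R: "R \<ge> 1" "R > 0"
    proof -
      have "1 * 1 \<le> real N * pi" using N pi_gt3 by (intro mult_mono) auto
      then show "R \<ge> 1" "R > 0" by (simp_all add: R_def)
    qed
    define P where "P = p ` {..<N} \<union> (\<lambda>k. - p k) ` {..<N}"
    define S where "S = box (Complex (- (R+1)) (- (R+1))) (Complex (R+1) (R+1))"
    define \<gamma> where "\<gamma> = rectpath (Complex (- R) (- R)) (Complex R R)"
    have p_in: "k < N" if "\<bar>(real k + 1/2) * pi\<bar> < R + 1" for k
    proof (rule ccontr)
      assume "\<not> k < N"
      then have "real N * pi \<le> real k * pi" by (intro mult_right_mono) auto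
      moreover have "(real k + 1/2) * pi = real k * pi + pi / 2" by (simp add: algebra_simps)
      ultimately show False using that pi_gt3 unfolding R_def by linarith
    qed
    have p_lt: "(real k + 1/2) * pi < R" if "k < N" for k
      unfolding R_def using that by (intro mult_strict_right_mono) auto
    have hol_g: "g holomorphic_on S - insert 0 P"
    proof (rule g_hol)
      fix z assume z: "z \<in> S - insert 0 P"
      have "cos z \<noteq> 0"
      proof
        assume "cos z = 0"
        then obtain k where k: "z = p k \<or> z = - p k" using cos0 by blast
        then have "\<bar>(real k + 1/2) * pi\<bar> < R + 1"
          using z unfolding S_def p_def by (auto simp: in_box_complex_iff)
        then have "k < N" by (rule p_in)
        then show False using k z unfolding P_def by blast
      qed
      then show "z \<noteq> 0 \<and> cos z \<noteq> 0" using z by blast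
    qed
    have img: "path_image \<gamma> \<subseteq> S" "\<And>z. z \<in> path_image \<gamma> \<Longrightarrow> \<bar>Re z\<bar> = R \<or> \<bar>Im z\<bar> = R"
      using R unfolding \<gamma>_def S_def
      by (auto simp: path_image_rectpath_cbox_minus_box in_box_complex_iff in_cbox_complex_iff)
    have inbox: "t \<in> box (Complex (- R) (- R)) (Complex R R)" if "t \<in> insert 0 P" for t
    proof -
      have pos: "0 < (real k + 1/2) * pi" for k by (simp add: add_pos_pos)
      show ?thesis
        using that R unfolding P_def p_def in_box_complex_iff
        by (auto simp del: of_real_mult of_real_add) (use p_lt pos in \<open>smt (verit)\<close>)+
    qed
    have disj: "path_image \<gamma> \<subseteq> S - insert 0 P"
      using inbox img(1) R unfolding \<gamma>_def by (auto simp: path_image_rectpath_cbox_minus_box)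
    have wn: "winding_number \<gamma> t = 1" if "t \<in> insert 0 P" for t
      unfolding \<gamma>_def using inbox[OF that] by (rule winding_number_rectpath)
    have outside: "\<forall>z. z \<notin> S \<longrightarrow> winding_number \<gamma> z = 0"
      unfolding \<gamma>_def S_def using R
      by (auto intro!: winding_number_rectpath_outside simp: in_box_complex_iff in_cbox_complex_iff)
    have finP: "finite (insert 0 P)" by (simp add: P_def)
    have 0: "0 \<notin> P" using p_inj by (auto simp: P_def)
    have "contour_integral \<gamma> g = 2 * pi * \<i> * (\<Sum>t\<in>insert 0 P. winding_number \<gamma> t * residue g t)"
      by (rule Residue_theorem[OF _ _ finP hol_g _ _ disj outside])
         (auto simp: S_def \<gamma>_def convex_connected)
    also have "(\<Sum>t\<in>insert 0 P. winding_number \<gamma> t * residue g t) = deriv f 0 + (\<Sum>t\<in>P. residue g t)"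
      using wn 0 finP by (simp add: res0)
    finally have ci: "contour_integral \<gamma> g = 2 * pi * \<i> * (deriv f 0 + (\<Sum>t\<in>P. residue g t))" .
    have sumP: "cmod (\<Sum>t\<in>P. residue g t) \<le> 1"
    proof -
      have dis: "p ` {..<N} \<inter> (\<lambda>k. - p k) ` {..<N} = {}" using p_inj by auto
      have "(\<Sum>t\<in>P. residue g t) = (\<Sum>k<N. residue g (p k)) + (\<Sum>k<N. residue g (- p k))"
        unfolding P_def using p_inj
        by (subst sum.union_disjoint[OF _ _ dis]) (auto simp: sum.reindex inj_on_def)
      also have "cmod \<dots> \<le> (\<Sum>k<N. 4 / pi\<^sup>2 * (1 / (2 * real k + 1)\<^sup>2))
          + (\<Sum>k<N. 4 / pi\<^sup>2 * (1 / (2 * real k + 1)\<^sup>2))"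
        using resp by (intro norm_triangle_mono sum_norm_le) auto
      also have "\<dots> = 8 / pi\<^sup>2 * (\<Sum>k<N. 1 / (2 * real k + 1)\<^sup>2)"
        by (simp add: sum_distrib_left flip: sum.distrib)
      also have "\<dots> \<le> 8 / pi\<^sup>2 * (pi\<^sup>2 / 8)"
        by (intro mult_left_mono sum_odd_inverse_squares_le) auto
      finally show ?thesis by simp
    qed
    have "g contour_integrable_on \<gamma>"
      using disj hol_g finP unfolding \<gamma>_def S_def
      by (intro contour_integrable_holomorphic_simple[of g "S - insert 0 P"])
         (auto simp: S_def finite_imp_closed open_Diff)
    moreover have gb: "cmod (g z) \<le> 4 * C / R\<^sup>2" if z: "z \<in> path_image \<gamma>" for z
    proof -
      have "1 \<le> \<bar>Im z\<bar> \<or> cos (Re z) ^ 2 = 1"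
        using img(2)[OF z]
      proof
        assume "\<bar>Re z\<bar> = R"
        then have "Re z = R \<or> Re z = - R" by linarith
        then have "cos (Re z) = cos R" by auto
        then have "cos (Re z) = (- 1) ^ N" by (simp add: R_def cos_npi)
        then show ?thesis by (simp flip: power_mult)
      qed (use R in simp)
      then have cosz: "exp \<bar>Im z\<bar> / 4 \<le> cmod (cos z)" by (rule cmod_cos_lower_bound)
      have zR: "R \<le> cmod z"
        using img(2)[OF z] abs_Re_le_cmod[of z] abs_Im_le_cmod[of z] by auto
      have "cmod (g z) = cmod (f z) / (cmod (cos z) * (cmod z)\<^sup>2)"
        by (simp add: g_def norm_divide norm_mult norm_power)
      also have "\<dots> \<le> (C * exp \<bar>Im z\<bar>) / (exp \<bar>Im z\<bar> / 4 * R\<^sup>2)"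
        using growth cosz zR R C0 by (intro frac_le mult_mono power_mono) auto
      also have "\<dots> = 4 * C / R\<^sup>2" by (simp add: field_simps)
      finally show ?thesis .
    qed
    ultimately have "cmod (contour_integral \<gamma> g) \<le> 4 * C / R\<^sup>2 * (2 * (R - - R) + 2 * (R - - R))"
      using contour_integral_rectpath_bound[of g "Complex (- R) (- R)" "Complex R R" "4 * C / R\<^sup>2"] R C0
      unfolding \<gamma>_def by simp
    also have "\<dots> = 32 * C / R" using R by (simp add: power2_eq_square field_simps)
    finally have "2 * pi * cmod (deriv f 0 + (\<Sum>t\<in>P. residue g t)) \<le> 32 * C / R"
      unfolding ci by (simp add: norm_mult)
    moreover have "1 * cmod (deriv f 0 + (\<Sum>t\<in>P. residue g t)) \<le> 2 * pi * cmod (deriv f 0 + (\<Sum>t\<in>P. residue g t))"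
      using pi_gt3 by (intro mult_right_mono) auto
    ultimately have "cmod (deriv f 0 + (\<Sum>t\<in>P. residue g t)) \<le> 32 * C / R" by linarith
    then have "cmod (deriv f 0) \<le> 1 + 32 * C / R"
      using sumP norm_triangle_ineq4[of "deriv f 0 + (\<Sum>t\<in>P. residue g t)" "\<Sum>t\<in>P. residue g t"] by simp
    then show ?thesis by (simp add: R_def mult.commute)
  qed
  have "(\<lambda>N. 1 + (32 * C / pi) / real N) \<longlonglongrightarrow> 1 + 0"
    by (intro tendsto_intros lim_const_over_n)
  then have "cmod (deriv f 0) \<le> 1 + 0"
    by (rule LIMSEQ_le_const) (use main in blast)
  then show ?thesis by simp
qed

section \<open>Algebra of the triple product\<close>

text \<open>
The shape in which two instances of the Jordan identity determine a commutator.
\<close>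

lemma two_term_system:
  fixes X Y K :: "'a::real_vector"
  assumes "X = 2 *\<^sub>R K - Y" "K = 2 *\<^sub>R X - Y"
  shows "X = Y"
proof -
  have "X = 2 *\<^sub>R (2 *\<^sub>R X - Y) - Y" using assms by simp
  also have "\<dots> = 4 *\<^sub>R X - 3 *\<^sub>R Y"
    using scaleR_add_left[of 2 1 Y] by (simp add: scaleR_diff_right)
  finally have "3 *\<^sub>R X = 3 *\<^sub>R Y"
    using scaleR_add_left[of 3 1 X] by (simp add: algebra_simps)
  then show ?thesis by simp
qed

context jb_star_triple
begin

lemma T_add_left: "T (x + x') y z = T x y z + T x' y z"
  and T_scaleC_left: "T (c *\<^sub>C x) y z = c *\<^sub>C T x y z"
  using linear_left[of y z] by (auto simp: clinear_def)

lemma T_add_right: "T x y (z + z') = T x y z + T x y z'"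
  and T_scaleC_right: "T x y (c *\<^sub>C z) = c *\<^sub>C T x y z"
  using T_add_left[of z z' y x] T_scaleC_left[of c z y x]
  unfolding symmetric[of x y "z + z'"] symmetric[of x y "c *\<^sub>C z"] symmetric[of x y z] symmetric[of x y z']
  by simp_all

lemma T_scaleR: "T (r *\<^sub>R x) y z = r *\<^sub>R T x y z" "T x (r *\<^sub>R y) z = r *\<^sub>R T x y z"
    "T x y (r *\<^sub>R z) = r *\<^sub>R T x y z"
  by (simp_all add: scaleR_scaleC T_scaleC_left T_scaleC_right antilinear_mid)

lemma T_minus: "T (- x) y z = - T x y z" "T x (- y) z = - T x y z" "T x y (- z) = - T x y z"
  using T_scaleR[where r = "-1"] by simp_all

lemma T_diff: "T (x - x') y z = T x y z - T x' y z" "T x (y - y') z = T x y z - T x y' z"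
    "T x y (z - z') = T x y z - T x y z'"
  using T_add_left[of x "-x'"] add_mid[of x y "-y'"] T_add_right[of x y z "-z'"]
  by (simp_all add: T_minus)

lemma T_zero [simp]: "T 0 y z = 0" "T x 0 z = 0" "T x y 0 = 0"
  using T_scaleR[where r = 0] by simp_all

lemma box_self_le: "norm (T x x z) \<le> (norm x)\<^sup>2 * norm z"
proof -
  have "bounded_linear (\<lambda>z. T x x z)"
    using box_hermitian[of x] by (simp add: hermitian_def bounded_clinear_def)
  from onorm[OF this] show ?thesis by (simp add: box_norm)
qed

text \<open>
Linear in the first and antilinear in the second variable, the product is a combination of its
values on the diagonal, which are the only ones that the axioms control in norm.
\<close>

lemma T_polarization:
  "T x y z = (1/4) *\<^sub>C (T (x + y) (x + y) z - T (x - y) (x - y) z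
     + \<i> *\<^sub>C (T (x + \<i> *\<^sub>C y) (x + \<i> *\<^sub>C y) z - T (x - \<i> *\<^sub>C y) (x - \<i> *\<^sub>C y) z))"
proof -
  have ii: "\<i> * (- 2 * \<i>) = 2" "\<i> * (2 * \<i>) = - 2" by (simp_all add: complex_eq_iff)
  have "T (x + y) (x + y) z - T (x - y) (x - y) z
      = 2 *\<^sub>C T x y z + 2 *\<^sub>C T y x z"
    using scaleC_add_left[of 1 1 "T x y z"] scaleC_add_left[of 1 1 "T y x z"]
    by (simp add: T_add_left add_mid T_diff scaleC_one)
  moreover have "T (x + \<i> *\<^sub>C y) (x + \<i> *\<^sub>C y) z - T (x - \<i> *\<^sub>C y) (x - \<i> *\<^sub>C y) z
      = (- 2 * \<i>) *\<^sub>C T x y z + (2 * \<i>) *\<^sub>C T y x z"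
    using scaleC_add_left[of "-\<i>" "-\<i>" "T x y z"] scaleC_add_left[of \<i> \<i> "T y x z"]
    by (simp add: T_add_left add_mid T_diff T_scaleC_left antilinear_mid scaleC_minus_left
        scaleC_add_right scaleC_diff_right)
  ultimately have "T (x + y) (x + y) z - T (x - y) (x - y) z
     + \<i> *\<^sub>C (T (x + \<i> *\<^sub>C y) (x + \<i> *\<^sub>C y) z - T (x - \<i> *\<^sub>C y) (x - \<i> *\<^sub>C y) z)
     = (2 *\<^sub>C T x y z + 2 *\<^sub>C T y x z) + (2 *\<^sub>C T x y z + (-2) *\<^sub>C T y x z)"
    by (simp only: scaleC_add_right scaleC_scaleC ii)
  also have "\<dots> = 4 *\<^sub>C T x y z"
    using scaleC_add_left[of 2 2 "T x y z"] scaleC_add_left[of 2 "-2" "T y x z"] by simp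
  finally show ?thesis by (simp add: scaleC_scaleC scaleC_one)
qed

lemma T_bound: "norm (T x y z) \<le> 4 * norm x * norm y * norm z"
proof (cases "x = 0 \<or> y = 0")
  case False
  have unit: "norm (T a b z) \<le> 4 * norm z" if a: "norm a = 1" and b: "norm b = 1" for a b
  proof -
    have bb: "norm (T w w z) \<le> 4 * norm z" if "norm w \<le> 2" for w
    proof -
      have "(norm w)\<^sup>2 * norm z \<le> 2\<^sup>2 * norm z"
        by (intro mult_right_mono power_mono that) auto
      then show ?thesis using box_self_le[of w z] by simp
    qed
    have n: "norm (a + b) \<le> 2" "norm (a - b) \<le> 2" "norm (a + \<i> *\<^sub>C b) \<le> 2" "norm (a - \<i> *\<^sub>C b) \<le> 2"
      using norm_triangle_ineq[of a b] norm_triangle_ineq4[of a b]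
        norm_triangle_ineq[of a "\<i> *\<^sub>C b"] norm_triangle_ineq4[of a "\<i> *\<^sub>C b"] a b
      by (simp_all add: norm_scaleC)
    have "norm (T a b z) = 1/4 * norm (T (a + b) (a + b) z - T (a - b) (a - b) z
     + \<i> *\<^sub>C (T (a + \<i> *\<^sub>C b) (a + \<i> *\<^sub>C b) z - T (a - \<i> *\<^sub>C b) (a - \<i> *\<^sub>C b) z))"
      by (subst T_polarization) (simp add: norm_scaleC)
    also have "\<dots> \<le> 1/4 * ((4 * norm z + 4 * norm z) + 1 * (4 * norm z + 4 * norm z))"
      using bb[OF n(1)] bb[OF n(2)] bb[OF n(3)] bb[OF n(4)]
      by (intro mult_left_mono norm_triangle_le add_mono)
         (auto intro!: norm_triangle_le_diff simp: norm_scaleC)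
    finally show ?thesis by simp
  qed
  define a b where "a = (1 / norm x) *\<^sub>R x" and "b = (1 / norm y) *\<^sub>R y"
  have xy: "x = norm x *\<^sub>R a" "y = norm y *\<^sub>R b" using False by (auto simp: a_def b_def)
  have "T x y z = (norm x * norm y) *\<^sub>R T a b z"
    by (subst xy(1), subst xy(2)) (simp add: T_scaleR)
  also have "norm \<dots> = (norm x * norm y) * norm (T a b z)" by simp
  also have "\<dots> \<le> (norm x * norm y) * (4 * norm z)"
    using False by (intro mult_left_mono unit) (auto simp: a_def b_def)
  finally show ?thesis by (simp add: mult_ac)
qed auto

text \<open>
The odd powers of \<open>u\<close>: the element with index \<open>k\<close> is the power with exponent \<open>2k+1\<close>.
\<close>

definition odd_power :: "'a \<Rightarrow> nat \<Rightarrow> 'a" where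
  "odd_power u k = (T u u ^^ k) u"

lemma odd_power_0 [simp]: "odd_power u 0 = u"
  and odd_power_Suc: "odd_power u (Suc k) = T u u (odd_power u k)"
  by (simp_all add: odd_power_def)

lemma norm_odd_power: "norm (odd_power u k) \<le> norm u ^ (2 * k + 1)"
proof (induction k)
  case (Suc k)
  have "norm (odd_power u (Suc k)) \<le> (norm u)\<^sup>2 * norm (odd_power u k)"
    unfolding odd_power_Suc by (rule box_self_le)
  also have "\<dots> \<le> (norm u)\<^sup>2 * norm u ^ (2 * k + 1)"
    by (intro mult_left_mono Suc) auto
  finally show ?case by (simp add: power2_eq_square mult_ac)
qed simp

text \<open>
Both parts are proved together by induction on \<open>n\<close>.  By the Jordan identity the commutator
of \<open>u \<box> u\<close> with \<open>odd_power u i \<box> odd_power u j\<close> is the difference of two neighbouring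
operators of level \<open>n + 1\<close>.  If it vanishes on level \<open>n\<close>, all operators of level
\<open>n + 1\<close> agree, and their common commutator \<open>X\<close> is determined in two ways: the
differences add up to \<open>n + 2\<close> times \<open>X\<close>, while exchanging the roles of the two operators in
the Jordan identity shows that the same total is \<open>- X\<close>.
\<close>

lemma odd_power_box:
  assumes "i + j = n"
  shows "T (odd_power u i) (odd_power u j) w = T (odd_power u n) u w"
    and "T u u (T (odd_power u n) u w) = T (odd_power u n) u (T u u w)"
proof -
  have "(\<forall>i j w. i + j = n \<longrightarrow> T (odd_power u i) (odd_power u j) w = T (odd_power u n) u w) \<and>
     (\<forall>w. T u u (T (odd_power u n) u w) = T (odd_power u n) u (T u u w))"
  proof (induction n)
    case (Suc n)
    have shift: "T (odd_power u (Suc i)) (odd_power u j) w = T (odd_power u i) (odd_power u (Suc j)) w" if "i + j = n" for i j w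
    proof -
      have "T u u (T (odd_power u i) (odd_power u j) w)
          = T (odd_power u (Suc i)) (odd_power u j) w - T (odd_power u i) (odd_power u (Suc j)) w + T (odd_power u i) (odd_power u j) (T u u w)"
        by (simp add: odd_power_Suc jordan[of u u "odd_power u i"])
      moreover have "T u u (T (odd_power u i) (odd_power u j) w) = T (odd_power u i) (odd_power u j) (T u u w)"
        using Suc that by simp
      ultimately show ?thesis by simp
    qed
    have A: "T (odd_power u i) (odd_power u j) w = T (odd_power u (Suc n)) u w" if "i + j = Suc n" for i j w
      using that
    proof (induction j arbitrary: i)
      case (Suc j)
      then have "T (odd_power u i) (odd_power u (Suc j)) w = T (odd_power u (Suc i)) (odd_power u j) w"
        using shift[of i j] by simp
      then show ?case using Suc.IH[of "Suc i"] Suc.prems by simp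
    qed simp
    have C: "T u u (T (odd_power u (Suc n)) u w) = T (odd_power u (Suc n)) u (T u u w)" for w
    proof -
      let ?m = "Suc n"
      define X where "X = T u u (T (odd_power u ?m) u w) - T (odd_power u ?m) u (T u u w)"
      have step: "T (odd_power u (Suc i)) (odd_power u j) w - T (odd_power u i) (odd_power u (Suc j)) w = X" if "i + j = ?m" for i j
        using jordan[of u u "odd_power u i" "odd_power u j" w] A[OF that] by (simp add: odd_power_Suc X_def)
      have tele: "T (odd_power u (Suc ?m - j)) (odd_power u j) w = T (odd_power u (Suc ?m)) u w - real j *\<^sub>R X"
        if "j \<le> Suc ?m" for j
        using that
      proof (induction j)
        case (Suc j)
        have "T (odd_power u (Suc (?m - j))) (odd_power u j) w - T (odd_power u (?m - j)) (odd_power u (Suc j)) w = X"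
          using Suc.prems by (intro step) simp
        then show ?case using Suc by (simp add: Suc_diff_le algebra_simps)
      qed simp
      \<comment> \<open>the two evaluations of the outermost difference\<close>
      have e1: "T u (odd_power u (Suc ?m)) w = T (odd_power u (Suc ?m)) u w - real (Suc ?m) *\<^sub>R X"
        using tele[of "Suc ?m"] by simp
      have e2: "T (odd_power u ?m) u (T u u w)
          = T (odd_power u (Suc ?m)) u w - T u (odd_power u (Suc ?m)) w + T u u (T (odd_power u ?m) u w)"
      proof -
        have "T (odd_power u ?m) u u = odd_power u (Suc ?m)"
          unfolding odd_power_Suc[of u ?m] by (rule symmetric)
        moreover have "T u (odd_power u ?m) u = odd_power u (Suc ?m)"
          using A[of 0 ?m u] calculation by simp
        ultimately show ?thesis using jordan[of "odd_power u ?m" u u u w] by simp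
      qed
      have "X = T u (odd_power u (Suc ?m)) w - T (odd_power u (Suc ?m)) u w"
        unfolding X_def e2 by simp
      then have "X = - (real (Suc ?m) *\<^sub>R X)" using e1 by simp
      then have "real (Suc ?m) *\<^sub>R X + X = 0"
        unfolding eq_neg_iff_add_eq_0 by (simp only: add.commute)
      then have "(real (Suc ?m) + 1) *\<^sub>R X = 0" by (simp only: scaleR_add_left scaleR_one)
      then have "X = 0" by (simp only: scaleR_eq_0_iff) linarith
      then show ?thesis by (simp add: X_def)
    qed
    show ?case using A C by blast
  qed simp
  then show "T (odd_power u i) (odd_power u j) w = T (odd_power u n) u w"
    and "T u u (T (odd_power u n) u w) = T (odd_power u n) u (T u u w)" using assms by blast+
qed

definition quad :: "'a \<Rightarrow> 'a \<Rightarrow> 'a" where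
  "quad u w = T u w u"

lemma quad_add: "quad u (x + y) = quad u x + quad u y" and quad_diff: "quad u (x - y) = quad u x - quad u y"
  and quad_scaleR: "quad u (r *\<^sub>R x) = r *\<^sub>R quad u x"
  by (simp_all add: quad_def add_mid T_diff T_scaleR)

lemma quad_odd_power: "quad u (odd_power u k) = odd_power u (Suc k)"
  using odd_power_box(1)[of 0 k k u u] unfolding quad_def odd_power_Suc symmetric[of "odd_power u k" u u] by simp

text \<open>
Two instances of the Jordan identity express the three elements through each other and leave no
choice but equality; in particular \<open>quad u\<close> commutes with these box operators.
\<close>

lemma odd_power_mixed:
  "T (odd_power u (Suc j)) y u = T (odd_power u j) u (quad u y)"
  "T (odd_power u (Suc j)) y u = quad u (T (odd_power u j) u y)"
proof -
  let ?K = "T (odd_power u (Suc j)) y u" and ?X = "T (odd_power u j) u (quad u y)" and ?Y = "quad u (T (odd_power u j) u y)"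
  have box: "T u (odd_power u j) w = T (odd_power u j) u w" for w
    using odd_power_box(1)[of 0 j j u w] by simp
  have up: "T u (odd_power u j) u = odd_power u (Suc j)" using quad_odd_power[of u j] by (simp add: quad_def)
  let ?p = "odd_power u j" and ?P = "odd_power u (Suc j)"
  have "T u ?p (T u y u) = T ?P y u - T u (T ?p u y) u + T u y ?P"
    using jordan[of u ?p u y u] unfolding up .
  then have 1: "?X = 2 *\<^sub>R ?K - ?Y"
    unfolding box symmetric[of u y ?P] quad_def by (simp add: scaleR_2)
  have "T u y ?P = T (T u y u) ?p u - T u (T y u ?p) u + T u ?p (T u y u)"
    using jordan[of u y u ?p u] unfolding up .
  then have 2: "?K = 2 *\<^sub>R ?X - ?Y"
    unfolding symmetric[of "T u y u" ?p u] box symmetric[of u y ?P] symmetric[of y u ?p] quad_def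
    by (simp add: scaleR_2)
  have "?X = ?Y" using 1 2 by (rule two_term_system)
  then show "?K = ?X" "?K = ?Y" using 2 by (simp_all add: scaleR_2)
qed

text \<open>
Think of two commuting roots \<open>\<alpha>\<close>, \<open>\<beta>\<close> with \<open>\<alpha> + \<beta> = 2L\<close> and
\<open>\<alpha> \<beta> = Q\<^sup>2\<close>, where \<open>L = u \<box> u\<close> and \<open>Q = quad u\<close>.  The operator with index \<open>k\<close> is
\<open>(\<alpha>^k + \<beta>^k) / 2\<close>; the next lemmas are the identities that this description predicts.
\<close>

definition power_mean :: "'a \<Rightarrow> nat \<Rightarrow> 'a \<Rightarrow> 'a" where
  "power_mean u k w = (if k = 0 then w else T (odd_power u (k - 1)) u w)"

lemma power_mean_simps [simp]: "power_mean u 0 w = w" "power_mean u (Suc k) w = T (odd_power u k) u w"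
  by (simp_all add: power_mean_def)

lemma power_mean_rec: "2 *\<^sub>R T u u (power_mean u (Suc k) w) = power_mean u (Suc (Suc k)) w + quad u (quad u (power_mean u k w))"
proof -
  let ?p = "odd_power u k" and ?P = "odd_power u (Suc k)"
  have "T w u ?P = T (T w u u) u ?p - T u (T u w u) ?p + T u u (T w u ?p)"
    using jordan[of w u u u ?p] by (simp only: odd_power_Suc)
  then have "T ?P u w = T ?p u (T u u w) - T u (quad u w) ?p + T u u (T ?p u w)"
    unfolding quad_def symmetric[of w u ?P] symmetric[of w u u] symmetric[of "T u u w" u ?p]
      symmetric[of w u ?p] .
  then have "T u (quad u w) ?p = 2 *\<^sub>R T u u (T ?p u w) - T ?P u w"
    using odd_power_box(2)[of 0 k k u w] by (simp add: scaleR_2 algebra_simps)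
  moreover have "T u (quad u w) ?p = quad u (quad u (power_mean u k w))"
  proof (cases k)
    case 0
    then show ?thesis by (simp add: quad_def)
  next
    case (Suc j)
    have comm: "T (odd_power u j) u (quad u y) = quad u (T (odd_power u j) u y)" for y
      using odd_power_mixed[of u j y] by simp
    show ?thesis
      unfolding Suc symmetric[of u "quad u w" "odd_power u (Suc j)"] odd_power_mixed(1) power_mean_simps comm ..
  qed
  ultimately show ?thesis by simp
qed

lemma box_quad_quad_commute: "T u u (quad u (quad u w)) = quad u (quad u (T u u w))"
  using odd_power_mixed[of u 0] by simp

abbreviation quad_power_mean :: "'a \<Rightarrow> nat \<Rightarrow> nat \<Rightarrow> 'a \<Rightarrow> 'a" where
  "quad_power_mean u j k w \<equiv> ((\<lambda>w. quad u (quad u w)) ^^ j) (power_mean u k w)"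

lemma quad_quad_pow_add: "((\<lambda>w. quad u (quad u w)) ^^ j) (x + y)
    = ((\<lambda>w. quad u (quad u w)) ^^ j) x + ((\<lambda>w. quad u (quad u w)) ^^ j) y"
  by (induction j) (simp_all add: quad_add)

lemma quad_quad_pow_scaleR: "((\<lambda>w. quad u (quad u w)) ^^ j) (r *\<^sub>R x) = r *\<^sub>R ((\<lambda>w. quad u (quad u w)) ^^ j) x"
  by (induction j) (simp_all add: quad_scaleR)

lemma box_quad_quad_pow_commute:
  "T u u (((\<lambda>w. quad u (quad u w)) ^^ j) x) = ((\<lambda>w. quad u (quad u w)) ^^ j) (T u u x)"
  by (induction j) (simp_all add: box_quad_quad_commute)

lemma quad_power_mean_rec: "2 *\<^sub>R T u u (quad_power_mean u j (Suc k) w) = quad_power_mean u j (Suc (Suc k)) w + quad_power_mean u (Suc j) k w"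
proof -
  have "2 *\<^sub>R T u u (quad_power_mean u j (Suc k) w) = ((\<lambda>w. quad u (quad u w)) ^^ j) (2 *\<^sub>R T u u (power_mean u (Suc k) w))"
    by (simp only: box_quad_quad_pow_commute quad_quad_pow_scaleR)
  also have "\<dots> = quad_power_mean u j (Suc (Suc k)) w + quad_power_mean u (Suc j) k w"
    by (simp only: power_mean_rec quad_quad_pow_add funpow_Suc_right o_def)
  finally show ?thesis .
qed

text \<open>
The identity \<open>(\<alpha>^j + \<beta>^j) (\<alpha>^k + \<beta>^k) = (\<alpha>^(j+k) + \<beta>^(j+k)) + (\<alpha> \<beta>)^j (\<alpha>^(k-j) + \<beta>^(k-j))\<close>,
by induction on \<open>j\<close> along the two-step recursion.
\<close>

lemma power_mean_mult:
  "j \<le> k \<Longrightarrow> 2 *\<^sub>R power_mean u j (power_mean u k w) = power_mean u (j + k) w + quad_power_mean u j (k - j) w"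
proof (induction j rule: less_induct)
  case (less j)
  consider "j = 0" | "j = 1" | i where "j = Suc (Suc i)"
    by (metis One_nat_def not0_implies_Suc)
  then show ?case
  proof cases
    case 1
    then show ?thesis by (simp add: scaleR_2)
  next
    case 2
    then obtain k' where "k = Suc k'" using less.prems by (cases k) auto
    then show ?thesis using 2 power_mean_rec[of u k' w] by simp
  next
    case 3
    then obtain m where k: "k = i + Suc (Suc m)"
      using less.prems by (metis add_Suc_right add_Suc_shift le_Suc_ex add.commute)
    let ?v = "power_mean u k w"
    have "2 *\<^sub>R power_mean u (Suc (Suc i)) ?v
        = 2 *\<^sub>R T u u (2 *\<^sub>R power_mean u (Suc i) ?v) - quad u (quad u (2 *\<^sub>R power_mean u i ?v))"
      unfolding T_scaleR quad_scaleR power_mean_rec by (simp add: scaleR_right_distrib del: power_mean_simps)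
    also have "2 *\<^sub>R power_mean u (Suc i) ?v = power_mean u (Suc (i + k)) w + quad_power_mean u (Suc i) (Suc m) w"
      using less.IH[of "Suc i"] 3 k by (simp del: power_mean_simps funpow.simps)
    also have "2 *\<^sub>R power_mean u i ?v = power_mean u (i + k) w + quad_power_mean u i (Suc (Suc m)) w"
      using less.IH[of i] 3 k by (simp del: power_mean_simps funpow.simps)
    also have "2 *\<^sub>R T u u (power_mean u (Suc (i + k)) w + quad_power_mean u (Suc i) (Suc m) w)
        - quad u (quad u (power_mean u (i + k) w + quad_power_mean u i (Suc (Suc m)) w))
        = (2 *\<^sub>R T u u (power_mean u (Suc (i + k)) w) - quad u (quad u (power_mean u (i + k) w)))
        + (2 *\<^sub>R T u u (quad_power_mean u (Suc i) (Suc m) w) - quad_power_mean u (Suc i) (Suc (Suc m)) w)"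
      by (simp add: T_add_right quad_add scaleR_right_distrib del: power_mean_simps)
    also have "\<dots> = power_mean u (Suc (Suc (i + k))) w + quad_power_mean u (Suc (Suc i)) m w"
      using power_mean_rec[of u "i + k" w] quad_power_mean_rec[of u "Suc i" m w] by (simp del: power_mean_simps funpow.simps)
    finally show ?thesis using 3 k by (simp del: power_mean_simps funpow.simps)
  qed
qed

text \<open>
Expanding \<open>(\<alpha> + \<beta>)^n\<close> writes \<open>L^n\<close> as an average of the symmetrised monomials
\<open>quad_power_mean u m k\<close> of total degree \<open>n\<close>.  Each of these is a quadratic expression in power means,
hence bounded by a multiple of \<open>q^n\<close>, and averaging does not increase the bound.
\<close>

lemma box_power_decay:
  assumes q: "0 < q" and decay: "\<And>k. norm (odd_power u k) \<le> C * q ^ k"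
  obtains K where "\<And>n w. norm ((T u u ^^ n) w) \<le> K * q ^ n * norm w"
proof -
  have C: "0 \<le> C" using order_trans[OF norm_ge_zero decay[of 0]] by simp
  define C1 where "C1 = 1 + 4 * C * norm u / q"
  have C1: "1 \<le> C1" unfolding C1_def using C q by simp
  have power_mean: "norm (power_mean u k w) \<le> C1 * q ^ k * norm w" for k w
  proof (cases k)
    case 0
    then show ?thesis using mult_right_mono[OF C1, of "norm w"] by simp
  next
    case (Suc j)
    have "norm (power_mean u k w) \<le> 4 * norm (odd_power u j) * norm u * norm w"
      using T_bound[of "odd_power u j" u w] Suc by simp
    also have "\<dots> \<le> 4 * (C * q ^ j) * norm u * norm w"
      by (intro mult_right_mono mult_left_mono decay) auto
    also have "\<dots> = (4 * C * norm u / q) * q ^ k * norm w" using q Suc by simp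
    also have "\<dots> \<le> C1 * q ^ k * norm w"
      unfolding C1_def using q by (intro mult_right_mono) auto
    finally show ?thesis .
  qed
  define K where "K = 2 * C1\<^sup>2 + C1"
  have quad_power_mean: "norm (quad_power_mean u m k w) \<le> K * q ^ (2 * m + k) * norm w" for m k w
  proof -
    have "quad_power_mean u m k w = 2 *\<^sub>R power_mean u m (power_mean u (m + k) w) - power_mean u (2 * m + k) w"
      using power_mean_mult[of m "m + k" u w] by (simp add: mult_2 add.assoc del: power_mean_simps)
    also have "norm \<dots> \<le> 2 * norm (power_mean u m (power_mean u (m + k) w)) + norm (power_mean u (2 * m + k) w)"
      using norm_triangle_ineq4[of "2 *\<^sub>R power_mean u m (power_mean u (m + k) w)"] by simp
    also have "\<dots> \<le> 2 * (C1 * q ^ m * (C1 * q ^ (m + k) * norm w)) + C1 * q ^ (2 * m + k) * norm w"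
    proof -
      have "C1 * q ^ m * norm (power_mean u (m + k) w) \<le> C1 * q ^ m * (C1 * q ^ (m + k) * norm w)"
        using C1 q by (intro mult_left_mono[OF power_mean]) auto
      then show ?thesis using power_mean[of m "power_mean u (m + k) w"] power_mean[of "2 * m + k" w] by linarith
    qed
    also have "\<dots> = K * q ^ (2 * m + k) * norm w"
    proof -
      have "q ^ (2 * m + k) = q ^ m * q ^ (m + k)" by (simp add: mult_2 add.assoc flip: power_add)
      then show ?thesis by (simp add: K_def power2_eq_square algebra_simps)
    qed
    finally show ?thesis .
  qed
  have pow_scale: "(T u u ^^ n) (r *\<^sub>R x) = r *\<^sub>R (T u u ^^ n) x"
    and pow_add: "(T u u ^^ n) (x + y) = (T u u ^^ n) x + (T u u ^^ n) y" for n r x y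
    by (induction n) (simp_all add: T_scaleR T_add_right)
  have "norm ((T u u ^^ n) (quad_power_mean u m k w)) \<le> K * q ^ (n + 2 * m + k) * norm w" for n m k w
  proof (induction n arbitrary: m k)
    case 0
    then show ?case using quad_power_mean by simp
  next
    case (Suc n)
    show ?case
    proof (cases k)
      case 0
      have "T u u (quad_power_mean u m 0 w) = quad_power_mean u m 1 w" by (simp add: box_quad_quad_pow_commute)
      then have "(T u u ^^ Suc n) (quad_power_mean u m k w) = (T u u ^^ n) (quad_power_mean u m 1 w)"
        by (simp only: funpow_Suc_right o_def 0)
      then show ?thesis using Suc[of m 1] 0 by simp
    next
      case (Suc j)
      have "T u u (quad_power_mean u m k w) = (1/2) *\<^sub>R (quad_power_mean u m (Suc (Suc j)) w + quad_power_mean u (Suc m) j w)"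
        unfolding quad_power_mean_rec[of u m j w, symmetric] Suc by simp
      then have "(T u u ^^ Suc n) (quad_power_mean u m k w)
          = (1/2) *\<^sub>R ((T u u ^^ n) (quad_power_mean u m (Suc (Suc j)) w) + (T u u ^^ n) (quad_power_mean u (Suc m) j w))"
        by (simp only: funpow_Suc_right o_def pow_scale pow_add)
      also have "norm \<dots> \<le> (1/2) * (K * q ^ (n + 2 * m + Suc (Suc j)) * norm w
           + K * q ^ (n + 2 * Suc m + j) * norm w)"
        using norm_triangle_mono[OF Suc.IH[of m "Suc (Suc j)"] Suc.IH[of "Suc m" j]]
        by (simp del: power_mean_simps funpow.simps)
      also have "\<dots> = K * q ^ (Suc n + 2 * m + k) * norm w" using Suc by simp
      finally show ?thesis .
    qed
  qed
  from this[of _ 0 0] show thesis by (intro that[of K]) simp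
qed

end

section \<open>Decay of odd powers\<close>

text \<open>
Bijectivity on \<open>V\<close> together with an explicit bound for the inverse; carrying the bound makes
perturbation quantitative.  The bound also gives injectivity when \<open>f\<close> is linear.
\<close>

definition bounded_inverse_on :: "'a::real_normed_vector set \<Rightarrow> ('a \<Rightarrow> 'a) \<Rightarrow> real \<Rightarrow> bool" where
  "bounded_inverse_on V f c \<longleftrightarrow> f ` V = V \<and> (\<forall>x\<in>V. norm x \<le> c * norm (f x))"

lemma bounded_inverse_on_mono:
  assumes "bounded_inverse_on V f c" "c \<le> c'"
  shows "bounded_inverse_on V f c'"
  using assms order_trans[OF _ mult_right_mono[OF assms(2) norm_ge_zero]]
  unfolding bounded_inverse_on_def by blast

text \<open>
The equation \<open>g x = y\<close> is the fixed point equation \<open>f x = y - (g x - f x)\<close>, whose right-hand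
side, composed with the inverse of \<open>f\<close>, is a contraction with constant \<open>c * d\<close>.
\<close>

lemma bounded_inverse_on_perturb:
  fixes V :: "'a::banach set"
  assumes "bounded_inverse_on V f c" "closed V" "subspace V" "linear f" "linear g"
    and gV: "g ` V \<subseteq> V" and close: "\<And>x. x \<in> V \<Longrightarrow> norm (g x - f x) \<le> d * norm x"
    and d: "0 \<le> d" "0 \<le> c" "c * d < 1"
  shows "bounded_inverse_on V g (c / (1 - c * d))"
proof -
  have fV: "f ` V = V" and fb: "\<And>x. x \<in> V \<Longrightarrow> norm x \<le> c * norm (f x)"
    using assms(1) by (auto simp: bounded_inverse_on_def)
  define e where "e x = g x - f x" for x
  have eV: "e x \<in> V" if "x \<in> V" for x
    unfolding e_def using that gV fV subspace_diff[OF \<open>subspace V\<close>] by blast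
  have e_diff: "e x - e y = e (x - y)" for x y
    unfolding e_def using assms(4,5) by (simp add: linear_diff)
  have lower: "norm x \<le> c / (1 - c * d) * norm (g x)" if x: "x \<in> V" for x
  proof -
    have "norm (f x) \<le> norm (g x) + norm (g x - f x)"
      using norm_triangle_ineq4[of "g x" "g x - f x"] by simp
    then have "norm (f x) \<le> norm (g x) + d * norm x" using close[OF x] by linarith
    then have "norm x \<le> c * (norm (g x) + d * norm x)"
      using fb[OF x] mult_left_mono[of _ _ c] d(2) by (meson order_trans)
    then have "(1 - c * d) * norm x \<le> c * norm (g x)" by (simp add: algebra_simps)
    then show ?thesis using d by (simp add: field_simps)
  qed
  have "y \<in> g ` V" if y: "y \<in> V" for y
  proof -
    define h where "h x = inv_into V f (y - e x)" for x
    have h: "h x \<in> V" "f (h x) = y - e x" if "x \<in> V" for x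
      using subspace_diff[OF \<open>subspace V\<close> y eV[OF that]] fV
      unfolding h_def by (auto intro!: inv_into_into f_inv_into_f)
    have "\<exists>!x\<in>V. h x = x"
    proof (rule Banach_fix)
      show "complete V" using \<open>closed V\<close> by (simp add: complete_eq_closed)
      show "V \<noteq> {}" using y by blast
      show "0 \<le> c * d" "c * d < 1" using d by simp_all
      show "h ` V \<subseteq> V" using h by blast
      fix x x' assume x: "x \<in> V" "x' \<in> V"
      have "f (h x - h x') = e (x' - x)"
        using h[OF x(1)] h[OF x(2)] \<open>linear f\<close> by (simp add: linear_diff e_diff[symmetric])
      moreover have "h x - h x' \<in> V" "x' - x \<in> V"
        using h x subspace_diff[OF \<open>subspace V\<close>] by auto
      ultimately have "norm (h x - h x') \<le> c * (d * norm (x' - x))"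
        using fb[of "h x - h x'"] close[of "x' - x"] d(2) mult_left_mono[of _ _ c]
        by (metis (no_types, lifting) e_def order_trans)
      then show "dist (h x) (h x') \<le> c * d * dist x x'"
        by (simp add: dist_norm norm_minus_commute mult_ac)
    qed
    then obtain x where x: "x \<in> V" "h x = x" by blast
    then have "g x = y" using h[of x] by (simp add: e_def)
    then show ?thesis using x by blast
  qed
  then show ?thesis using lower gV unfolding bounded_inverse_on_def by blast
qed

lemma has_field_derivative_quadratic:
  fixes F :: "complex \<Rightarrow> complex"
  assumes "open S" "x \<in> S" and quad: "\<And>y. y \<in> S \<Longrightarrow> cmod (F y - F x - (y - x) * D) \<le> K * (cmod (y - x))\<^sup>2"
  shows "(F has_field_derivative D) (at x)"
proof -
  have "((\<lambda>y. K * cmod (y - x)) \<longlongrightarrow> K * cmod (x - x)) (at x)"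
    by (intro tendsto_intros)
  then have lim: "((\<lambda>y. K * cmod (y - x)) \<longlongrightarrow> 0) (at x)" by simp
  have "\<forall>\<^sub>F y in at x. cmod ((F y - F x) / (y - x) - D) \<le> K * cmod (y - x)"
  proof -
    have "\<forall>\<^sub>F y in at x. y \<in> S - {x}"
      using assms(1,2) by (auto simp: eventually_at_topological)
    then show ?thesis
    proof eventually_elim
      case (elim y)
      then have ne: "y - x \<noteq> 0" by auto
      have "cmod ((F y - F x) / (y - x) - D) = cmod (F y - F x - (y - x) * D) / cmod (y - x)"
        using ne by (simp add: norm_divide[symmetric] diff_divide_distrib)
      also have "\<dots> \<le> K * (cmod (y - x))\<^sup>2 / cmod (y - x)"
        using quad[of y] elim by (intro divide_right_mono) auto
      finally show ?case using ne by (simp add: power2_eq_square)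
    qed
  qed
  then have "((\<lambda>y. (F y - F x) / (y - x) - D) \<longlongrightarrow> 0) (at x)"
    using lim by (rule Lim_null_comparison)
  then show ?thesis by (simp add: has_field_derivative_iff Lim_null[symmetric] LIM_zero_iff)
qed

lemma sums_imp_coefficient_bound:
  fixes F :: "complex \<Rightarrow> complex"
  assumes hol: "F holomorphic_on ball 0 R" and r: "0 < r" "r < R"
    and bound: "\<And>z. z \<in> ball 0 R \<Longrightarrow> cmod (F z) \<le> B"
    and sums: "\<And>z. cmod z < 1 \<Longrightarrow> (\<lambda>k. a k * z ^ k) sums F z"
  shows "cmod (a k) \<le> B / r ^ k"
proof -
  have "F has_fps_expansion Abs_fps a"
    unfolding has_fps_expansion_def
  proof
    have "summable (\<lambda>k. a k * (1/2) ^ k)" using sums[of "1/2"] by (auto simp: sums_iff)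
    then have "ereal (cmod (1/2)) \<le> conv_radius a" by (rule conv_radius_geI)
    then show "0 < fps_conv_radius (Abs_fps a)"
      unfolding fps_conv_radius_def by (simp add: fun_eq_iff) (metis Abs_fps_inverse UNIV_I
          ereal_less(2) fps_nth_Abs_fps half_gt_zero less_le_trans zero_less_one)
    have "\<forall>\<^sub>F z in nhds 0. z \<in> ball 0 (1::real)"
      by (rule eventually_nhds_in_open) auto
    then show "\<forall>\<^sub>F z in nhds 0. eval_fps (Abs_fps a) z = F z"
      by eventually_elim (use sums in \<open>auto simp: eval_fps_def sums_iff\<close>)
  qed
  then have "a k = (deriv ^^ k) F 0 / fact k"
    using fps_nth_fps_expansion[of F "Abs_fps a" k] by simp
  then have "cmod (a k) = cmod ((deriv ^^ k) F 0) / fact k" by (simp add: norm_divide)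
  also have "cmod ((deriv ^^ k) F 0) \<le> fact k * B / r ^ k"
    using r bound
    by (intro Cauchy_inequality holomorphic_on_subset[OF hol]
        holomorphic_on_imp_continuous_on[OF holomorphic_on_subset[OF hol]]) auto
  then have "cmod ((deriv ^^ k) F 0) / fact k \<le> (fact k * B / r ^ k) / fact k"
    by (rule divide_right_mono) simp
  finally show ?thesis by simp
qed

context jb_star_triple
begin

lemma T_bounded_linear: "bounded_linear (\<lambda>x. T x y z)" "bounded_linear (\<lambda>y. T x y z)"
    "bounded_linear (\<lambda>z. T x y z)"
proof -
  show "bounded_linear (\<lambda>x. T x y z)"
    by (rule bounded_linear_intro[where K = "4 * norm y * norm z"])
      (use T_bound[of _ y z] in \<open>auto simp: T_add_left T_scaleR mult_ac\<close>)
  show "bounded_linear (\<lambda>y. T x y z)"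
    by (rule bounded_linear_intro[where K = "4 * norm x * norm z"])
      (use T_bound[of x _ z] in \<open>auto simp: add_mid T_scaleR mult_ac\<close>)
  show "bounded_linear (\<lambda>z. T x y z)"
    by (rule bounded_linear_intro[where K = "4 * norm x * norm y"])
      (use T_bound[of x y] in \<open>auto simp: T_add_right T_scaleR mult_ac\<close>)
qed

text \<open>
The space \<open>V\<close> of all \<open>x\<close> on which \<open>Q\<^sup>2\<close> and \<open>L\<^sup>2\<close> agree is closed, invariant under
\<open>L\<close> and contains \<open>u\<close>.  On it the Bergman operator is \<open>(1 - L)\<^sup>2\<close>, so \<open>1 - L\<close> is bounded below;
\<open>1 - \<zeta> L\<close> is bounded below for the other \<open>\<zeta>\<close> of modulus one because the spectrum of
\<open>L\<close> is contained in the nonnegative reals.  By compactness the bound is uniform on the closed unit disc, so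
the solution \<open>w\<close> of \<open>(1 - \<zeta> L) w = u\<close>, whose Taylor coefficients at \<open>0\<close> are the odd
powers of \<open>u\<close>, extends holomorphically to a larger disc.
\<close>

lemma odd_power_decay:
  assumes u: "norm u = 1" and berg: "\<And>x. norm x \<le> c * norm (x - 2 *\<^sub>R T u u x + quad u (quad u x))"
  obtains C q where "0 < q" "q < 1" "\<And>k. norm (odd_power u k) \<le> C * q ^ k"
proof -
  \<comment> \<open>cut out by an equation between bounded operators, so closed and invariant at once\<close>
  define V where "V = {x. quad u (quad u x) = T u u (T u u x)}"
  define E where "E \<zeta> x = x - \<zeta> *\<^sub>C T u u x" for \<zeta> x
  have LV: "T u u x \<in> V" if "x \<in> V" for x
    using that by (simp add: V_def box_quad_quad_commute[symmetric])
  have blQ: "bounded_linear (quad u)" unfolding quad_def[abs_def] by (rule T_bounded_linear)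
  have "closed V"
    unfolding V_def
    by (intro closed_Collect_eq linear_continuous_on bounded_linear_compose[OF blQ blQ]
        bounded_linear_compose[OF T_bounded_linear(3) T_bounded_linear(3)])
  have "subspace V"
    unfolding V_def subspace_def by (auto simp: quad_def add_mid T_add_right T_scaleR)
  have scV: "\<zeta> *\<^sub>C x \<in> V" if "x \<in> V" for \<zeta> x
    using that by (simp add: V_def quad_def T_scaleC_right antilinear_mid)
  have EV: "E \<zeta> ` V \<subseteq> V" for \<zeta>
    unfolding E_def using subspace_diff[OF \<open>subspace V\<close>] scV LV by blast
  have linE: "linear (E \<zeta>)" for \<zeta>
    unfolding E_def by (rule linearI) (simp_all add: T_add_right T_scaleR scaleC_add_right scaleC_scaleR
        algebra_simps)
  have L1: "norm (T u u x) \<le> norm x" for x using box_self_le[of u x] u by simp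
  have lam_L: "norm (\<zeta> *\<^sub>C T u u x) \<le> cmod \<zeta> * norm x" for \<zeta> x
    by (simp add: norm_scaleC mult_left_mono L1)
  have pointwise: "\<exists>c>0. \<forall>x\<in>V. norm x \<le> c * norm (E \<zeta> x)" if lam: "cmod \<zeta> \<le> 1" for \<zeta>
  proof -
    consider "\<zeta> = 1" | "cmod \<zeta> < 1" | "cmod \<zeta> = 1" "\<zeta> \<noteq> 1" using lam by linarith
    then show ?thesis
    proof cases
      case 1
      have "norm x \<le> (2 * \<bar>c\<bar> + 1) * norm (E 1 x)" if "x \<in> V" for x
      proof -
        have "x - 2 *\<^sub>R T u u x + quad u (quad u x) = E 1 (E 1 x)"
          using that by (simp add: E_def V_def scaleC_one T_diff scaleR_2)
        then have "norm x \<le> c * norm (E 1 (E 1 x))" using berg[of x] by simp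
        also have "\<dots> \<le> \<bar>c\<bar> * (2 * norm (E 1 x))"
        proof (rule mult_mono)
          show "norm (E 1 (E 1 x)) \<le> 2 * norm (E 1 x)"
            using norm_triangle_ineq4[of "E 1 x" "T u u (E 1 x)"] L1[of "E 1 x"]
            by (simp add: E_def[of 1 "E 1 x"] scaleC_one)
        qed auto
        also have "\<dots> \<le> (2 * \<bar>c\<bar> + 1) * norm (E 1 x)" by (simp add: algebra_simps)
        finally show ?thesis .
      qed
      then show ?thesis using 1 by (intro exI[of _ "2 * \<bar>c\<bar> + 1"]) auto
    next
      case 2
      have "norm x \<le> (1 / (1 - cmod \<zeta>)) * norm (E \<zeta> x)" for x
      proof -
        have "norm x \<le> norm (E \<zeta> x) + cmod \<zeta> * norm x"
          using norm_triangle_ineq[of "E \<zeta> x" "\<zeta> *\<^sub>C T u u x"] lam_L[of \<zeta> x] by (simp add: E_def)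
        then show ?thesis using 2 by (simp add: field_simps)
      qed
      then show ?thesis using 2 by (intro exI[of _ "1 / (1 - cmod \<zeta>)"]) auto
    next
      case 3
      \<comment> \<open>a nonnegative real number of modulus one is \<open>1\<close>, so the spectrum misses \<open>\<mu>\<close>\<close>
      define \<mu> where "\<mu> = inverse \<zeta>"
      have \<zeta>0: "\<zeta> \<noteq> 0" using 3 by auto
      have "\<mu> \<notin> complex_of_real ` {0..}"
      proof
        assume "\<mu> \<in> complex_of_real ` {0..}"
        then obtain r where r: "r \<ge> 0" "\<mu> = of_real r" by auto
        moreover have "cmod \<mu> = 1" using 3 by (simp add: \<mu>_def norm_inverse)
        ultimately have "\<mu> = 1" by simp
        then show False using 3 by (simp add: \<mu>_def)
      qed
      then have "\<mu> \<notin> spectrum (\<lambda>z. T u u z)" using box_spectrum by blast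
      then obtain S where S: "bounded_clinear S" "S \<circ> (\<lambda>z. T u u z - \<mu> *\<^sub>C z) = id"
        unfolding spectrum_def by blast
      then have "bounded_linear S" by (simp add: bounded_clinear_def)
      then obtain K where K: "0 < K" "\<And>x. norm (S x) \<le> norm x * K"
        using bounded_linear.pos_bounded by blast
      have "norm x \<le> K * norm (E \<zeta> x)" for x
      proof -
        have "T u u x - \<mu> *\<^sub>C x = (- \<mu>) *\<^sub>C E \<zeta> x"
          using \<zeta>0 by (simp add: E_def scaleC_diff_right scaleC_scaleC \<mu>_def scaleC_minus_left scaleC_one)
        moreover have "cmod \<mu> = 1" using 3 by (simp add: \<mu>_def norm_inverse)
        ultimately have "norm (T u u x - \<mu> *\<^sub>C x) = norm (E \<zeta> x)"
          by (simp add: norm_scaleC)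
        moreover have "x = S (T u u x - \<mu> *\<^sub>C x)" using fun_cong[OF S(2), of x] by simp
        ultimately show ?thesis using K(2)[of "T u u x - \<mu> *\<^sub>C x"] by (simp add: mult.commute)
      qed
      then show ?thesis using K by blast
    qed
  qed
  have E_close: "norm (E \<mu> x - E \<zeta> x) \<le> cmod (\<mu> - \<zeta>) * norm x" for \<mu> \<zeta> x
  proof -
    have "E \<mu> x - E \<zeta> x = (\<zeta> - \<mu>) *\<^sub>C T u u x"
      using scaleC_add_left[of "\<zeta> - \<mu>" \<mu> "T u u x"] by (simp add: E_def)
    then show ?thesis using lam_L[of "\<zeta> - \<mu>" x] by (simp add: norm_minus_commute)
  qed
  obtain c1 where c1: "c1 > 0" "\<And>\<zeta> x. cmod \<zeta> \<le> 1 \<Longrightarrow> x \<in> V \<Longrightarrow> norm x \<le> c1 * norm (E \<zeta> x)"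
  proof -
    obtain k where k: "\<And>\<zeta>. cmod \<zeta> \<le> 1 \<Longrightarrow> k \<zeta> > 0"
      "\<And>\<zeta> x. cmod \<zeta> \<le> 1 \<Longrightarrow> x \<in> V \<Longrightarrow> norm x \<le> k \<zeta> * norm (E \<zeta> x)"
      using pointwise by metis
    have "compact (cball (0::complex) 1)" by simp
    moreover have "cball (0::complex) 1 \<subseteq> (\<Union>\<zeta>\<in>cball 0 1. ball \<zeta> (1 / (2 * k \<zeta>)))"
      using k(1) by force
    ultimately obtain D where D: "D \<subseteq> cball 0 1" "finite D"
      "cball (0::complex) 1 \<subseteq> (\<Union>\<zeta>\<in>D. ball \<zeta> (1 / (2 * k \<zeta>)))"
      using compactE_image[of "cball (0::complex) 1" "cball 0 1" "\<lambda>\<zeta>. ball \<zeta> (1 / (2 * k \<zeta>))"]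
      by (metis open_ball)
    define c1 where "c1 = 1 + (\<Sum>\<zeta>\<in>D. 2 * k \<zeta>)"
    have kD: "0 < k \<zeta>" if "\<zeta> \<in> D" for \<zeta> using that D(1) k(1) by auto
    have "norm x \<le> c1 * norm (E \<mu> x)" if \<mu>: "cmod \<mu> \<le> 1" and x: "x \<in> V" for \<mu> x
    proof -
      obtain \<zeta> where \<zeta>: "\<zeta> \<in> D" "dist \<zeta> \<mu> < 1 / (2 * k \<zeta>)" using D(3) \<mu> by auto
      have kp: "0 < k \<zeta>" using kD \<zeta> by blast
      have "norm (E \<zeta> x) \<le> norm (E \<mu> x) + cmod (\<mu> - \<zeta>) * norm x"
        using norm_triangle_ineq4[of "E \<mu> x" "E \<mu> x - E \<zeta> x"] E_close[of \<mu> x \<zeta>] by simp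
      also have "\<dots> \<le> norm (E \<mu> x) + 1 / (2 * k \<zeta>) * norm x"
        using \<zeta>(2) by (intro add_left_mono mult_right_mono) (auto simp: dist_norm norm_minus_commute)
      finally have "k \<zeta> * norm (E \<zeta> x) \<le> k \<zeta> * norm (E \<mu> x) + norm x / 2"
        using kp by (simp add: field_simps)
      moreover have "norm x \<le> k \<zeta> * norm (E \<zeta> x)" using k(2)[of \<zeta> x] \<zeta> D(1) x by auto
      ultimately have "norm x \<le> 2 * k \<zeta> * norm (E \<mu> x)" by simp
      also have "2 * k \<zeta> \<le> (\<Sum>\<zeta>\<in>D. 2 * k \<zeta>)"
        using kD by (intro member_le_sum \<zeta> D) (auto intro: less_imp_le)
      then have "2 * k \<zeta> * norm (E \<mu> x) \<le> c1 * norm (E \<mu> x)"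
        unfolding c1_def by (intro mult_right_mono) auto
      finally show ?thesis .
    qed
    moreover have "c1 > 0" unfolding c1_def using kD by (intro add_pos_nonneg sum_nonneg) (auto intro: less_imp_le)
    ultimately show thesis using that by blast
  qed
  have inside: "bounded_inverse_on V (E \<zeta>) c1" if "cmod \<zeta> < 1" for \<zeta>
  proof -
    have "bounded_inverse_on V (\<lambda>x. x) 1" by (simp add: bounded_inverse_on_def)
    then have "bounded_inverse_on V (E \<zeta>) (1 / (1 - 1 * cmod \<zeta>))"
      using that lam_L EV
      by (intro bounded_inverse_on_perturb \<open>closed V\<close> \<open>subspace V\<close> linE) (auto simp: E_def linear_ident)
    then show ?thesis using c1(2) that by (simp add: bounded_inverse_on_def)
  qed
  \<comment> \<open>a point of this disc is within \<open>1 / (2 * c1)\<close> of the open unit disc\<close>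
  define R where "R = 1 + 1 / (2 * c1)"
  have R: "R > 1" using c1 by (simp add: R_def)
  have inv: "bounded_inverse_on V (E \<mu>) (2 * c1)" if \<mu>: "cmod \<mu> < R" for \<mu>
  proof -
    define \<zeta> where "\<zeta> = \<mu> / of_real R"
    have "cmod \<zeta> < 1" using \<mu> R by (simp add: \<zeta>_def norm_divide)
    have "\<mu> - \<zeta> = \<zeta> * of_real (R - 1)" using R by (simp add: \<zeta>_def field_simps)
    then have "cmod (\<mu> - \<zeta>) = cmod \<zeta> * (R - 1)" using R by (simp add: norm_mult del: of_real_diff)
    also have "\<dots> \<le> 1 * (R - 1)" using \<open>cmod \<zeta> < 1\<close> R by (intro mult_right_mono) auto
    finally have d: "cmod (\<mu> - \<zeta>) \<le> 1 / (2 * c1)" by (simp add: R_def)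
    then have cd: "c1 * cmod (\<mu> - \<zeta>) \<le> 1 / 2" using c1(1) by (simp add: field_simps)
    have "bounded_inverse_on V (E \<mu>) (c1 / (1 - c1 * cmod (\<mu> - \<zeta>)))"
      using c1(1) cd
      by (intro bounded_inverse_on_perturb[OF inside[OF \<open>cmod \<zeta> < 1\<close>]] \<open>closed V\<close> \<open>subspace V\<close>
          linE EV E_close) auto
    moreover have "c1 / (1 - c1 * cmod (\<mu> - \<zeta>)) \<le> c1 / (1 / 2)"
      using cd c1(1) by (intro divide_left_mono) auto
    ultimately show ?thesis by (auto intro: bounded_inverse_on_mono simp: mult.commute)
  qed
  have uV: "u \<in> V"
    using quad_odd_power[of u 0] quad_odd_power[of u 1] by (simp add: V_def odd_power_Suc)
  have solve: "\<exists>x\<in>V. E \<mu> x = y" if "cmod \<mu> < R" "y \<in> V" for \<mu> y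
    using inv[OF that(1)] that(2) unfolding bounded_inverse_on_def by (metis imageE)
  have lower: "norm x \<le> 2 * c1 * norm (E \<mu> x)" if "cmod \<mu> < R" "x \<in> V" for \<mu> x
    using inv[OF that(1)] that(2) unfolding bounded_inverse_on_def by blast
  obtain w where w: "\<And>\<mu>. cmod \<mu> < R \<Longrightarrow> w \<mu> \<in> V" "\<And>\<mu>. cmod \<mu> < R \<Longrightarrow> E \<mu> (w \<mu>) = u"
    using solve[OF _ uV] by metis
  have nw: "norm (w \<mu>) \<le> 2 * c1" if "cmod \<mu> < R" for \<mu>
    using lower[OF that w(1)[OF that]] w(2)[OF that] u by simp
  have shift: "E \<mu> x = E \<nu> x + (\<nu> - \<mu>) *\<^sub>C T u u x" for \<mu> \<nu> x
    using scaleC_add_left[of "\<nu> - \<mu>" \<mu> "T u u x"] by (simp add: E_def algebra_simps)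
  have hol: "(\<lambda>\<mu>. \<phi> (w \<mu>)) holomorphic_on ball 0 R" if \<phi>: "cfunctional \<phi>" for \<phi>
    unfolding holomorphic_on_def field_differentiable_def
  proof
    fix \<mu> assume "\<mu> \<in> ball (0::complex) R"
    then have \<mu>: "cmod \<mu> < R" by simp
    obtain y where y: "y \<in> V" "E \<mu> y = T u u (w \<mu>)"
      using solve[OF \<mu> LV[OF w(1)[OF \<mu>]]] by blast
    have "cmod (\<phi> (w \<nu>) - \<phi> (w \<mu>) - (\<nu> - \<mu>) * \<phi> y) \<le> (2 * c1)^3 * (cmod (\<nu> - \<mu>))\<^sup>2"
      if "\<nu> \<in> ball 0 R" for \<nu>
    proof -
      have \<nu>: "cmod \<nu> < R" using that by simp
      have dV: "w \<nu> - w \<mu> \<in> V" using w \<mu> \<nu> subspace_diff[OF \<open>subspace V\<close>] by blast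
      have Ew: "E \<mu> (w \<nu>) = u + (\<nu> - \<mu>) *\<^sub>C T u u (w \<nu>)" using shift[of \<mu> "w \<nu>" \<nu>] w(2)[OF \<nu>] by simp
      have E1: "E \<mu> (w \<nu> - w \<mu>) = (\<nu> - \<mu>) *\<^sub>C T u u (w \<nu>)"
        using Ew w(2)[OF \<mu>] linear_diff[OF linE, of \<mu> "w \<nu>" "w \<mu>"] by simp
      have "norm (w \<nu> - w \<mu>) \<le> 2 * c1 * (cmod (\<nu> - \<mu>) * norm (w \<nu>))"
        using order_trans[OF lower[OF \<mu> dV] mult_left_mono] lam_L[of "\<nu> - \<mu>" "w \<nu>"] c1(1)
        unfolding E1 by simp
      also have "\<dots> \<le> 2 * c1 * (cmod (\<nu> - \<mu>) * (2 * c1))"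
        using nw[OF \<nu>] c1(1) by (intro mult_left_mono) auto
      finally have d1: "norm (w \<nu> - w \<mu>) \<le> (2 * c1)\<^sup>2 * cmod (\<nu> - \<mu>)"
        by (simp add: power2_eq_square mult_ac)
      define x where "x = w \<nu> - w \<mu> - (\<nu> - \<mu>) *\<^sub>C y"
      have xV: "x \<in> V" unfolding x_def using dV scV[OF y(1)] subspace_diff[OF \<open>subspace V\<close>] by blast
      have EC: "E \<mu> (a *\<^sub>C z) = a *\<^sub>C E \<mu> z" for a z
        by (simp add: E_def T_scaleC_right scaleC_diff_right scaleC_scaleC mult.commute)
      have "E \<mu> x = (\<nu> - \<mu>) *\<^sub>C T u u (w \<nu> - w \<mu>)"
        unfolding x_def linear_diff[OF linE] EC y(2)
        using E1 linear_diff[OF linE, of \<mu> "w \<nu>" "w \<mu>"] by (simp add: T_diff scaleC_diff_right)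
      then have "norm x \<le> 2 * c1 * (cmod (\<nu> - \<mu>) * norm (w \<nu> - w \<mu>))"
        using order_trans[OF lower[OF \<mu> xV] mult_left_mono] lam_L[of "\<nu> - \<mu>" "w \<nu> - w \<mu>"] c1(1) by simp
      also have "\<dots> \<le> 2 * c1 * (cmod (\<nu> - \<mu>) * ((2 * c1)\<^sup>2 * cmod (\<nu> - \<mu>)))"
        using d1 c1(1) by (intro mult_left_mono) auto
      finally have "norm x \<le> (2 * c1)^3 * (cmod (\<nu> - \<mu>))\<^sup>2"
        by (simp add: power2_eq_square power3_eq_cube mult_ac)
      moreover have "\<phi> x = \<phi> (w \<nu>) - \<phi> (w \<mu>) - (\<nu> - \<mu>) * \<phi> y"
        unfolding x_def using \<phi> cfunctional_bounded_linear[OF \<phi>]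
        by (simp add: bounded_linear.linear linear_diff cfunctional_scaleC)
      ultimately show ?thesis using cfunctional_bound[OF \<phi>, of x] by simp
    qed
    then have "((\<lambda>\<mu>. \<phi> (w \<mu>)) has_field_derivative \<phi> y) (at \<mu>)"
      using \<mu> by (intro has_field_derivative_quadratic[of "ball 0 R"]) auto
    then show "\<exists>f'. ((\<lambda>\<mu>. \<phi> (w \<mu>)) has_field_derivative f') (at \<mu> within ball 0 R)"
      by (blast intro: has_field_derivative_at_within)
  qed
  define r where "r = (1 + R) / 2"
  have r: "1 < r" "r < R" using R by (simp_all add: r_def)
  have sums: "(\<lambda>k. \<phi> (odd_power u k) * z ^ k) sums \<phi> (w z)" if \<phi>: "cfunctional \<phi>" and z: "cmod z < 1" for \<phi> z
  proof -
    have zR: "cmod z < R" using z R by simp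
    have Lw: "norm ((T u u ^^ n) (w z)) \<le> 2 * c1" for n
    proof (induction n)
      case (Suc n)
      then show ?case using L1[of "(T u u ^^ n) (w z)"] by simp
    qed (use nw[OF zR] in simp)
    have clin: "\<phi> (a + b) = \<phi> a + \<phi> b" "\<phi> (c *\<^sub>C a) = c * \<phi> a" for a b c
      using \<phi> by (auto simp: cfunctional_def)
    have wz: "w z = u + z *\<^sub>C T u u (w z)" using w(2)[OF zR] by (simp add: E_def algebra_simps)
    have powC: "(T u u ^^ n) (a + c *\<^sub>C b) = (T u u ^^ n) a + c *\<^sub>C (T u u ^^ n) b" for n a b c
      by (induction n) (simp_all add: T_add_right T_scaleC_right)
    have rem: "\<phi> (w z) - (\<Sum>k<n. \<phi> (odd_power u k) * z ^ k) = z ^ n * \<phi> ((T u u ^^ n) (w z))" for n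
    proof (induction n)
      case (Suc n)
      have "(T u u ^^ n) (w z) = odd_power u n + z *\<^sub>C (T u u ^^ Suc n) (w z)"
        by (subst wz) (simp only: powC odd_power_def funpow_Suc_right o_def)
      then have "z ^ n * \<phi> ((T u u ^^ n) (w z)) = z ^ n * \<phi> (odd_power u n) + z ^ Suc n * \<phi> ((T u u ^^ Suc n) (w z))"
        by (simp only: clin) (simp add: algebra_simps)
      then show ?case using Suc by (simp add: algebra_simps del: funpow.simps)
    qed simp
    have "(\<lambda>n. \<phi> (w z) - (\<Sum>k<n. \<phi> (odd_power u k) * z ^ k)) \<longlonglongrightarrow> 0"
    proof (rule Lim_null_comparison)
      show "\<forall>\<^sub>F n in sequentially. norm (\<phi> (w z) - (\<Sum>k<n. \<phi> (odd_power u k) * z ^ k)) \<le> cmod z ^ n * (2 * c1)"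
        unfolding rem norm_mult norm_power
        by (intro always_eventually allI mult_left_mono order_trans[OF cfunctional_bound[OF \<phi>] Lw]) auto
      show "(\<lambda>n. cmod z ^ n * (2 * c1)) \<longlonglongrightarrow> 0"
        using z by (intro tendsto_mult_left_zero LIMSEQ_power_zero) auto
    qed
    then have "(\<lambda>n. \<phi> (w z) - (\<phi> (w z) - (\<Sum>k<n. \<phi> (odd_power u k) * z ^ k))) \<longlonglongrightarrow> \<phi> (w z) - 0"
      by (intro tendsto_diff tendsto_const)
    then show ?thesis by (simp add: sums_def)
  qed
  have "norm (odd_power u k) \<le> 2 * c1 * (1 / r) ^ k" for k
  proof (rule norm_le_by_functionals)
    fix \<phi> :: "'a \<Rightarrow> complex" assume \<phi>: "cfunctional \<phi>"
    have "cmod (\<phi> (odd_power u k)) \<le> 2 * c1 / r ^ k"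
      using sums[OF \<phi>] r order_trans[OF cfunctional_bound[OF \<phi>] nw]
      by (intro sums_imp_coefficient_bound[OF hol[OF \<phi>]]) auto
    then show "cmod (\<phi> (odd_power u k)) \<le> 2 * c1 * (1 / r) ^ k" by (simp add: power_one_over)
  qed
  then show thesis using r by (intro that[of "1 / r"]) auto
qed

end

section \<open>Norm and spectral radius of Hermitian operators\<close>

text \<open>
Sinclair's theorem.  For a linear functional \<open>\<phi>\<close> of norm at most one the entire function
\<open>g 0 z = \<phi> (exp (\<i> (z / q) A) w)\<close> is bounded by \<open>norm w\<close> on the real line, because the exponentials are isometries
there.  Its derivatives on the real line are bounded uniformly in their order by the hypothesis, so
the Taylor expansion around the point \<open>Re z\<close> gives growth at most \<open>exp \<bar>Im z\<bar>\<close>, and Bernstein's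
inequality bounds the derivative at \<open>0\<close>, which is \<open>\<i> \<phi> (A w) / q\<close>.
\<close>

lemma hermitian_norm_le_of_power_bound:
  fixes A :: "'a::complex_banach \<Rightarrow> 'a"
  assumes herm: "hermitian A" and q: "0 < q"
    and pow: "\<And>n x. norm ((A ^^ n) x) \<le> K * q ^ n * norm x"
  shows "norm (A w) \<le> q * norm w"
proof (rule norm_le_by_functionals)
  fix \<phi> :: "'a \<Rightarrow> complex" assume \<phi>: "cfunctional \<phi>"
  have scaleA: "A (c *\<^sub>C x) = c *\<^sub>C A x" for c x
    using herm by (simp add: hermitian_def bounded_clinear_def clinear_def)
  have iso: "norm (op_exp (\<lambda>w. (\<i> * complex_of_real t) *\<^sub>C A w) z) = norm z" for t z
    using herm by (simp add: hermitian_def)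
  have ob: "cmod (\<phi> (op_exp (\<lambda>w. (\<i> * complex_of_real t) *\<^sub>C A w) z)) \<le> norm z" for t z
    using cfunctional_bound[OF \<phi>] iso by metis
  have bl\<phi>: "bounded_linear \<phi>" by (rule cfunctional_bounded_linear[OF \<phi>])
  define c where "c n = \<phi> ((A ^^ n) w)" for n
  define a where "a n = (\<i> / of_real q) ^ n * c n" for n
  have c_bound: "cmod (c n) \<le> K * q ^ n * norm w" for n
    unfolding c_def using order_trans[OF cfunctional_bound[OF \<phi>] pow] .
  have a_bound: "cmod (a n) \<le> K * norm w" for n
  proof -
    have "cmod (a n) = cmod (c n) / q ^ n"
      using q by (simp add: a_def norm_mult norm_power norm_divide power_divide)
    also have "\<dots> \<le> K * q ^ n * norm w / q ^ n"
      using q by (intro divide_right_mono c_bound) auto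
    finally show ?thesis using q by simp
  qed
  define g where "g m z = (\<Sum>n. a (n + m) / fact n * z ^ n)" for m and z :: complex
  have summ: "summable (\<lambda>n. a (n + m) / fact n * z ^ n)" for m and z :: complex
  proof (rule summable_comparison_test', rule summable_mult)
    show "summable (\<lambda>n. cmod z ^ n /\<^sub>R fact n)" by (rule summable_exp_generic)
    show "norm (a (n + m) / fact n * z ^ n) \<le> (K * norm w) * (cmod z ^ n /\<^sub>R fact n)"
      if "n \<ge> 0" for n
      using mult_right_mono[OF a_bound[of "n + m"], of "cmod z ^ n / fact n"]
      by (simp add: norm_mult norm_divide norm_power field_simps)
  qed
  have g_deriv: "(g m has_field_derivative g (Suc m) z) (at z)" for m z
  proof -
    have "diffs (\<lambda>n. a (n + m) / fact n) n = a (n + Suc m) / fact n" for n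
      by (simp add: diffs_def field_simps del: of_nat_Suc)
    then show ?thesis
      using termdiffs_strong_converges_everywhere[of "\<lambda>n. a (n + m) / fact n" z] summ
      unfolding g_def by simp
  qed
  have g_hol: "g m holomorphic_on S" for m S
    using g_deriv by (meson DERIV_subset holomorphic_on_def field_differentiable_def subset_UNIV
        has_field_derivative_at_within)
  have higher: "(deriv ^^ m) (g 0) = g m" for m
  proof (induction m)
    case (Suc m)
    have "deriv (g m) = g (Suc m)" using g_deriv by (auto intro: DERIV_imp_deriv)
    then show ?case using Suc by simp
  qed simp
  have g_real: "g m (of_real x) = (\<i> / of_real q) ^ m
      * \<phi> (op_exp (\<lambda>w. (\<i> * complex_of_real (x / q)) *\<^sub>C A w) ((A ^^ m) w))" for m x
  proof -
    let ?d = "\<i> * complex_of_real (x / q)"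
    let ?z = "(A ^^ m) w"
    have odd_power: "((\<lambda>w. ?d *\<^sub>C A w) ^^ n) ?z = ?d ^ n *\<^sub>C (A ^^ (n + m)) w" for n
    proof (induction n)
      case (Suc n)
      then show ?case by (simp add: scaleA scaleC_scaleC)
    qed (simp add: scaleC_one)
    have sv: "summable (\<lambda>n. (1 / fact n) *\<^sub>R ((\<lambda>w. ?d *\<^sub>C A w) ^^ n) ?z)"
    proof (rule summable_comparison_test', rule summable_mult)
      show "summable (\<lambda>n. \<bar>x\<bar> ^ n /\<^sub>R fact n)" by (rule summable_exp_generic)
      show "norm ((1 / fact n) *\<^sub>R ((\<lambda>w. ?d *\<^sub>C A w) ^^ n) ?z)
          \<le> (K * q ^ m * norm w) * (\<bar>x\<bar> ^ n /\<^sub>R fact n)" if "n \<ge> 0" for n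
      proof -
        have "norm ((1 / fact n) *\<^sub>R ((\<lambda>w. ?d *\<^sub>C A w) ^^ n) ?z)
            = \<bar>x\<bar> ^ n / q ^ n / fact n * norm ((A ^^ (n + m)) w)"
          using q unfolding norm_scaleR odd_power norm_scaleC
          by (simp add: norm_mult norm_power norm_divide power_divide)
        also have "\<dots> \<le> \<bar>x\<bar> ^ n / q ^ n / fact n * (K * q ^ (n + m) * norm w)"
          using q by (intro mult_left_mono pow) auto
        also have "\<dots> = (K * q ^ m * norm w) * (\<bar>x\<bar> ^ n /\<^sub>R fact n)"
          using q by (simp add: power_add field_simps)
        finally show ?thesis .
      qed
    qed
    have "\<phi> (op_exp (\<lambda>w. ?d *\<^sub>C A w) ?z) = (\<Sum>n. \<phi> ((1 / fact n) *\<^sub>R ((\<lambda>w. ?d *\<^sub>C A w) ^^ n) ?z))"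
      unfolding op_exp_def by (rule bounded_linear.suminf[OF bl\<phi> sv])
    also have "(\<lambda>n. \<phi> ((1 / fact n) *\<^sub>R ((\<lambda>w. ?d *\<^sub>C A w) ^^ n) ?z))
        = (\<lambda>n. ?d ^ n / fact n * c (n + m))"
      unfolding odd_power c_def scaleR_scaleC scaleC_scaleC cfunctional_scaleC[OF \<phi>] by (simp add: mult_ac)
    finally have e: "\<phi> (op_exp (\<lambda>w. ?d *\<^sub>C A w) ?z) = (\<Sum>n. ?d ^ n / fact n * c (n + m))" .
    have eq: "a (n + m) / fact n * of_real x ^ n = (\<i> / of_real q) ^ m * (?d ^ n / fact n * c (n + m))" for n
      by (simp add: a_def power_add power_mult_distrib power_divide mult_ac)
    have "summable (\<lambda>n. (\<i> / of_real q) ^ m * (?d ^ n / fact n * c (n + m)))"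
      using summ[of m "of_real x"] unfolding eq .
    then have "summable (\<lambda>n. ?d ^ n / fact n * c (n + m))"
      by (rule summable_mult_D) (use q in simp)
    then show ?thesis unfolding g_def eq e by (rule suminf_mult)
  qed
  have on_real: "cmod (g m (of_real x)) \<le> K * norm w" for m x
  proof -
    have "cmod (g m (of_real x)) \<le> (1 / q) ^ m * norm ((A ^^ m) w)"
      unfolding g_real norm_mult norm_power
      by (intro mult_mono ob) (use q in \<open>auto simp: norm_divide\<close>)
    also have "\<dots> \<le> (1 / q) ^ m * (K * q ^ m * norm w)"
      using q by (intro mult_left_mono pow) auto
    finally show ?thesis using q by (simp add: power_one_over)
  qed
  have on_real0: "cmod (g 0 (of_real x)) \<le> norm w" for x
    using ob[of "x / q" w] unfolding g_real by simp
  have growth: "cmod (g 0 z) \<le> (K * norm w) * exp \<bar>Im z\<bar>" for z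
  proof -
    define x y where "x = Re z" and "y = Im z"
    have "(\<lambda>m. (deriv ^^ m) (g 0) (of_real x) / fact m * (z - of_real x) ^ m) sums g 0 z"
      by (rule holomorphic_power_series[of _ _ "\<bar>y\<bar> + 1"])
        (use g_hol in \<open>auto simp: dist_norm x_def y_def cmod_def complex_eq_iff\<close>)
    moreover have "z - of_real x = \<i> * of_real y" by (simp add: x_def y_def complex_eq_iff)
    ultimately have s: "(\<lambda>m. g m (of_real x) / fact m * (\<i> * of_real y) ^ m) sums g 0 z"
      by (simp add: higher)
    have e: "(\<lambda>m. (K * norm w) * (\<bar>y\<bar> ^ m /\<^sub>R fact m)) sums ((K * norm w) * exp \<bar>y\<bar>)"
      by (intro sums_mult exp_converges)
    have le: "norm (g m (of_real x) / fact m * (\<i> * of_real y) ^ m) \<le> (K * norm w) * (\<bar>y\<bar> ^ m /\<^sub>R fact m)" for m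
      using mult_right_mono[OF on_real[of m x], of "\<bar>y\<bar> ^ m / fact m"]
      by (simp add: norm_mult norm_divide norm_power field_simps)
    have "norm (\<Sum>m. g m (of_real x) / fact m * (\<i> * of_real y) ^ m) \<le> (\<Sum>m. (K * norm w) * (\<bar>y\<bar> ^ m /\<^sub>R fact m))"
      by (rule norm_suminf_le[OF le sums_summable[OF e]])
    then show ?thesis using s e by (simp add: sums_iff y_def)
  qed
  show "cmod (\<phi> (A w)) \<le> q * norm w"
  proof (cases "w = 0")
    case True
    then show ?thesis using cfunctional_bound[OF \<phi>, of "A w"] pow[of 1 w] by simp
  next
    case False
    define f where "f z = g 0 z / of_real (norm w)" for z
    have "cmod (deriv f 0) \<le> 1"
    proof (rule bernstein_inequality)
      show "f holomorphic_on UNIV" unfolding f_def using False by (intro holomorphic_intros g_hol) auto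
      show "cmod (f z) \<le> K * exp \<bar>Im z\<bar>" for z
        using growth[of z] False by (simp add: f_def norm_divide field_simps)
      show "cmod (f (of_real x)) \<le> 1" for x
        using on_real0[of x] False by (simp add: f_def norm_divide field_simps)
    qed
    moreover have "deriv f 0 = a 1 / of_real (norm w)"
    proof (rule DERIV_imp_deriv)
      have "g 1 0 = a 1"
        unfolding g_def using powser_zero[of "\<lambda>n. a (n + 1) / fact n"] by simp
      then have "(g 0 has_field_derivative a 1) (at 0)" using g_deriv[of 0 0] by simp
      then show "(f has_field_derivative a 1 / of_real (norm w)) (at 0)"
        unfolding f_def by (rule DERIV_cdivide)
    qed
    ultimately have "cmod (a 1) \<le> norm w"
      using False by (simp add: norm_divide)
    then show ?thesis
      using q by (simp add: a_def c_def norm_mult norm_divide field_simps)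
  qed
qed

context jb_star_triple
begin

text \<open>
If the operator were bounded below, the odd powers of \<open>u\<close> and then the powers of \<open>u \<box> u\<close> would decay
geometrically; as \<open>u \<box> u\<close> is Hermitian, its norm would be less than \<open>1\<close>, but it is
\<open>(norm u)\<^sup>2\<close>.
\<close>

lemma bergman_not_bounded_below:
  assumes "norm u = 1"
  shows "\<not> (\<forall>x. norm x \<le> c * norm (x - 2 *\<^sub>R T u u x + quad u (quad u x)))"
proof
  assume "\<forall>x. norm x \<le> c * norm (x - 2 *\<^sub>R T u u x + quad u (quad u x))"
  then obtain C q where q: "0 < q" "q < 1" and decay: "\<And>k. norm (odd_power u k) \<le> C * q ^ k"
    using odd_power_decay[OF assms] by metis
  obtain K where K: "\<And>n w. norm ((T u u ^^ n) w) \<le> K * q ^ n * norm w"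
    using box_power_decay[OF q(1) decay] by metis
  have "norm (T u u w) \<le> q * norm w" for w
    by (rule hermitian_norm_le_of_power_bound[OF _ q(1) K]) (rule box_hermitian)
  then have "onorm (\<lambda>z. T u u z) \<le> q"
    using q by (intro onorm_bound) auto
  then show False using box_norm[of u] assms q by simp
qed

end

section \<open>The Bergman operator along field lines\<close>

lemma bounded_inverse_on_UNIV_comp:
  assumes "bounded_inverse_on UNIV f c" "bounded_inverse_on UNIV g d" "0 \<le> d"
  shows "bounded_inverse_on UNIV (\<lambda>x. f (g x)) (d * c)"
proof -
  have "norm x \<le> (d * c) * norm (f (g x))" for x
  proof -
    have "norm x \<le> d * norm (g x)" using assms(2) by (auto simp: bounded_inverse_on_def)
    also have "\<dots> \<le> d * (c * norm (f (g x)))"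
      using assms(1,3) by (intro mult_left_mono) (auto simp: bounded_inverse_on_def)
    finally show ?thesis by (simp add: mult_ac)
  qed
  moreover have "range (\<lambda>x. f (g x)) = UNIV"
    using assms(1,2) by (metis bounded_inverse_on_def image_image)
  ultimately show ?thesis by (simp add: bounded_inverse_on_def)
qed

text \<open>
Up to terms of smaller order, \<open>P (t + h)\<close> is \<open>(1 + h M) P (1 + h N)\<close>, and
the outer factors have inverses of norm at most \<open>1 / (1 - h K)\<close>.  Hence the bound for the inverse
grows by a factor of at most \<open>exp (4 K h)\<close> in a short time step, and Bolzano's lemma chains the
steps.  The constant \<open>4\<close> exceeds the two factors \<open>K\<close> of the leading term and leaves room
for the error.
\<close>

lemma bounded_inverse_propagates:
  fixes P M N :: "real \<Rightarrow> 'a::banach \<Rightarrow>\<^sub>L 'a"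
  assumes der: "\<And>t. t \<in> {0..b} \<Longrightarrow>
      (P has_vector_derivative ((M t o\<^sub>L P t) + (P t o\<^sub>L N t))) (at t within {0..b})"
    and M: "\<And>t. t \<in> {0..b} \<Longrightarrow> norm (M t) \<le> K" and N: "\<And>t. t \<in> {0..b} \<Longrightarrow> norm (N t) \<le> K"
    and K: "0 < K" and b: "0 \<le> b" and c: "0 < c"
    and start: "bounded_inverse_on UNIV (P 0) c"
  shows "bounded_inverse_on UNIV (P b) (c * exp (4 * K * b))"
proof -
  define k where "k t = c * exp (4 * K * t)" for t
  have kpos: "0 < k t" for t using c by (simp add: k_def)
  \<comment> \<open>an error of \<open>\<epsilon> * h\<close> then costs at most \<open>h * K\<close>, because \<open>k s \<le> k b\<close>\<close>
  define \<epsilon> where "\<epsilon> = K / k b"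
  have \<epsilon>: "0 < \<epsilon>" using K kpos by (simp add: \<epsilon>_def)
  have local: "\<exists>d>0. \<forall>s t. s \<le> x \<and> x \<le> t \<and> t - s < d \<longrightarrow>
      (0 \<le> s \<and> t \<le> b \<longrightarrow> bounded_inverse_on UNIV (P s) (k s) \<longrightarrow> bounded_inverse_on UNIV (P t) (k t))"
    if x: "0 \<le> x" "x \<le> b" for x
  proof -
    have x': "x \<in> {0..b}" using x by simp
    define D where "D = (M x o\<^sub>L P x) + (P x o\<^sub>L N x)"
    define W where "W = 2 * K * (norm D + \<epsilon>/2) + K\<^sup>2 * (norm (P x) + (norm D + \<epsilon>/2))"
    have W: "0 \<le> W" unfolding W_def using K \<epsilon> by (intro add_nonneg_nonneg mult_nonneg_nonneg) auto
    obtain d1 where d1: "0 < d1" "\<And>y. y \<in> {0..b} \<Longrightarrow> \<bar>y - x\<bar> < d1 \<Longrightarrow>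
        norm (P y - P x - (y - x) *\<^sub>R D) \<le> \<epsilon>/2 * \<bar>y - x\<bar>"
      using der[OF x'] \<epsilon> unfolding has_vector_derivative_def has_derivative_within_alt D_def
      by (auto dest!: spec[of _ "\<epsilon>/2"])
    define d where "d = min (min d1 1) (min (1 / (12 * K)) (\<epsilon> / (2 * (W + 1))))"
    have dpos: "0 < d" using d1 K \<epsilon> W by (auto simp: d_def)
    show ?thesis
    proof (intro exI[of _ d] conjI allI impI dpos)
      fix s t assume st: "s \<le> x \<and> x \<le> t \<and> t - s < d" "0 \<le> s \<and> t \<le> b"
        and inv: "bounded_inverse_on UNIV (P s) (k s)"
      define h where "h = t - s"
      have h: "0 \<le> h" "h < d1" "h \<le> 1" "h * K \<le> 1/12" "h * W \<le> \<epsilon>/2"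
      proof -
        have "h < d" using st by (simp add: h_def)
        then show "h < d1" "h \<le> 1" by (auto simp: d_def)
        show "0 \<le> h" using st by (simp add: h_def)
        have "h \<le> 1 / (12 * K)" using \<open>h < d\<close> by (simp add: d_def)
        then show "h * K \<le> 1/12" using K by (simp add: field_simps)
        have "h * (W + 1) \<le> \<epsilon>/2" using \<open>h < d\<close> W by (simp add: d_def field_simps)
        then show "h * W \<le> \<epsilon>/2" using \<open>0 \<le> h\<close> by (simp add: algebra_simps)
      qed
      let ?M = "M x" and ?N = "N x"
      have sx: "norm (P s - P x - (s - x) *\<^sub>R D) \<le> \<epsilon>/2 * (x - s)"
      proof -
        have "\<bar>s - x\<bar> = x - s" using st by linarith
        then show ?thesis using d1(2)[of s] st x h(2) by (simp add: h_def)
      qed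
      have tx: "norm (P t - P x - (t - x) *\<^sub>R D) \<le> \<epsilon>/2 * (t - x)"
      proof -
        have "\<bar>t - x\<bar> = t - x" using st by linarith
        then show ?thesis using d1(2)[of t] st x h(2) by (simp add: h_def)
      qed
      have e1: "norm (P t - P s - h *\<^sub>R D) \<le> \<epsilon>/2 * h"
      proof -
        have eq: "P t - P s - h *\<^sub>R D = (P t - P x - (t - x) *\<^sub>R D) - (P s - P x - (s - x) *\<^sub>R D)"
          by (simp add: h_def algebra_simps)
        have "norm (P t - P s - h *\<^sub>R D) \<le> \<epsilon>/2 * (t - x) + \<epsilon>/2 * (x - s)"
          unfolding eq by (rule order_trans[OF norm_triangle_ineq4 add_mono[OF tx sx]])
        also have "\<epsilon>/2 * (t - x) + \<epsilon>/2 * (x - s) = \<epsilon>/2 * h"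
          by (simp add: h_def field_simps)
        finally show ?thesis .
      qed
      have e2: "norm (P s - P x) \<le> (norm D + \<epsilon>/2) * h"
      proof -
        have "norm (P s - P x) \<le> norm (P s - P x - (s - x) *\<^sub>R D) + norm ((s - x) *\<^sub>R D)"
          using norm_triangle_ineq[of "P s - P x - (s - x) *\<^sub>R D" "(s - x) *\<^sub>R D"] by simp
        also have "\<dots> \<le> \<epsilon>/2 * (x - s) + (x - s) * norm D"
        proof -
          have "\<bar>s - x\<bar> = x - s" using st by linarith
          then show ?thesis using sx by simp
        qed
        also have "\<dots> = (norm D + \<epsilon>/2) * (x - s)" by (simp add: algebra_simps)
        also have "\<dots> \<le> (norm D + \<epsilon>/2) * h"
          using st \<epsilon> by (intro mult_left_mono) (auto simp: h_def)
        finally show ?thesis .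
      qed
      define Z where "Z = (id_blinfun + h *\<^sub>R ?M) o\<^sub>L P s o\<^sub>L (id_blinfun + h *\<^sub>R ?N)"
      have err: "norm (P t - Z) \<le> \<epsilon> * h"
      proof -
        have Zeq: "P t - Z = (P t - P s - h *\<^sub>R D)
            - h *\<^sub>R ((?M o\<^sub>L (P s - P x)) + ((P s - P x) o\<^sub>L ?N)) - (h * h) *\<^sub>R (?M o\<^sub>L P s o\<^sub>L ?N)"
          by (rule blinfun_eqI)
            (simp add: Z_def D_def blinfun.bilinear_simps algebra_simps)
        have n1: "norm ((?M o\<^sub>L (P s - P x)) + ((P s - P x) o\<^sub>L ?N)) \<le> 2 * K * ((norm D + \<epsilon>/2) * h)"
        proof -
          have "norm (?M o\<^sub>L (P s - P x)) \<le> K * norm (P s - P x)"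
            "norm ((P s - P x) o\<^sub>L ?N) \<le> K * norm (P s - P x)"
            using order_trans[OF norm_blinfun_compose mult_right_mono[OF M[OF x']]]
              order_trans[OF norm_blinfun_compose mult_left_mono[OF N[OF x']]]
            by (auto simp: mult.commute)
          then have "norm ((?M o\<^sub>L (P s - P x)) + ((P s - P x) o\<^sub>L ?N)) \<le> 2 * K * norm (P s - P x)"
            by (intro norm_triangle_le) linarith
          also have "\<dots> \<le> 2 * K * ((norm D + \<epsilon>/2) * h)"
            using K e2 by (intro mult_left_mono) auto
          finally show ?thesis .
        qed
        have Ps: "norm (P s) \<le> norm (P x) + (norm D + \<epsilon>/2)"
        proof -
          have "norm (P s) \<le> norm (P x) + norm (P s - P x)"
            using norm_triangle_ineq[of "P x" "P s - P x"] by simp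
          moreover have "(norm D + \<epsilon>/2) * h \<le> (norm D + \<epsilon>/2) * 1"
            using h \<epsilon> by (intro mult_left_mono) auto
          from order_trans[OF e2 this] have "norm (P s - P x) \<le> norm D + \<epsilon>/2" by simp
          ultimately show ?thesis by linarith
        qed
        have n2: "norm (?M o\<^sub>L P s o\<^sub>L ?N) \<le> K\<^sup>2 * (norm (P x) + (norm D + \<epsilon>/2))"
        proof -
          have nn: "0 \<le> norm (P x) + (norm D + \<epsilon>/2)" using \<epsilon> by simp
          have "norm (?M o\<^sub>L P s o\<^sub>L ?N) \<le> norm (?M o\<^sub>L P s) * norm ?N" by (rule norm_blinfun_compose)
          also have "\<dots> \<le> (norm ?M * norm (P s)) * norm ?N"
            by (intro mult_right_mono norm_blinfun_compose) auto
          also have "\<dots> \<le> (K * (norm (P x) + (norm D + \<epsilon>/2))) * K"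
            using K M[OF x'] N[OF x'] Ps nn by (intro mult_mono) auto
          finally show ?thesis by (simp add: power2_eq_square mult_ac)
        qed
        have "norm (P t - Z) \<le> norm (P t - P s - h *\<^sub>R D)
            + norm (h *\<^sub>R ((?M o\<^sub>L (P s - P x)) + ((P s - P x) o\<^sub>L ?N))) + norm ((h * h) *\<^sub>R (?M o\<^sub>L P s o\<^sub>L ?N))"
          unfolding Zeq by (rule order_trans[OF norm_triangle_ineq4 add_right_mono[OF norm_triangle_ineq4]])
        also have "\<dots> \<le> \<epsilon>/2 * h + h * (2 * K * ((norm D + \<epsilon>/2) * h))
            + (h * h) * (K\<^sup>2 * (norm (P x) + (norm D + \<epsilon>/2)))"
          unfolding norm_scaleR using h(1) e1 n1 n2 by (intro add_mono mult_mono) auto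
        also have "\<dots> = \<epsilon>/2 * h + h * (h * W)" by (simp add: W_def algebra_simps)
        also have "\<dots> \<le> \<epsilon>/2 * h + h * (\<epsilon>/2)" using h by (intro add_left_mono mult_left_mono) auto
        finally show ?thesis by simp
      qed
      have fac: "bounded_inverse_on UNIV (id_blinfun + h *\<^sub>R X) (1 / (1 - h * K))" if "norm X \<le> K" for X :: "'a \<Rightarrow>\<^sub>L 'a"
      proof -
        have "bounded_inverse_on UNIV (\<lambda>x::'a. x) 1" by (simp add: bounded_inverse_on_def)
        then have "bounded_inverse_on UNIV (id_blinfun + h *\<^sub>R X) (1 / (1 - 1 * (h * K)))"
        proof (rule bounded_inverse_on_perturb)
          show "linear (blinfun_apply (id_blinfun + h *\<^sub>R X))"
            by (simp add: blinfun.bounded_linear_right bounded_linear.linear)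
          show "norm ((id_blinfun + h *\<^sub>R X) v - v) \<le> (h * K) * norm v" for v
          proof -
            have "norm (X v) \<le> K * norm v"
              by (rule order_trans[OF norm_blinfun mult_right_mono[OF that]]) simp
            then have "h * norm (X v) \<le> h * (K * norm v)" using h(1) by (rule mult_left_mono)
            then show ?thesis using h(1) by (simp add: blinfun.bilinear_simps mult_ac)
          qed
        qed (use h K in \<open>auto simp: linear_ident\<close>)
        then show ?thesis by simp
      qed
      let ?q = "1 / (1 - h * K)"
      have q0: "0 < ?q" using h(4) by simp
      have Zinv: "bounded_inverse_on UNIV Z (?q * (k s * ?q))"
      proof -
        have "bounded_inverse_on UNIV (\<lambda>v. (id_blinfun + h *\<^sub>R ?M) (P s v)) (k s * ?q)"
          using kpos[of s] by (intro bounded_inverse_on_UNIV_comp fac M x' inv) auto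
        from bounded_inverse_on_UNIV_comp[OF this fac[OF N[OF x']]] q0
        have "bounded_inverse_on UNIV
            (\<lambda>v. (id_blinfun + h *\<^sub>R ?M) (P s ((id_blinfun + h *\<^sub>R ?N) v))) (?q * (k s * ?q))"
          by simp
        moreover have "blinfun_apply Z
            = (\<lambda>v. (id_blinfun + h *\<^sub>R ?M) (P s ((id_blinfun + h *\<^sub>R ?N) v)))"
          by (simp add: Z_def fun_eq_iff)
        ultimately show ?thesis by (simp only:)
      qed
      define y where "y = h * K"
      have y: "0 \<le> y" "y \<le> 1/12" using h K by (auto simp: y_def)
      define c1 where "c1 = ?q * (k s * ?q)"
      have c1: "0 < c1" "c1 * (1 - y)\<^sup>2 = k s" using q0 kpos[of s] y
        by (auto simp: c1_def y_def power2_eq_square)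
      have ksb: "k s * (\<epsilon> * h) \<le> y"
      proof -
        have "k s \<le> k b" unfolding k_def using c K st x by (intro mult_left_mono) auto
        then have "k s * (\<epsilon> * h) \<le> k b * (\<epsilon> * h)" using \<epsilon> h by (intro mult_right_mono) auto
        also have "\<dots> = y" using kpos[of b] by (simp add: \<epsilon>_def y_def)
        finally show ?thesis .
      qed
      have y2: "(1 - y)\<^sup>2 - y \<ge> 1 - 3 * y" by (simp add: power2_eq_square algebra_simps)
      have dd: "(1 - y)\<^sup>2 * (c1 * (\<epsilon> * h)) \<le> y" using ksb unfolding c1(2)[symmetric] by (simp add: mult_ac)
      have sq: "0 < (1 - y)\<^sup>2" using y by simp
      have lt: "c1 * (\<epsilon> * h) < 1"
      proof -
        have "(1 - y)\<^sup>2 * (c1 * (\<epsilon> * h)) < (1 - y)\<^sup>2 * 1" using dd y2 y by linarith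
        then show ?thesis using sq by (simp only: mult_less_cancel_left_pos)
      qed
      have "bounded_inverse_on UNIV (P t) (c1 / (1 - c1 * (\<epsilon> * h)))"
      proof (rule bounded_inverse_on_perturb[OF Zinv[folded c1_def]])
        show "norm (P t v - Z v) \<le> \<epsilon> * h * norm v" for v
          using order_trans[OF norm_blinfun mult_right_mono[OF err norm_ge_zero]]
          by (simp flip: blinfun.diff_left)
      qed (use h \<epsilon> c1 lt in \<open>auto simp: blinfun.bounded_linear_right bounded_linear.linear\<close>)
      moreover have "c1 / (1 - c1 * (\<epsilon> * h)) \<le> k t"
      proof -
        have "k t = k s * exp (4 * y)"
          by (simp add: k_def y_def h_def exp_add[symmetric] algebra_simps)
        also have "\<dots> \<ge> k s * (1 + 4 * y)"
          using kpos[of s] exp_ge_add_one_self[of "4 * y"] by (intro mult_left_mono) auto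
        finally have kt: "k s * (1 + 4 * y) \<le> k t" .
        have "1 \<le> (1 + 4 * y) * (1 - 3 * y)"
        proof -
          have "12 * y * y \<le> y" using mult_right_mono[OF y(2) y(1)] by simp
          then show ?thesis by (simp add: algebra_simps)
        qed
        also have "\<dots> \<le> (1 + 4 * y) * ((1 - y)\<^sup>2 * (1 - c1 * (\<epsilon> * h)))"
          using y2 dd y by (intro mult_left_mono) (auto simp: right_diff_distrib)
        finally have "k s * 1 \<le> k s * ((1 + 4 * y) * ((1 - y)\<^sup>2 * (1 - c1 * (\<epsilon> * h))))"
          using kpos[of s] by (intro mult_left_mono) auto
        then have "c1 * (1 - y)\<^sup>2 \<le> (k s * (1 + 4 * y) * (1 - c1 * (\<epsilon> * h))) * (1 - y)\<^sup>2"
          using c1(2) by (simp add: mult_ac)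
        then have "c1 \<le> k s * (1 + 4 * y) * (1 - c1 * (\<epsilon> * h))"
          using sq by (simp only: mult_le_cancel_right_pos)
        also have "\<dots> \<le> k t * (1 - c1 * (\<epsilon> * h))" using kt lt by (intro mult_right_mono) auto
        finally show ?thesis using lt by (simp add: field_simps)
      qed
      ultimately show "bounded_inverse_on UNIV (P t) (k t)" by (rule bounded_inverse_on_mono)
    qed
  qed
  have "0 \<le> (0::real) \<and> b \<le> b \<longrightarrow> bounded_inverse_on UNIV (P 0) (k 0) \<longrightarrow> bounded_inverse_on UNIV (P b) (k b)"
    by (rule Bolzano[OF b]) (use local in auto)
  then show ?thesis using start by (simp add: k_def)
qed

context jb_star_triple
begin

definition bergman :: "'a \<Rightarrow> 'a \<Rightarrow> 'a" where
  "bergman z w = w - 2 *\<^sub>R T z z w + quad z (quad z w)"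

text \<open>
Again two instances of the Jordan identity that form a system with a unique solution.
\<close>

lemma quad_box: "T z a (quad z y) = T (quad z a) y z" "quad z (T a z y) = T (quad z a) y z"
proof -
  let ?K = "T (quad z a) y z" and ?X = "T z a (quad z y)" and ?Y = "quad z (T a z y)"
  have 1: "?X = 2 *\<^sub>R ?K - ?Y"
    using jordan[of z a z y z] symmetric[of z y "T z a z"] by (simp add: quad_def scaleR_2)
  have 2: "?K = 2 *\<^sub>R ?X - ?Y"
    using jordan[of z y z a z] symmetric[of z y "T z a z"] symmetric[of "T z y z" a z]
      symmetric[of y z a] by (simp add: quad_def scaleR_2)
  have "?X = ?Y" using 1 2 by (rule two_term_system)
  then show "?X = ?K" "?Y = ?K" using 2 by (simp_all add: scaleR_2)
qed

text \<open>
The cubic part in \<open>z\<close> of the differential equation for the Bergman operator.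
\<close>

lemma bergman_cubic:
  "T (quad z a) z w + T z (quad z a) w + T a (quad z w) z + quad z (T a w z)
    = 2 *\<^sub>R T z a (T z z w) + 2 *\<^sub>R T z z (T a z w)"
proof -
  have 1: "T a z (T w z z) = T (T a z w) z z - T w (T z a z) z + T w z (T a z z)"
    using jordan[of a z w z z] .
  have 2: "T w z (T a z z) = T (T w z a) z z - T a (T z w z) z + T a z (T w z z)"
    using jordan[of w z a z z] .
  have 3: "T w z (T z a z) = T (T w z z) a z - T z (T z w a) z + T z a (T w z z)"
    using jordan[of w z z a z] .
  note s = symmetric[of w z z] symmetric[of a z z] symmetric[of w z a]
    symmetric[of "T a z w" z z] symmetric[of "T z z w" a z] symmetric[of "T z a z" z w]
    symmetric[of w "T z a z" z] symmetric[of z w a]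
  have "T a (quad z w) z + T z (quad z a) w = 2 *\<^sub>R T z z (T a z w)"
    using 1 2 unfolding s quad_def scaleR_2 by (simp add: algebra_simps)
  moreover have "T (quad z a) z w + quad z (T a w z) = 2 *\<^sub>R T z a (T z z w)"
    using 3 unfolding s quad_def scaleR_2 by (simp add: algebra_simps)
  ultimately have "(T (quad z a) z w + quad z (T a w z)) + (T a (quad z w) z + T z (quad z a) w)
      = 2 *\<^sub>R T z a (T z z w) + 2 *\<^sub>R T z z (T a z w)" by simp
  then show ?thesis by (simp only: add.assoc add.commute add.left_commute)
qed

text \<open>
The left-hand side is the derivative of \<open>bergman z w\<close> in the direction
\<open>z' = a - {z,a,z}\<close>.  Sorted by degree in \<open>z\<close>, the linear parts agree by inspection, the cubic parts by
\<open>bergman_cubic\<close> and the quintic parts by \<open>quad_box\<close>.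
\<close>

lemma bergman_derivative_identity:
  fixes z a w defines "z' \<equiv> a - T z a z"
  shows "- 2 *\<^sub>R (T z' z w + T z z' w) + (T z' (quad z w) z + T z (quad z w) z')
      + quad z (T z' w z + T z w z') = - 2 *\<^sub>R T z a (bergman z w) + bergman z (- 2 *\<^sub>R T a z w)"
proof -
  have sym: "T z y z' = T z' y z" for y by (rule symmetric)
  have z': "T z' y x = T a y x - T (quad z a) y x" "T x z' y = T x a y - T x (quad z a) y" for x y
    by (simp_all add: z'_def quad_def T_diff)
  have q1: "T (quad z a) (quad z w) z = T z a (quad z (quad z w))" using quad_box(1)[of z a "quad z w"] by simp
  have q2: "T (quad z a) w z = quad z (T a z w)" using quad_box(2)[of z a w] by simp
  have Qneg: "quad z (- 2 *\<^sub>R y) = - 2 *\<^sub>R quad z y" for y by (rule quad_scaleR)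
  have "T (quad z a) z w + T z (quad z a) w
    = 2 *\<^sub>R T z a (T z z w) + 2 *\<^sub>R T z z (T a z w) - T a (quad z w) z - quad z (T a w z)"
    using bergman_cubic[of z a w] by (simp add: algebra_simps)
  then have c: "2 *\<^sub>R T (quad z a) z w + 2 *\<^sub>R T z (quad z a) w
    = 2 *\<^sub>R (2 *\<^sub>R T z a (T z z w)) + 2 *\<^sub>R (2 *\<^sub>R T z z (T a z w))
      - 2 *\<^sub>R T a (quad z w) z - 2 *\<^sub>R quad z (T a w z)"
    by (simp only: scaleR_add_right[symmetric] scaleR_diff_right[symmetric])
  have "- 2 *\<^sub>R (T z' z w + T z z' w) + (T z' (quad z w) z + T z (quad z w) z')
      + quad z (T z' w z + T z w z')
    = (2 *\<^sub>R T (quad z a) z w + 2 *\<^sub>R T z (quad z a) w) - 2 *\<^sub>R T a z w - 2 *\<^sub>R T z a w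
      + 2 *\<^sub>R T a (quad z w) z - 2 *\<^sub>R T z a (quad z (quad z w))
      + 2 *\<^sub>R quad z (T a w z) - 2 *\<^sub>R quad z (quad z (T a z w))"
    unfolding sym z' q1 q2 quad_add quad_diff
    by (simp add: scaleR_2 algebra_simps)
  also have "\<dots> = - 2 *\<^sub>R T z a (bergman z w) + bergman z (- 2 *\<^sub>R T a z w)"
    unfolding c bergman_def T_add_right T_diff T_scaleR Qneg
    by (simp add: algebra_simps)
  finally show ?thesis .
qed

definition box_op :: "'a \<Rightarrow> 'a \<Rightarrow> 'a \<Rightarrow>\<^sub>L 'a" where "box_op x y = Blinfun (\<lambda>w. T x y w)"
definition quad_op :: "'a \<Rightarrow> 'a \<Rightarrow> 'a \<Rightarrow>\<^sub>L 'a" where "quad_op x y = Blinfun (\<lambda>w. T x w y)"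

lemma box_op_apply [simp]: "box_op x y w = T x y w" and quad_op_apply [simp]: "quad_op x y w = T x w y"
  by (simp_all add: box_op_def quad_op_def bounded_linear_Blinfun_apply T_bounded_linear)

lemma norm_box_op: "norm (box_op x y) \<le> 4 * norm x * norm y"
  by (rule norm_blinfun_bound) (auto simp: T_bound)

lemma norm_quad_op: "norm (quad_op x y) \<le> 4 * norm x * norm y"
  by (rule norm_blinfun_bound) (use T_bound[of x _ y] in \<open>auto simp: mult_ac\<close>)

lemma bounded_bilinear_box_op: "bounded_bilinear box_op"
proof
  show "\<exists>K. \<forall>a b. norm (box_op a b) \<le> norm a * norm b * K"
    using norm_box_op by (intro exI[of _ 4]) (simp add: mult_ac)
qed (auto intro!: blinfun_eqI simp: blinfun.bilinear_simps T_add_left add_mid T_scaleR)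

lemma bounded_bilinear_quad_op: "bounded_bilinear quad_op"
proof
  show "\<exists>K. \<forall>a b. norm (quad_op a b) \<le> norm a * norm b * K"
    using norm_quad_op by (intro exI[of _ 4]) (simp add: mult_ac)
qed (auto intro!: blinfun_eqI simp: blinfun.bilinear_simps T_add_left T_add_right T_scaleR)

lemma bergman_invertible_along_path:
  assumes p: "\<And>t. t \<in> {0..b} \<Longrightarrow>
      (p has_vector_derivative (a t - T (p t) (a t) (p t))) (at t within {0..b})"
    and a: "\<And>t. t \<in> {0..b} \<Longrightarrow> norm (a t) \<le> A" and R: "\<And>t. t \<in> {0..b} \<Longrightarrow> norm (p t) \<le> R"
    and b: "0 \<le> b" and c: "0 < c" and start: "bounded_inverse_on UNIV (bergman (p 0)) c"
  obtains c' where "0 < c'" "bounded_inverse_on UNIV (bergman (p b)) c'"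
proof -
  define P where "P t = id_blinfun - 2 *\<^sub>R box_op (p t) (p t) + (quad_op (p t) (p t) o\<^sub>L quad_op (p t) (p t))" for t
  have P: "blinfun_apply (P t) = bergman (p t)" for t
    by (simp add: P_def fun_eq_iff bergman_def quad_def blinfun.bilinear_simps)
  define M N where "M t = - 2 *\<^sub>R box_op (p t) (a t)" and "N t = - 2 *\<^sub>R box_op (a t) (p t)" for t
  define K where "K = 8 * ((\<bar>R\<bar> + 1) * (\<bar>A\<bar> + 1))"
  have K: "0 < K" by (simp add: K_def)
  have MN: "norm (M t) \<le> K" "norm (N t) \<le> K" if "t \<in> {0..b}" for t
  proof -
    have "norm (p t) * norm (a t) \<le> (\<bar>R\<bar> + 1) * (\<bar>A\<bar> + 1)"
      using a[OF that] R[OF that] by (intro mult_mono) auto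
    then have "8 * (norm (p t) * norm (a t)) \<le> K"
      unfolding K_def by (rule mult_left_mono) simp
    moreover have "norm (box_op (p t) (a t)) \<le> 4 * (norm (p t) * norm (a t))"
      "norm (box_op (a t) (p t)) \<le> 4 * (norm (p t) * norm (a t))"
      using norm_box_op[of "p t" "a t"] norm_box_op[of "a t" "p t"] by (simp_all add: mult_ac)
    ultimately show "norm (M t) \<le> K" "norm (N t) \<le> K" by (auto simp: M_def N_def)
  qed
  have der: "(P has_vector_derivative ((M t o\<^sub>L P t) + (P t o\<^sub>L N t))) (at t within {0..b})"
    if t: "t \<in> {0..b}" for t
  proof -
    let ?z = "p t" and ?z' = "a t - T (p t) (a t) (p t)"
    note pt = p[OF t]
    note dT = bounded_bilinear.has_vector_derivative[OF bounded_bilinear_box_op pt pt]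
    note dQ = bounded_bilinear.has_vector_derivative[OF bounded_bilinear_quad_op pt pt]
    note dQQ = bounded_bilinear.has_vector_derivative[OF bounded_bilinear_blinfun_compose dQ dQ]
    have "(P has_vector_derivative
        0 - 2 *\<^sub>R (box_op ?z ?z' + box_op ?z' ?z) +
        ((quad_op ?z ?z o\<^sub>L (quad_op ?z ?z' + quad_op ?z' ?z)) + ((quad_op ?z ?z' + quad_op ?z' ?z) o\<^sub>L quad_op ?z ?z)))
        (at t within {0..b})"
      unfolding P_def[abs_def]
      by (intro has_vector_derivative_add has_vector_derivative_diff has_vector_derivative_const
          bounded_linear.has_vector_derivative[OF bounded_linear_scaleR_right] dT dQQ)
    also have "0 - 2 *\<^sub>R (box_op ?z ?z' + box_op ?z' ?z) +
        ((quad_op ?z ?z o\<^sub>L (quad_op ?z ?z' + quad_op ?z' ?z)) + ((quad_op ?z ?z' + quad_op ?z' ?z) o\<^sub>L quad_op ?z ?z))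
        = (M t o\<^sub>L P t) + (P t o\<^sub>L N t)"
    proof (rule blinfun_eqI)
      fix w
      have "bergman ?z (- 2 *\<^sub>R T (a t) ?z w) = bergman ?z (- (2 *\<^sub>R T (a t) ?z w))"
        by simp
      then show "(0 - 2 *\<^sub>R (box_op ?z ?z' + box_op ?z' ?z) +
        ((quad_op ?z ?z o\<^sub>L (quad_op ?z ?z' + quad_op ?z' ?z)) + ((quad_op ?z ?z' + quad_op ?z' ?z) o\<^sub>L quad_op ?z ?z))) w
        = ((M t o\<^sub>L P t) + (P t o\<^sub>L N t)) w"
        using bergman_derivative_identity[of "a t" ?z w]
        by (simp add: blinfun.bilinear_simps P M_def N_def quad_def add_mid algebra_simps)
    qed
    finally show ?thesis .
  qed
  have "bounded_inverse_on UNIV (P b) (c * exp (4 * K * b))"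
    by (rule bounded_inverse_propagates[OF der MN(1) MN(2) K b c]) (use start in \<open>auto simp: P\<close>)
  then show thesis using c by (intro that[of "c * exp (4 * K * b)"]) (auto simp: P)
qed

text \<open>
The field \<open>a - {y,a,y}\<close> at \<open>y = s z\<close> takes the prescribed value \<open>z\<close> for
\<open>a = \<Sum>k. s^(2k) odd_power z k\<close>: since \<open>{z, odd_power z k, z} = odd_power z (k + 1)\<close>, subtracting
\<open>{y,a,y}\<close> removes all terms but the first.
\<close>

lemma radial_field:
  assumes z: "norm z < 1"
  obtains A where "0 \<le> A" "\<And>s. s \<in> {0..1} \<Longrightarrow> \<exists>a. norm a \<le> A \<and> a - T (s *\<^sub>R z) a (s *\<^sub>R z) = z"
proof -
  define A where "A = (\<Sum>k. norm z * ((norm z)\<^sup>2) ^ k)"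
  have q: "norm ((norm z)\<^sup>2) < 1" using z by (simp add: abs_square_less_1)
  have sA: "summable (\<lambda>k. norm z * ((norm z)\<^sup>2) ^ k)"
    by (intro summable_mult summable_geometric q)
  have pwb: "norm (odd_power z k) \<le> norm z * ((norm z)\<^sup>2) ^ k" for k
    using norm_odd_power[of z k] by (simp add: power_mult)
  have "\<exists>a. norm a \<le> A \<and> a - T (s *\<^sub>R z) a (s *\<^sub>R z) = z" if s: "s \<in> {0..1}" for s :: real
  proof (intro exI conjI)
    define f where "f k = (s ^ (2 * k)) *\<^sub>R odd_power z k" for k
    have fb: "norm (f k) \<le> norm z * ((norm z)\<^sup>2) ^ k" for k
    proof -
      have "norm (f k) = s ^ (2 * k) * norm (odd_power z k)" using s by (simp add: f_def)
      also have "\<dots> \<le> 1 * norm (odd_power z k)"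
        using s by (intro mult_right_mono power_le_one) auto
      finally show ?thesis using pwb[of k] by simp
    qed
    have sf: "summable f" by (rule summable_comparison_test'[OF sA fb])
    show "norm (suminf f) \<le> A"
      unfolding A_def by (rule norm_suminf_le[OF fb sA])
    have "T (s *\<^sub>R z) (suminf f) (s *\<^sub>R z) = (\<Sum>k. T (s *\<^sub>R z) (f k) (s *\<^sub>R z))"
      by (rule bounded_linear.suminf[OF T_bounded_linear(2) sf])
    also have "(\<lambda>k. T (s *\<^sub>R z) (f k) (s *\<^sub>R z)) = (\<lambda>k. f (Suc k))"
    proof
      fix k
      have "T (s *\<^sub>R z) (f k) (s *\<^sub>R z) = (s * s * s ^ (2 * k)) *\<^sub>R quad z (odd_power z k)"
        by (simp add: f_def T_scaleR quad_def mult_ac)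
      also have "s * s * s ^ (2 * k) = s ^ (2 * Suc k)" by simp
      finally show "T (s *\<^sub>R z) (f k) (s *\<^sub>R z) = f (Suc k)" by (simp only: f_def quad_odd_power)
    qed
    finally have e: "T (s *\<^sub>R z) (suminf f) (s *\<^sub>R z) = (\<Sum>k. f (Suc k))" .
    have f0: "f 0 = z" by (simp add: f_def)
    show "suminf f - T (s *\<^sub>R z) (suminf f) (s *\<^sub>R z) = z"
      using suminf_split_head[OF sf] unfolding e f0 by simp
  qed
  moreover have "0 \<le> A" unfolding A_def by (intro suminf_nonneg sA) auto
  ultimately show thesis using that by blast
qed

text \<open>
The radial segment is an integral curve of time-dependent fields by \<open>radial_field\<close>, and the
Bergman operator at \<open>0\<close> is the identity.
\<close>

lemma bergman_invertible_in_ball: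
  assumes z: "norm z < 1"
  obtains c where "0 < c" "bounded_inverse_on UNIV (bergman z) c"
proof -
  obtain A where A: "\<And>s. s \<in> {0..1} \<Longrightarrow> \<exists>a. norm a \<le> A \<and> a - T (s *\<^sub>R z) a (s *\<^sub>R z) = z"
    using radial_field[OF z] by metis
  then obtain a where a: "\<And>s. s \<in> {0..1} \<Longrightarrow> norm (a s) \<le> A"
    "\<And>s. s \<in> {0..1} \<Longrightarrow> a s - T (s *\<^sub>R z) (a s) (s *\<^sub>R z) = z" by metis
  have "bergman 0 w = w" for w by (simp add: bergman_def quad_def)
  then have s: "bounded_inverse_on UNIV (bergman (0 *\<^sub>R z)) 1"
    by (simp add: bounded_inverse_on_def surj_def)
  obtain c' where "0 < c'" "bounded_inverse_on UNIV (bergman (1 *\<^sub>R z)) c'"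
  proof (rule bergman_invertible_along_path[of 1 "\<lambda>s. s *\<^sub>R z" a A 1 1])
    fix t :: real assume t: "t \<in> {0..1}"
    have "((\<lambda>s. s *\<^sub>R z) has_vector_derivative z) (at t within {0..1})"
      by (auto intro!: derivative_eq_intros)
    then show "((\<lambda>s. s *\<^sub>R z) has_vector_derivative a t - T (t *\<^sub>R z) (a t) (t *\<^sub>R z)) (at t within {0..1})"
      using a(2)[OF t] by simp
    show "norm (a t) \<le> A" using a(1)[OF t] .
    show "norm (t *\<^sub>R z) \<le> 1" using t z mult_mono[of t 1 "norm z" 1] by simp
  qed (use s in auto)
  then show thesis using that by simp
qed

text \<open>
A field line that leaves the ball meets the unit sphere, where its Bergman operator would have to be
invertible by propagation and cannot be by \<open>bergman_not_bounded_below\<close>.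
\<close>

lemma field_line_stays_in_ball:
  assumes p: "\<And>t. t \<in> {0..1} \<Longrightarrow>
      (p has_vector_derivative (a - T (p t) a (p t))) (at t within {0..1})"
    and start: "norm (p 0) < 1"
  shows "norm (p 1) < 1"
proof (rule ccontr)
  assume "\<not> norm (p 1) < 1"
  have cont: "continuous_on {0..1} p"
    by (rule continuous_on_vector_derivative[OF p])
  then have "\<exists>x\<ge>0. x \<le> 1 \<and> norm (p x) = 1"
    using start \<open>\<not> norm (p 1) < 1\<close> by (intro IVT' continuous_on_norm) auto
  then obtain b where b: "0 \<le> b" "b \<le> 1" "norm (p b) = 1" by blast
  have "compact (p ` {0..1})" using cont by (intro compact_continuous_image) auto
  then obtain R where R: "\<And>t. t \<in> {0..1} \<Longrightarrow> norm (p t) \<le> R"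
    using compact_imp_bounded bounded_iff by (metis image_eqI)
  obtain c where c: "0 < c" "bounded_inverse_on UNIV (bergman (p 0)) c"
    using bergman_invertible_in_ball[OF start] .
  have sub: "{0..b} \<subseteq> {0..1}" using b by auto
  obtain c' where "0 < c'" "bounded_inverse_on UNIV (bergman (p b)) c'"
    using bergman_invertible_along_path[of b p "\<lambda>_. a" "norm a" R c] c b R sub
      has_vector_derivative_within_subset[OF p sub] by (metis order_refl subset_iff)
  then have "\<forall>x. norm x \<le> c' * norm (x - 2 *\<^sub>R T (p b) (p b) x + quad (p b) (quad (p b) x))"
    by (simp add: bounded_inverse_on_def bergman_def)
  then show False using bergman_not_bounded_below[OF b(3)] by blast
qed

end

section \<open>Local flows of quadratic vector fields\<close>

lemma square_minus_triangle_sum: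
  fixes f :: "nat \<Rightarrow> nat \<Rightarrow> 'd::ab_group_add"
  shows "(\<Sum>i<n. \<Sum>j<n. f i j) - (\<Sum>k<n. \<Sum>i\<le>k. f i (k - i))
    = (\<Sum>(i,j)\<in>{..<n} \<times> {..<n} - {(i, j). i + j < n}. f i j)"
proof -
  have "{(i, j). i + j < n} \<subseteq> {..<n} \<times> {..<n}" by auto
  from sum_diff[OF _ this, of "\<lambda>(i,j). f i j"] sum.triangle_reindex[of f n]
  show ?thesis by (simp add: sum.cartesian_product)
qed

text \<open>
The difference between the product of partial sums and the partial sum of the Cauchy product runs
over the index pairs of a square minus a triangle, and is dominated by the corresponding difference
for the real series of norms.
\<close>

lemma Cauchy_product_bilinear_sums:
  fixes x :: "nat \<Rightarrow> 'a::banach" and y :: "nat \<Rightarrow> 'b::banach" and pr :: "'a \<Rightarrow> 'b \<Rightarrow> 'c::real_normed_vector"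
  assumes pr: "bounded_bilinear pr"
    and x: "summable (\<lambda>n. norm (x n))" and y: "summable (\<lambda>n. norm (y n))"
  shows "(\<lambda>n. \<Sum>i\<le>n. pr (x i) (y (n - i))) sums pr (suminf x) (suminf y)"
proof -
  interpret bounded_bilinear pr by fact
  obtain K where K: "0 \<le> K" "\<And>a b. norm (pr a b) \<le> norm a * norm b * K"
    using nonneg_bounded by blast
  define Sq Tr where "Sq n = {..<n} \<times> {..<n}" and "Tr n = {(i, j). i + j < n}" for n :: nat
  let ?R = "\<lambda>n. (\<Sum>i<n. \<Sum>j<n. norm (x i) * norm (y j)) - (\<Sum>k<n. \<Sum>i\<le>k. norm (x i) * norm (y (k - i)))"
  have "?R \<longlonglongrightarrow> (\<Sum>n. norm (x n)) * (\<Sum>n. norm (y n)) - (\<Sum>n. norm (x n)) * (\<Sum>n. norm (y n))"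
    using Cauchy_product_sums[of "\<lambda>n. norm (x n)" "\<lambda>n. norm (y n)"] x y
    unfolding sum_product[symmetric] sums_def
    by (intro tendsto_diff tendsto_mult summable_LIMSEQ) auto
  then have R0: "(\<lambda>n. K * ?R n) \<longlonglongrightarrow> 0"
    using tendsto_mult_right_zero by fastforce
  have eq: "pr (\<Sum>i<n. x i) (\<Sum>j<n. y j) = (\<Sum>i<n. \<Sum>j<n. pr (x i) (y j))" for n
    by (simp add: sum_left sum_right) (rule sum.swap)
  have "(\<lambda>n. pr (\<Sum>i<n. x i) (\<Sum>j<n. y j) - (\<Sum>k<n. \<Sum>i\<le>k. pr (x i) (y (k - i)))) \<longlonglongrightarrow> 0"
  proof (rule Lim_null_comparison[OF always_eventually R0], rule allI)
    fix n
    have "norm (\<Sum>(i,j)\<in>Sq n - Tr n. pr (x i) (y j)) \<le> (\<Sum>(i,j)\<in>Sq n - Tr n. K * (norm (x i) * norm (y j)))"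
      by (rule sum_norm_le) (use K in \<open>auto simp: mult_ac\<close>)
    also have "\<dots> = K * (\<Sum>(i,j)\<in>Sq n - Tr n. norm (x i) * norm (y j))"
      by (simp add: sum_distrib_left case_prod_unfold)
    finally show "norm (pr (\<Sum>i<n. x i) (\<Sum>j<n. y j) - (\<Sum>k<n. \<Sum>i\<le>k. pr (x i) (y (k - i)))) \<le> K * ?R n"
      using square_minus_triangle_sum[of "\<lambda>i j. pr (x i) (y j)" n]
        square_minus_triangle_sum[of "\<lambda>i j. norm (x i) * norm (y j)" n]
      unfolding eq Sq_def Tr_def by simp
  qed
  moreover have "(\<lambda>n. pr (\<Sum>i<n. x i) (\<Sum>j<n. y j)) \<longlonglongrightarrow> pr (suminf x) (suminf y)"
    by (rule tendsto[OF summable_LIMSEQ[OF summable_norm_cancel[OF x]]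
          summable_LIMSEQ[OF summable_norm_cancel[OF y]]])
  ultimately have "(\<lambda>n. pr (\<Sum>i<n. x i) (\<Sum>j<n. y j)
      - (pr (\<Sum>i<n. x i) (\<Sum>j<n. y j) - (\<Sum>k<n. \<Sum>i\<le>k. pr (x i) (y (k - i)))))
      \<longlonglongrightarrow> pr (suminf x) (suminf y) - 0"
    by (intro tendsto_diff)
  then show ?thesis by (simp add: sums_def)
qed

lemma suminf_geometric_shift_le:
  fixes f :: "nat \<Rightarrow> 'a::banach"
  assumes "\<And>n. norm (f n) \<le> c * q ^ n" "0 \<le> q" "q \<le> 1/2"
  shows "summable (\<lambda>n. norm (f n))" "norm (suminf f) \<le> 2 * c"
proof -
  have s: "summable (\<lambda>n. c * q ^ n)" using assms by (intro summable_mult summable_geometric) auto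
  show "summable (\<lambda>n. norm (f n))"
    by (rule summable_comparison_test'[OF s, of 0]) (use assms in auto)
  have c: "0 \<le> c" using assms(1)[of 0] order_trans[OF norm_ge_zero] by fastforce
  have "norm (suminf f) \<le> (\<Sum>n. c * q ^ n)" by (rule norm_suminf_le[OF assms(1) s])
  also have "\<dots> = c * (1 / (1 - q))"
    using assms by (subst suminf_mult) (auto simp: suminf_geometric)
  also have "\<dots> \<le> c * 2"
    using assms c by (intro mult_left_mono) (auto simp: field_simps)
  finally show "norm (suminf f) \<le> 2 * c" by simp
qed

context jb_star_triple
begin

text \<open>
Taylor coefficients in time of the solution of \<open>z' = a - {z,a,z}\<close> with initial value \<open>z\<close>,
obtained by comparing coefficients.  Each is a polynomial in the initial value, which is why the
flow depends holomorphically on it.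
\<close>

fun flow_coeff :: "'a \<Rightarrow> 'a \<Rightarrow> nat \<Rightarrow> 'a" where
  "flow_coeff a z 0 = z"
| "flow_coeff a z (Suc n) = (1 / real (Suc n)) *\<^sub>R
     ((if n = 0 then a else 0) - (\<Sum>i\<le>n. T (flow_coeff a z i) a (flow_coeff a z (n - i))))"

declare flow_coeff.simps(2) [simp del]

lemma norm_flow_coeff:
  assumes z: "norm z \<le> 2"
  shows "norm (flow_coeff a z n) \<le> 2 * (16 * norm a) ^ n"
proof (induction n rule: less_induct)
  case (less m)
  show ?case
  proof (cases m)
    case 0
    then show ?thesis using z by simp
  next
    case (Suc n)
    define \<kappa> where "\<kappa> = 16 * norm a"
    have "norm (\<Sum>i\<le>n. T (flow_coeff a z i) a (flow_coeff a z (n - i))) \<le> (\<Sum>i\<le>n. \<kappa> ^ Suc n)"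
    proof (rule sum_norm_le)
      fix i assume i: "i \<in> {..n}"
      have "norm (T (flow_coeff a z i) a (flow_coeff a z (n - i))) \<le> 4 * norm (flow_coeff a z i) * norm a * norm (flow_coeff a z (n - i))"
        by (rule T_bound)
      also have "\<dots> \<le> 4 * (2 * \<kappa> ^ i) * norm a * (2 * \<kappa> ^ (n - i))"
        using less[of i] less[of "n - i"] i Suc unfolding \<kappa>_def
        by (intro mult_mono) auto
      also have "\<dots> = \<kappa> * (\<kappa> ^ i * \<kappa> ^ (n - i))" by (simp add: \<kappa>_def)
      also have "\<dots> = \<kappa> ^ Suc n" using i by (simp flip: power_add)
      finally show "norm (T (flow_coeff a z i) a (flow_coeff a z (n - i))) \<le> \<kappa> ^ Suc n" .
    qed
    then have S: "norm (\<Sum>i\<le>n. T (flow_coeff a z i) a (flow_coeff a z (n - i))) \<le> real (Suc n) * \<kappa> ^ Suc n" by simp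
    have a: "norm (if n = 0 then a else 0) \<le> real (Suc n) * \<kappa> ^ Suc n"
      by (cases n) (auto simp: \<kappa>_def)
    have "norm (flow_coeff a z m) = 1 / real (Suc n) * norm ((if n = 0 then a else 0) - (\<Sum>i\<le>n. T (flow_coeff a z i) a (flow_coeff a z (n - i))))"
      by (simp add: Suc flow_coeff.simps(2) del: of_nat_Suc)
    also have "\<dots> \<le> 1 / real (Suc n) * (real (Suc n) * \<kappa> ^ Suc n + real (Suc n) * \<kappa> ^ Suc n)"
      by (intro mult_left_mono order_trans[OF norm_triangle_ineq4 add_mono] a S) auto
    also have "\<dots> = 2 * \<kappa> ^ Suc n" by (simp del: of_nat_Suc power_Suc)
    finally show ?thesis by (simp add: \<kappa>_def Suc)
  qed
qed

text \<open>
The constants \<open>22\<close> and \<open>64\<close> are chosen so that the induction closes: the product rule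
produces three terms whose contributions \<open>11/4\<close>, \<open>16\<close> and \<open>11/4\<close> add up to \<open>21.5\<close>.
\<close>

lemma norm_flow_coeff_diff:
  assumes z: "norm z \<le> 2" and a: "norm a \<le> \<epsilon>" and b: "norm b \<le> \<epsilon>"
  shows "norm (flow_coeff a z (Suc n) - flow_coeff b z (Suc n)) \<le> 22 * norm (a - b) * (64 * \<epsilon>) ^ n"
proof (induction n rule: less_induct)
  case (less n)
  define \<kappa> where "\<kappa> = 64 * \<epsilon>"
  define d where "d = norm (a - b)"
  have \<epsilon>: "0 \<le> \<epsilon>" using a order_trans[OF norm_ge_zero] by blast
  have \<kappa>: "0 \<le> \<kappa>" using \<epsilon> by (simp add: \<kappa>_def)
  have d: "0 \<le> d" by (simp add: d_def)
  have c: "norm (flow_coeff a z i) \<le> 2 * \<kappa> ^ i" "norm (flow_coeff b z i) \<le> 2 * \<kappa> ^ i" for i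
  proof -
    have "(16 * norm x) ^ i \<le> \<kappa> ^ i" if "norm x \<le> \<epsilon>" for x :: 'a
      using that \<epsilon> by (intro power_mono) (auto simp: \<kappa>_def)
    from this[OF a] this[OF b] show "norm (flow_coeff a z i) \<le> 2 * \<kappa> ^ i" "norm (flow_coeff b z i) \<le> 2 * \<kappa> ^ i"
      using norm_flow_coeff[OF z, of a i] norm_flow_coeff[OF z, of b i] by auto
  qed
  have D: "\<epsilon> * norm (flow_coeff a z i - flow_coeff b z i) \<le> 11/32 * d * \<kappa> ^ i" if "i \<le> n" for i
  proof (cases i)
    case 0
    then show ?thesis using d by simp
  next
    case (Suc j)
    have "\<epsilon> * norm (flow_coeff a z i - flow_coeff b z i) \<le> \<epsilon> * (22 * d * \<kappa> ^ j)"
      using less[of j] that Suc \<epsilon> by (intro mult_left_mono) (auto simp: d_def \<kappa>_def)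
    also have "\<dots> = 11/32 * d * \<kappa> ^ i" by (simp add: Suc \<kappa>_def)
    finally show ?thesis .
  qed
  have S: "norm (\<Sum>i\<le>n. T (flow_coeff a z i) a (flow_coeff a z (n - i)) - T (flow_coeff b z i) b (flow_coeff b z (n - i)))
      \<le> (\<Sum>i\<le>n. (if n = 0 then 16 else 21.5) * d * \<kappa> ^ n)"
  proof (rule sum_norm_le)
    fix i assume i: "i \<in> {..n}"
    let ?j = "n - i"
    let ?x = "flow_coeff a z i" and ?x' = "flow_coeff b z i" and ?y = "flow_coeff a z ?j" and ?y' = "flow_coeff b z ?j"
    have odd_power: "\<kappa> ^ i * \<kappa> ^ ?j = \<kappa> ^ n" using i by (simp flip: power_add)
    have eq: "T ?x a ?y - T ?x' b ?y' = T (?x - ?x') a ?y + T ?x' (a - b) ?y + T ?x' b (?y - ?y')"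
      by (simp add: T_diff)
    have n3: "norm (T ?x a ?y - T ?x' b ?y')
        \<le> norm (T (?x - ?x') a ?y) + norm (T ?x' (a - b) ?y) + norm (T ?x' b (?y - ?y'))"
      unfolding eq by (rule order_trans[OF norm_triangle_ineq add_right_mono[OF norm_triangle_ineq]])
    have t2: "norm (T ?x' (a - b) ?y) \<le> 16 * d * \<kappa> ^ n"
    proof -
      have "norm (T ?x' (a - b) ?y) \<le> 4 * norm ?x' * d * norm ?y" unfolding d_def by (rule T_bound)
      also have "\<dots> \<le> 4 * (2 * \<kappa> ^ i) * d * (2 * \<kappa> ^ ?j)" using d \<kappa> c by (intro mult_mono) auto
      also have "\<dots> = 16 * d * (\<kappa> ^ i * \<kappa> ^ ?j)" by simp
      finally show ?thesis by (simp only: odd_power)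
    qed
    have t1: "norm (T (?x - ?x') a ?y) \<le> 2.75 * d * \<kappa> ^ n"
    proof -
      have "norm (T (?x - ?x') a ?y) \<le> 4 * norm (?x - ?x') * norm a * norm ?y" by (rule T_bound)
      also have "\<dots> \<le> 4 * norm (?x - ?x') * \<epsilon> * (2 * \<kappa> ^ ?j)" using \<epsilon> a c by (intro mult_mono) auto
      also have "\<dots> = 8 * (\<epsilon> * norm (?x - ?x')) * \<kappa> ^ ?j" by simp
      also have "\<dots> \<le> 8 * (11/32 * d * \<kappa> ^ i) * \<kappa> ^ ?j"
        using D[of i] i \<kappa> by (intro mult_right_mono mult_left_mono) auto
      also have "\<dots> = 2.75 * d * (\<kappa> ^ i * \<kappa> ^ ?j)" by simp
      finally show ?thesis by (simp only: odd_power)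
    qed
    have t3: "norm (T ?x' b (?y - ?y')) \<le> 2.75 * d * \<kappa> ^ n"
    proof -
      have "norm (T ?x' b (?y - ?y')) \<le> 4 * norm ?x' * norm b * norm (?y - ?y')" by (rule T_bound)
      also have "\<dots> \<le> 4 * (2 * \<kappa> ^ i) * \<epsilon> * norm (?y - ?y')" using \<epsilon> \<kappa> b c by (intro mult_mono) auto
      also have "\<dots> = 8 * \<kappa> ^ i * (\<epsilon> * norm (?y - ?y'))" by simp
      also have "\<dots> \<le> 8 * \<kappa> ^ i * (11/32 * d * \<kappa> ^ ?j)"
        using D[of ?j] \<kappa> by (intro mult_left_mono) auto
      also have "\<dots> = 2.75 * d * (\<kappa> ^ i * \<kappa> ^ ?j)" by simp
      finally show ?thesis by (simp only: odd_power)
    qed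
    show "norm (T ?x a ?y - T ?x' b ?y') \<le> (if n = 0 then 16 else 21.5) * d * \<kappa> ^ n"
    proof (cases "n = 0")
      case True
      then show ?thesis using n3 t2 i by simp
    next
      case False
      then show ?thesis using n3 t1 t2 t3 by simp
    qed
  qed
  have S': "norm (\<Sum>i\<le>n. T (flow_coeff a z i) a (flow_coeff a z (n - i)) - T (flow_coeff b z i) b (flow_coeff b z (n - i)))
      \<le> real (Suc n) * ((if n = 0 then 16 else 21.5) * d * \<kappa> ^ n)"
    using S by (simp del: of_nat_Suc)
  have A: "norm ((if n = 0 then a else 0) - (if n = 0 then b else 0)) \<le> (if n = 0 then d else 0)"
    by (simp add: d_def)
  have "flow_coeff a z (Suc n) - flow_coeff b z (Suc n) = (1 / real (Suc n)) *\<^sub>R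
     (((if n = 0 then a else 0) - (if n = 0 then b else 0))
      - (\<Sum>i\<le>n. T (flow_coeff a z i) a (flow_coeff a z (n - i)) - T (flow_coeff b z i) b (flow_coeff b z (n - i))))"
    unfolding flow_coeff.simps(2) sum_subtractf by (simp only: scaleR_diff_right[symmetric]) simp
  then have "norm (flow_coeff a z (Suc n) - flow_coeff b z (Suc n)) \<le> 1 / real (Suc n) *
     ((if n = 0 then d else 0) + real (Suc n) * ((if n = 0 then 16 else 21.5) * d * \<kappa> ^ n))"
    using order_trans[OF norm_triangle_ineq4 add_mono[OF A S']]
    by (simp only: norm_scaleR abs_divide abs_one abs_of_nat) (intro mult_left_mono, auto)
  also have "\<dots> \<le> 22 * d * \<kappa> ^ n"
  proof (cases "n = 0")
    case False
    have "1 / real (Suc n) * (0 + real (Suc n) * (21.5 * d * \<kappa> ^ n)) = 21.5 * (d * \<kappa> ^ n)"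
      by (simp del: of_nat_Suc)
    moreover have "0 \<le> d * \<kappa> ^ n" using d \<kappa> by simp
    ultimately show ?thesis using False by simp
  qed (use d in simp)
  finally show ?case by (simp add: d_def \<kappa>_def)
qed

text \<open>
The derivative of \<open>flow_coeff a z n\<close> with respect to \<open>z\<close> in the direction \<open>h\<close>.
\<close>

fun flow_coeff_deriv :: "'a \<Rightarrow> 'a \<Rightarrow> 'a \<Rightarrow> nat \<Rightarrow> 'a" where
  "flow_coeff_deriv a z h 0 = h"
| "flow_coeff_deriv a z h (Suc n) = - ((1 / real (Suc n)) *\<^sub>R
     (\<Sum>i\<le>n. T (flow_coeff a z i) a (flow_coeff_deriv a z h (n - i)) + T (flow_coeff_deriv a z h i) a (flow_coeff a z (n - i))))"

declare flow_coeff_deriv.simps(2) [simp del]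

lemma bounded_bilinear_T: "bounded_bilinear (\<lambda>x y. T x a y)"
proof
  show "\<exists>K. \<forall>x y. norm (T x a y) \<le> norm x * norm y * K"
    using T_bound[of _ a] by (intro exI[of _ "4 * norm a"]) (simp add: mult_ac)
qed (simp_all add: T_add_left T_add_right T_scaleR)

lemma flow_coeff_has_derivative: "((\<lambda>z. flow_coeff a z n) has_derivative (\<lambda>h. flow_coeff_deriv a z h n)) (at z)"
proof (induction n rule: less_induct)
  case (less m)
  show ?case
  proof (cases m)
    case (Suc n)
    have "((\<lambda>z. (1 / real (Suc n)) *\<^sub>R ((if n = 0 then a else 0) - (\<Sum>i\<le>n. T (flow_coeff a z i) a (flow_coeff a z (n - i)))))
      has_derivative (\<lambda>h. (1 / real (Suc n)) *\<^sub>R (0 - (\<Sum>i\<le>n. T (flow_coeff a z i) a (flow_coeff_deriv a z h (n - i)) + T (flow_coeff_deriv a z h i) a (flow_coeff a z (n - i)))))) (at z)"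
      using Suc
      by (intro has_derivative_scaleR_right has_derivative_diff has_derivative_const has_derivative_sum
          bounded_bilinear.FDERIV[OF bounded_bilinear_T] less) auto
    then show ?thesis unfolding Suc flow_coeff.simps(2) flow_coeff_deriv.simps(2) by simp
  qed simp
qed

lemma flow_coeff_deriv_clinear: "clinear (\<lambda>h. flow_coeff_deriv a z h n)"
proof (induction n rule: less_induct)
  case (less m)
  show ?case
  proof (cases m)
    case (Suc n)
    have IH: "flow_coeff_deriv a z (x + y) i = flow_coeff_deriv a z x i + flow_coeff_deriv a z y i" "flow_coeff_deriv a z (c *\<^sub>C x) i = c *\<^sub>C flow_coeff_deriv a z x i"
      if "i \<le> n" for i x y c
      using less[of i] that Suc by (auto simp: clinear_def)
    have sc: "c *\<^sub>C (\<Sum>i\<in>I. f i) = (\<Sum>i\<in>I. c *\<^sub>C f i)" for c I and f :: "nat \<Rightarrow> 'a"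
      using linear_sum[OF bounded_linear.linear[OF bounded_linear_scaleC_right]] .
    define S where "S h = (\<Sum>i\<le>n. T (flow_coeff a z i) a (flow_coeff_deriv a z h (n - i)) + T (flow_coeff_deriv a z h i) a (flow_coeff a z (n - i)))" for h
    have flow_coeff_deriv: "flow_coeff_deriv a z h m = - ((1 / real (Suc n)) *\<^sub>R S h)" for h
      unfolding Suc flow_coeff_deriv.simps(2) S_def ..
    have "S (x + y) = S x + S y" for x y
      unfolding S_def sum.distrib[symmetric]
      by (rule sum.cong) (auto simp: IH T_add_left T_add_right)
    moreover have "S (c *\<^sub>C x) = c *\<^sub>C S x" for x c
      unfolding S_def sc
      by (rule sum.cong) (auto simp: IH T_scaleC_left T_scaleC_right scaleC_add_right)
    ultimately show ?thesis
      unfolding clinear_def flow_coeff_deriv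
      by (simp add: scaleR_right_distrib scaleC_minus_right scaleC_scaleR)
  qed (simp add: clinear_def)
qed

lemma norm_flow_coeff_deriv:
  assumes z: "norm z \<le> 2"
  shows "norm (flow_coeff_deriv a z h n) \<le> norm h * (16 * norm a) ^ n"
proof (induction n rule: less_induct)
  case (less m)
  show ?case
  proof (cases m)
    case (Suc n)
    define \<kappa> where "\<kappa> = 16 * norm a"
    have "norm (\<Sum>i\<le>n. T (flow_coeff a z i) a (flow_coeff_deriv a z h (n - i)) + T (flow_coeff_deriv a z h i) a (flow_coeff a z (n - i)))
        \<le> (\<Sum>i\<le>n. norm h * \<kappa> ^ Suc n)"
    proof (rule sum_norm_le)
      fix i assume i: "i \<in> {..n}"
      have odd_power: "\<kappa> ^ i * \<kappa> ^ (n - i) = \<kappa> ^ n" using i by (simp flip: power_add)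
      have "norm (T (flow_coeff a z i) a (flow_coeff_deriv a z h (n - i))) \<le> 4 * norm (flow_coeff a z i) * norm a * norm (flow_coeff_deriv a z h (n - i))"
        by (rule T_bound)
      also have "\<dots> \<le> 4 * (2 * \<kappa> ^ i) * norm a * (norm h * \<kappa> ^ (n - i))"
        using norm_flow_coeff[OF z, of a i] less[of "n - i"] i Suc unfolding \<kappa>_def
        by (intro mult_mono) auto
      also have "\<dots> = (8 * norm a * norm h) * (\<kappa> ^ i * \<kappa> ^ (n - i))" by simp
      finally have 1: "norm (T (flow_coeff a z i) a (flow_coeff_deriv a z h (n - i))) \<le> (8 * norm a * norm h) * \<kappa> ^ n"
        unfolding odd_power .
      have "norm (T (flow_coeff_deriv a z h i) a (flow_coeff a z (n - i))) \<le> 4 * norm (flow_coeff_deriv a z h i) * norm a * norm (flow_coeff a z (n - i))"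
        by (rule T_bound)
      also have "\<dots> \<le> 4 * (norm h * \<kappa> ^ i) * norm a * (2 * \<kappa> ^ (n - i))"
        using norm_flow_coeff[OF z, of a "n - i"] less[of i] i Suc unfolding \<kappa>_def
        by (intro mult_mono) auto
      also have "\<dots> = (8 * norm a * norm h) * (\<kappa> ^ i * \<kappa> ^ (n - i))" by simp
      finally have 2: "norm (T (flow_coeff_deriv a z h i) a (flow_coeff a z (n - i))) \<le> (8 * norm a * norm h) * \<kappa> ^ n"
        unfolding odd_power .
      have e: "(8 * norm a * norm h) * \<kappa> ^ n + (8 * norm a * norm h) * \<kappa> ^ n = norm h * \<kappa> ^ Suc n"
        by (simp add: \<kappa>_def)
      show "norm (T (flow_coeff a z i) a (flow_coeff_deriv a z h (n - i)) + T (flow_coeff_deriv a z h i) a (flow_coeff a z (n - i))) \<le> norm h * \<kappa> ^ Suc n"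
        using norm_triangle_mono[OF 1 2] unfolding e .
    qed
    then have S: "norm (\<Sum>i\<le>n. T (flow_coeff a z i) a (flow_coeff_deriv a z h (n - i)) + T (flow_coeff_deriv a z h i) a (flow_coeff a z (n - i)))
        \<le> real (Suc n) * (norm h * \<kappa> ^ Suc n)" by simp
    have "norm (flow_coeff_deriv a z h m) = 1 / real (Suc n) * norm (\<Sum>i\<le>n. T (flow_coeff a z i) a (flow_coeff_deriv a z h (n - i)) + T (flow_coeff_deriv a z h i) a (flow_coeff a z (n - i)))"
      by (simp add: Suc flow_coeff_deriv.simps(2) del: of_nat_Suc)
    also have "\<dots> \<le> 1 / real (Suc n) * (real (Suc n) * (norm h * \<kappa> ^ Suc n))"
      by (intro mult_left_mono S) auto
    also have "\<dots> = norm h * \<kappa> ^ Suc n" by (simp del: of_nat_Suc power_Suc)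
    finally show ?thesis by (simp add: \<kappa>_def Suc)
  qed simp
qed

definition flow :: "'a \<Rightarrow> 'a \<Rightarrow> real \<Rightarrow> 'a" where
  "flow a z t = (\<Sum>n. t ^ n *\<^sub>R flow_coeff a z n)"

lemma flow_term_bound:
  assumes "norm a \<le> 1/64" "norm z \<le> 2" "\<bar>t\<bar> \<le> 2"
  shows "norm (t ^ n *\<^sub>R flow_coeff a z n) \<le> 2 * (1/2) ^ n"
proof -
  have "norm (t ^ n *\<^sub>R flow_coeff a z n) \<le> 2 ^ n * (2 * (1/4) ^ n)"
    unfolding norm_scaleR norm_power power_abs
  proof (intro mult_mono power_mono)
    have "(16 * norm a) ^ n \<le> (1/4) ^ n" using assms(1) by (intro power_mono) auto
    then show "norm (flow_coeff a z n) \<le> 2 * (1/4) ^ n" using norm_flow_coeff[OF assms(2), of a n] by simp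
  qed (use assms in auto)
  also have "\<dots> = 2 * (2 * (1/4)) ^ n" by (simp only: power_mult_distrib mult_ac)
  finally show ?thesis by simp
qed

lemma flow_summable:
  assumes "norm a \<le> 1/64" "norm z \<le> 2" "\<bar>t\<bar> \<le> 2"
  shows "summable (\<lambda>n. norm (t ^ n *\<^sub>R flow_coeff a z n))" "norm (flow a z t) \<le> 4"
  using suminf_geometric_shift_le[OF flow_term_bound[OF assms]] by (auto simp: flow_def)

lemma flow_0 [simp]: "flow a z 0 = z"
proof -
  have "(\<lambda>n. 0 ^ n *\<^sub>R flow_coeff a z n) = (\<lambda>n. if n = 0 then z else 0)" by auto
  then show ?thesis
    using sums_unique[OF sums_single[of 0 "\<lambda>_. z"]] unfolding flow_def by simp
qed

lemma flow_has_derivative: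
  assumes a: "norm a \<le> 1/64" and z: "norm z < 2"
  obtains D where "clinear D" "((\<lambda>z. flow a z 1) has_derivative D) (at z)"
proof -
  define g' where "g' x h = (\<Sum>n. flow_coeff_deriv a x h n)" for x h
  have bd: "norm (flow_coeff_deriv a x h n) \<le> norm h * (1/4) ^ n" if "norm x \<le> 2" for x h n
  proof -
    have "(16 * norm a) ^ n \<le> (1/4) ^ n" using a by (intro power_mono) auto
    then show ?thesis
      using norm_flow_coeff_deriv[OF that, of a h n] by (meson mult_left_mono norm_ge_zero order_trans)
  qed
  have sm: "summable (\<lambda>n. flow_coeff_deriv a x h n)" if "norm x \<le> 2" for x h
    by (rule summable_norm_cancel, rule suminf_geometric_shift_le(1)[OF bd[OF that]]) auto
  have "\<exists>g. \<forall>x\<in>ball 0 2. (\<lambda>n. flow_coeff a x n) sums g x \<and> (g has_derivative g' x) (at x within ball 0 2)"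
  proof (rule has_derivative_series)
    show "((\<lambda>z. flow_coeff a z n) has_derivative (\<lambda>h. flow_coeff_deriv a x h n)) (at x within ball 0 2)" for n x
      using flow_coeff_has_derivative by (rule has_derivative_at_withinI)
    have "(\<lambda>n. 2 * (1/4 :: real) ^ n) \<longlonglongrightarrow> 0"
      by (intro tendsto_mult_right_zero LIMSEQ_power_zero) auto
    then show "\<forall>\<^sub>F n in sequentially. \<forall>x\<in>ball 0 2. \<forall>h. norm (sum (\<lambda>i. flow_coeff_deriv a x h i) {..<n} - g' x h) \<le> e * norm h"
      if "e > 0" for e
    proof -
      have "\<forall>\<^sub>F n in sequentially. 2 * (1/4 :: real) ^ n < e"
        using order_tendstoD(2)[OF \<open>(\<lambda>n. 2 * (1/4 :: real) ^ n) \<longlonglongrightarrow> 0\<close> that] .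
      then show ?thesis
      proof eventually_elim
        case (elim n)
        show ?case
        proof (intro ballI allI)
          fix x h assume "x \<in> ball (0::'a) 2"
          then have x: "norm x \<le> 2" by simp
          have "sum (\<lambda>i. flow_coeff_deriv a x h i) {..<n} - g' x h = - (\<Sum>i. flow_coeff_deriv a x h (i + n))"
            using suminf_minus_initial_segment[OF sm[OF x, of h], of n] by (simp add: g'_def)
          moreover have "norm (\<Sum>i. flow_coeff_deriv a x h (i + n)) \<le> 2 * (norm h * (1/4) ^ n)"
          proof (rule suminf_geometric_shift_le(2)[of _ _ "1/4"])
            show "norm (flow_coeff_deriv a x h (i + n)) \<le> norm h * (1/4) ^ n * (1/4) ^ i" for i
              using bd[OF x, of h "i + n"] by (simp add: power_add mult_ac)
          qed auto
          ultimately have "norm (sum (\<lambda>i. flow_coeff_deriv a x h i) {..<n} - g' x h) \<le> (2 * (1/4) ^ n) * norm h"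
            by (simp add: mult_ac)
          also have "\<dots> \<le> e * norm h" using elim by (intro mult_right_mono) auto
          finally show "norm (sum (\<lambda>i. flow_coeff_deriv a x h i) {..<n} - g' x h) \<le> e * norm h" .
        qed
      qed
    qed
    show "(\<lambda>n. flow_coeff a 0 n) sums flow a 0 1"
      using summable_sums[OF summable_norm_cancel[OF flow_summable(1)[of a 0 1]]] a
      by (simp add: flow_def)
  qed auto
  then obtain g where g: "\<And>x. x \<in> ball 0 2 \<Longrightarrow> (\<lambda>n. flow_coeff a x n) sums g x"
    "\<And>x. x \<in> ball 0 2 \<Longrightarrow> (g has_derivative g' x) (at x within ball 0 2)" by blast
  have zb: "z \<in> ball 0 2" using z by simp
  have "(g has_derivative g' z) (at z)"
    using g(2)[OF zb] at_within_open[OF zb] by simp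
  then have "((\<lambda>z. flow a z 1) has_derivative g' z) (at z)"
    by (rule has_derivative_transform_within_open[OF _ open_ball zb])
       (use g(1) in \<open>auto simp: flow_def sums_iff\<close>)
  moreover have "clinear (g' z)"
    unfolding clinear_def
  proof (intro conjI allI)
    have c: "flow_coeff_deriv a z (x + y) n = flow_coeff_deriv a z x n + flow_coeff_deriv a z y n" "flow_coeff_deriv a z (k *\<^sub>C x) n = k *\<^sub>C flow_coeff_deriv a z x n" for x y k n
      using flow_coeff_deriv_clinear[of a z n] by (auto simp: clinear_def)
    show "g' z (x + y) = g' z x + g' z y" for x y
      unfolding g'_def c using sm[of z] z by (intro suminf_add[symmetric]) auto
    show "g' z (k *\<^sub>C x) = k *\<^sub>C g' z x" for k x
      unfolding g'_def c using sm[of z] z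
      by (intro bounded_linear.suminf[OF bounded_linear_scaleC_right, symmetric]) auto
  qed
  ultimately show thesis using that by blast
qed

text \<open>
Termwise differentiation; the quadratic term of the field is recovered as a Cauchy product.
\<close>

lemma flow_ode:
  assumes a: "norm a \<le> 1/64" and z: "norm z \<le> 2" and t: "\<bar>t\<bar> \<le> 1"
  shows "((\<lambda>t. flow a z t) has_vector_derivative (a - T (flow a z t) a (flow a z t))) (at t)"
proof -
  have e: "real (Suc n) *\<^sub>R (s ^ n *\<^sub>R flow_coeff a z (Suc n))
      = (if n = 0 then a else 0) - (\<Sum>i\<le>n. T (s ^ i *\<^sub>R flow_coeff a z i) a (s ^ (n - i) *\<^sub>R flow_coeff a z (n - i)))" for n s
  proof -
    have "real (Suc n) *\<^sub>R (s ^ n *\<^sub>R flow_coeff a z (Suc n))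
      = s ^ n *\<^sub>R ((if n = 0 then a else 0) - (\<Sum>i\<le>n. T (flow_coeff a z i) a (flow_coeff a z (n - i))))"
      unfolding flow_coeff.simps(2) by (simp del: of_nat_Suc)
    also have "\<dots> = (if n = 0 then a else 0) - (\<Sum>i\<le>n. s ^ n *\<^sub>R T (flow_coeff a z i) a (flow_coeff a z (n - i)))"
      by (simp add: scaleR_diff_right scaleR_sum_right)
    also have "(\<Sum>i\<le>n. s ^ n *\<^sub>R T (flow_coeff a z i) a (flow_coeff a z (n - i)))
        = (\<Sum>i\<le>n. T (s ^ i *\<^sub>R flow_coeff a z i) a (s ^ (n - i) *\<^sub>R flow_coeff a z (n - i)))"
      by (rule sum.cong) (auto simp: T_scaleR simp flip: power_add)
    finally show ?thesis .
  qed
  have sums_field: "(\<lambda>n. real (Suc n) *\<^sub>R (s ^ n *\<^sub>R flow_coeff a z (Suc n))) sums (a - T (flow a z s) a (flow a z s))"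
    if s: "\<bar>s\<bar> \<le> 2" for s
  proof -
    have "(\<lambda>n. if n = 0 then a else 0) sums a" using sums_single[of 0 "\<lambda>_. a"] by simp
    moreover have "(\<lambda>n. \<Sum>i\<le>n. T (s ^ i *\<^sub>R flow_coeff a z i) a (s ^ (n - i) *\<^sub>R flow_coeff a z (n - i)))
        sums T (flow a z s) a (flow a z s)"
      unfolding flow_def
      by (rule Cauchy_product_bilinear_sums[OF bounded_bilinear_T]) (use flow_summable(1)[OF a z s] in auto)
    ultimately show ?thesis unfolding e by (rule sums_diff)
  qed
  define f' where "f' n s h = (h * (real n * s ^ (n - 1))) *\<^sub>R flow_coeff a z n" for n s and h :: real
  have fsc: "f' (Suc n) s h = h *\<^sub>R (real (Suc n) *\<^sub>R (s ^ n *\<^sub>R flow_coeff a z (Suc n)))" for n s h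
    by (simp add: f'_def mult_ac del: of_nat_Suc)
  have fb: "norm (f' n s h) \<le> (6 * \<bar>h\<bar>) * (1/2) ^ n" if s: "\<bar>s\<bar> \<le> 3/2" for n s h
  proof -
    have n: "real n * (3/8) ^ n \<le> (1/2) ^ n * 3"
    proof (induction n)
      case (Suc n)
      have b: "(3/8 :: real) ^ n \<le> (1/2) ^ n * 1"
        using power_mono[of "3/8" "1/2::real" n] by simp
      have "real (Suc n) * (3/8) ^ Suc n = 3/8 * (real n * (3/8) ^ n) + 3/8 * (3/8) ^ n"
        by (simp add: algebra_simps)
      also have "\<dots> \<le> 3/8 * ((1/2) ^ n * 3) + 3/8 * ((1/2) ^ n * 1)"
        using Suc b by (intro add_mono mult_left_mono) auto
      also have "\<dots> = (1/2) ^ Suc n * 3" by simp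
      finally show ?case .
    qed simp
    have s1: "\<bar>s\<bar> ^ (n - 1) \<le> (3/2) ^ n"
    proof -
      have "\<bar>s\<bar> ^ (n - 1) \<le> (3/2) ^ (n - 1)" using s by (intro power_mono) auto
      also have "\<dots> \<le> (3/2 :: real) ^ n" by (intro power_increasing) auto
      finally show ?thesis .
    qed
    have c: "norm (flow_coeff a z n) \<le> 2 * (1/4) ^ n"
    proof -
      have "(16 * norm a) ^ n \<le> (1/4) ^ n" using a by (intro power_mono) auto
      then show ?thesis using norm_flow_coeff[OF z, of a n] by simp
    qed
    have "norm (f' n s h) = \<bar>h\<bar> * (real n * \<bar>s\<bar> ^ (n - 1)) * norm (flow_coeff a z n)"
      by (simp add: f'_def abs_mult power_abs)
    also have "\<dots> \<le> \<bar>h\<bar> * (real n * (3/2) ^ n) * (2 * (1/4) ^ n)"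
      using s1 c by (intro mult_mono) auto
    also have "\<dots> = (2 * \<bar>h\<bar>) * (real n * ((3/2) * (1/4)) ^ n)" by (simp only: power_mult_distrib mult_ac)
    also have "\<dots> = (2 * \<bar>h\<bar>) * (real n * (3/8) ^ n)" by simp
    also have "\<dots> \<le> (2 * \<bar>h\<bar>) * ((1/2) ^ n * 3)" by (intro mult_left_mono n) auto
    finally show ?thesis by (simp add: mult_ac)
  qed
  define g' where "g' s h = h *\<^sub>R (a - T (flow a z s) a (flow a z s))" for s h
  let ?S = "{-3/2<..<3/2::real}"
  have f'_sums: "(\<lambda>n. f' n s h) sums g' s h" if s: "s \<in> ?S" for s h
  proof -
    have "(\<lambda>n. f' (Suc n) s h) sums g' s h"
      unfolding fsc g'_def using s by (intro sums_scaleR_right sums_field) auto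
    moreover have "f' 0 s h = 0" by (simp add: f'_def)
    ultimately show ?thesis using sums_Suc[of "\<lambda>n. f' n s h" "g' s h"] by simp
  qed
  have "\<exists>g. \<forall>x\<in>?S. (\<lambda>n. x ^ n *\<^sub>R flow_coeff a z n) sums g x \<and> (g has_derivative g' x) (at x within ?S)"
  proof (rule has_derivative_series)
    show "((\<lambda>s. s ^ n *\<^sub>R flow_coeff a z n) has_derivative f' n s) (at s within ?S)" for n s
      unfolding f'_def by (auto intro!: derivative_eq_intros simp: fun_eq_iff mult_ac)
    have lim: "(\<lambda>n. 12 * (1/2 :: real) ^ n) \<longlonglongrightarrow> 0"
      by (intro tendsto_mult_right_zero LIMSEQ_power_zero) auto
    show "\<forall>\<^sub>F n in sequentially. \<forall>s\<in>?S. \<forall>h. norm (sum (\<lambda>i. f' i s h) {..<n} - g' s h) \<le> e * norm h"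
      if "e > 0" for e
      using order_tendstoD(2)[OF lim that]
    proof eventually_elim
      case (elim n)
      show ?case
      proof (intro ballI allI)
        fix s h :: real assume s: "s \<in> ?S"
        have "sum (\<lambda>i. f' i s h) {..<n} - g' s h = - (\<Sum>i. f' (i + n) s h)"
          using suminf_minus_initial_segment[OF sums_summable[OF f'_sums[OF s, of h]], of n]
            sums_unique[OF f'_sums[OF s, of h]] by simp
        moreover have "norm (\<Sum>i. f' (i + n) s h) \<le> 2 * ((6 * \<bar>h\<bar>) * (1/2) ^ n)"
        proof (rule suminf_geometric_shift_le(2)[of _ _ "1/2"])
          have sb: "\<bar>s\<bar> \<le> 3/2" using s by (auto simp: abs_le_iff)
          show "norm (f' (i + n) s h) \<le> 6 * \<bar>h\<bar> * (1/2) ^ n * (1/2) ^ i" for i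
            using fb[OF sb, of "i + n" h] by (simp add: power_add mult_ac)
        qed auto
        ultimately have "norm (sum (\<lambda>i. f' i s h) {..<n} - g' s h) \<le> (12 * (1/2) ^ n) * \<bar>h\<bar>"
          by (simp add: mult_ac)
        also have "\<dots> \<le> e * norm h" using elim by (simp add: mult_right_mono)
        finally show "norm (sum (\<lambda>i. f' i s h) {..<n} - g' s h) \<le> e * norm h" .
      qed
    qed
    show "(\<lambda>n. 0 ^ n *\<^sub>R flow_coeff a z n) sums flow a z 0"
      using summable_sums[OF summable_norm_cancel[OF flow_summable(1)[OF a z, of 0]]]
      by (simp add: flow_def)
  qed auto
  then obtain g where g: "\<And>x. x \<in> ?S \<Longrightarrow> (\<lambda>n. x ^ n *\<^sub>R flow_coeff a z n) sums g x"
    "\<And>x. x \<in> ?S \<Longrightarrow> (g has_derivative g' x) (at x within ?S)" by blast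
  have tS: "t \<in> ?S" using t by auto
  have "(g has_derivative g' t) (at t)"
    using g(2)[OF tS] at_within_open[OF tS] by simp
  then have "((\<lambda>t. flow a z t) has_derivative g' t) (at t)"
    by (rule has_derivative_transform_within_open[OF _ _ tS])
       (use g(1) in \<open>auto simp: flow_def sums_iff\<close>)
  then show ?thesis by (simp add: has_vector_derivative_def g'_def[abs_def])
qed

end

section \<open>Transitivity on the ball\<close>

context jb_star_triple
begin

lemma flow_field [simp]: "flow 0 z t = z"
proof -
  have "flow_coeff 0 z (Suc n) = 0" for n by (simp add: flow_coeff.simps(2))
  then have "flow_coeff 0 z n = (if n = 0 then z else 0)" for n by (cases n) auto
  then have "(\<lambda>n. t ^ n *\<^sub>R flow_coeff 0 z n) = (\<lambda>n. if n = 0 then z else 0)" by (auto simp: fun_eq_iff)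
  then show ?thesis
    using sums_unique[OF sums_single[of 0 "\<lambda>_. z"]] unfolding flow_def by simp
qed

lemma flow_in_ball:
  assumes a: "norm a \<le> 1/64" and z: "norm z < 1"
  shows "norm (flow a z 1) < 1"
proof (rule field_line_stays_in_ball[where p = "flow a z" and a = a])
  show "((\<lambda>t. flow a z t) has_vector_derivative a - T (flow a z t) a (flow a z t)) (at t within {0..1})"
    if "t \<in> {0..1}" for t
    by (rule has_vector_derivative_at_within[OF flow_ode[OF a]]) (use that z in auto)
qed (use z in simp)

lemma flow_continuous:
  assumes a: "norm a \<le> 1/64"
  shows "continuous_on (ball 0 2) (\<lambda>z. flow a z 1)"
proof (rule continuous_at_imp_continuous_on, rule ballI)
  fix z assume "z \<in> ball (0::'a) 2"
  then have "norm z < 2" by simp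
  then obtain D where "((\<lambda>z. flow a z 1) has_derivative D) (at z)"
    using flow_has_derivative[OF a] by metis
  then show "isCont (\<lambda>z. flow a z 1) z" by (rule has_derivative_continuous)
qed

lemma flow_in_cball:
  assumes a: "norm a \<le> 1/64" and z: "norm z \<le> 1"
  shows "norm (flow a z 1) \<le> 1"
proof -
  have "(\<lambda>z. flow a z 1) ` closure (ball 0 1) \<subseteq> cball 0 1"
  proof (rule image_closure_subset)
    show "continuous_on (closure (ball 0 1)) (\<lambda>z. flow a z 1)"
      by (rule continuous_on_subset[OF flow_continuous[OF a]]) auto
    show "(\<lambda>z. flow a z 1) ` ball 0 1 \<subseteq> cball 0 1"
      by (auto simp: less_imp_le[OF flow_in_ball[OF a]])
  qed simp
  then have "flow a z 1 \<in> cball 0 1" using z by (auto dest: subsetD[OF _ imageI[of z]])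
  then show ?thesis by simp
qed

text \<open>
The field of \<open>- a\<close> is the negative of that of \<open>a\<close>, so running the line backwards solves the
equation for \<open>- a\<close>.  Two solutions with the same initial value agree: the derivative of their difference \<open>d\<close> is
at most half of the maximum of \<open>norm d\<close> on the unit interval, so this maximum vanishes.
\<close>

lemma flow_inverse:
  assumes a: "norm a \<le> 1/64" and z: "norm z \<le> 1"
  shows "flow (- a) (flow a z 1) 1 = z"
proof -
  define w where "w = flow a z 1"
  have w: "norm w \<le> 1" unfolding w_def by (rule flow_in_cball[OF a z])
  define x y d where "x t = flow a z (1 - t)" and "y t = flow (- a) w t" and "d t = y t - x t" for t :: real
  have b: "norm (x t) \<le> 4" "norm (y t) \<le> 4" if "t \<in> {0..1}" for t
    unfolding x_def y_def using that a z w by (auto intro!: flow_summable(2))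
  have dx: "(x has_vector_derivative - (a - T (x t) a (x t))) (at t within {0..1})" if "t \<in> {0..1}" for t
  proof -
    have 1: "((\<lambda>t. flow a z t) has_vector_derivative (a - T (x t) a (x t))) (at (1 - t))"
      unfolding x_def by (rule flow_ode) (use that a z in auto)
    have 2: "((\<lambda>t. 1 - t) has_vector_derivative -1) (at t within {0..1})"
      by (auto intro!: derivative_eq_intros)
    have "((\<lambda>t. flow a z t) \<circ> (\<lambda>t. 1 - t) has_vector_derivative (-1) *\<^sub>R (a - T (x t) a (x t))) (at t within {0..1})"
      by (rule vector_diff_chain_within[OF 2 has_vector_derivative_at_within[OF 1]])
    then show ?thesis by (simp add: o_def x_def[abs_def])
  qed
  have dy: "(y has_vector_derivative (- a - T (y t) (- a) (y t))) (at t within {0..1})" if "t \<in> {0..1}" for t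
    unfolding y_def[abs_def]
    by (rule has_vector_derivative_at_within[OF flow_ode]) (use that a w in auto)
  have dd: "(d has_vector_derivative (T (d t) a (y t) + T (x t) a (d t))) (at t within {0..1})"
    if "t \<in> {0..1}" for t
  proof -
    have "(d has_vector_derivative ((- a - T (y t) (- a) (y t)) - (- (a - T (x t) a (x t))))) (at t within {0..1})"
      unfolding d_def[abs_def] by (intro has_vector_derivative_diff dx dy that)
    moreover have "(- a - T (y t) (- a) (y t)) - (- (a - T (x t) a (x t))) = T (d t) a (y t) + T (x t) a (d t)"
      by (simp add: d_def T_diff T_minus)
    ultimately show ?thesis by simp
  qed
  have cont: "continuous_on {0..1} d" by (rule continuous_on_vector_derivative[OF dd])
  have "\<exists>t0\<in>{0..1}. \<forall>t\<in>{0..1}. norm (d t) \<le> norm (d t0)"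
    by (rule continuous_attains_sup[OF _ _ continuous_on_norm[OF cont]]) auto
  then obtain t0 where t0: "t0 \<in> {0..1}" "\<And>t. t \<in> {0..1} \<Longrightarrow> norm (d t) \<le> norm (d t0)"
    by blast
  have d0: "d 0 = 0" by (simp add: d_def x_def y_def w_def)
  have "norm (d t0 - d 0) \<le> (1/2 * norm (d t0)) * norm (t0 - 0)"
  proof (rule differentiable_bound[of "{0..1}"])
    fix t :: real assume t: "t \<in> {0..1}"
    show "(d has_derivative (\<lambda>h. h *\<^sub>R (T (d t) a (y t) + T (x t) a (d t)))) (at t within {0..1})"
      using dd[OF t] by (simp add: has_vector_derivative_def)
    have "norm (T (d t) a (y t) + T (x t) a (d t)) \<le> 1/2 * norm (d t0)"
    proof -
      have "norm (T (d t) a (y t)) \<le> 4 * norm (d t) * norm a * norm (y t)" by (rule T_bound)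
      also have "\<dots> \<le> 4 * norm (d t0) * (1/64) * 4"
        using t0(2)[OF t] a b[OF t] by (intro mult_mono) auto
      finally have 1: "norm (T (d t) a (y t)) \<le> 1/4 * norm (d t0)" by simp
      have "norm (T (x t) a (d t)) \<le> 4 * norm (x t) * norm a * norm (d t)" by (rule T_bound)
      also have "\<dots> \<le> 4 * 4 * (1/64) * norm (d t0)"
        using t0(2)[OF t] a b[OF t] by (intro mult_mono) auto
      finally have 2: "norm (T (x t) a (d t)) \<le> 1/4 * norm (d t0)" by simp
      show ?thesis using norm_triangle_mono[OF 1 2] by simp
    qed
    then have "norm (h *\<^sub>R (T (d t) a (y t) + T (x t) a (d t))) \<le> 1/2 * norm (d t0) * norm h" for h
      using mult_left_mono[of _ _ "\<bar>h\<bar>"] by (fastforce simp: mult_ac)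
    then show "onorm (\<lambda>h. h *\<^sub>R (T (d t) a (y t) + T (x t) a (d t))) \<le> 1/2 * norm (d t0)"
      by (intro onorm_bound) auto
  qed (use t0 in auto)
  also have "\<dots> \<le> (1/2 * norm (d t0)) * 1" using t0(1) by (intro mult_left_mono) auto
  finally have "norm (d t0) \<le> 0" using d0 by simp
  then have "d 1 = 0" using t0(2)[of 1] by simp
  then show ?thesis by (simp add: d_def x_def y_def w_def)
qed

lemma flow_second_order:
  assumes a: "norm a \<le> 1/64" and z: "norm z \<le> 2"
  shows "norm (flow a z 1 - z - (a - T z a z)) \<le> 1024 * (norm a)\<^sup>2"
proof -
  define \<kappa> where "\<kappa> = 16 * norm a"
  have sm: "summable (\<lambda>n. flow_coeff a z n)"
    using summable_norm_cancel[OF flow_summable(1)[OF a z, of 1]] by simp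
  have "flow a z 1 = (\<Sum>n. flow_coeff a z (n + 2)) + (\<Sum>n<2. flow_coeff a z n)"
    using suminf_split_initial_segment[OF sm, of 2] by (simp add: flow_def)
  also have "(\<Sum>n<2. flow_coeff a z n) = z + (a - T z a z)"
    by (simp add: numeral_2_eq_2 flow_coeff.simps)
  finally have "flow a z 1 - z - (a - T z a z) = (\<Sum>n. flow_coeff a z (n + 2))" by simp
  moreover have "norm (\<Sum>n. flow_coeff a z (n + 2)) \<le> 2 * (2 * \<kappa>\<^sup>2)"
  proof (rule suminf_geometric_shift_le(2))
    show "norm (flow_coeff a z (n + 2)) \<le> 2 * \<kappa>\<^sup>2 * \<kappa> ^ n" for n
      using norm_flow_coeff[OF z, of a "n + 2"] by (simp add: \<kappa>_def power_add mult_ac power2_eq_square)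
  qed (use a in \<open>auto simp: \<kappa>_def\<close>)
  ultimately show ?thesis by (simp add: \<kappa>_def power_mult_distrib)
qed

lemma flow_diff:
  assumes a: "norm a \<le> 1/128" and b: "norm b \<le> 1/128" and z: "norm z \<le> 2"
  shows "norm (flow a z 1 - flow b z 1) \<le> 44 * norm (a - b)"
proof -
  have sm: "summable (\<lambda>n. flow_coeff x z n)" if "norm x \<le> 1/128" for x
    using summable_norm_cancel[OF flow_summable(1)[of x z 1]] z that by simp
  have "flow a z 1 - flow b z 1 = (\<Sum>n. flow_coeff a z n - flow_coeff b z n)"
    unfolding flow_def using suminf_diff[OF sm[OF a] sm[OF b]] by simp
  also have "\<dots> = (\<Sum>n. flow_coeff a z (Suc n) - flow_coeff b z (Suc n))"
    using suminf_split_head[OF summable_diff[OF sm[OF a] sm[OF b]]] by simp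
  also have "norm \<dots> \<le> 2 * (22 * norm (a - b))"
    by (rule suminf_geometric_shift_le(2)[of _ _ "1/2"]) (use norm_flow_coeff_diff[OF z a b] in auto)
  finally show ?thesis by simp
qed

text \<open>
The flow from \<open>0\<close> differs from \<open>a\<close> by terms of order two and higher in time, whose
Lipschitz constant in \<open>a\<close> is small for small \<open>a\<close>.
\<close>

lemma flow_from_0_diff:
  assumes a: "norm a \<le> 1/5632" and b: "norm b \<le> 1/5632"
  shows "norm ((flow a 0 1 - a) - (flow b 0 1 - b)) \<le> 1/2 * norm (a - b)"
proof -
  have sm: "summable (\<lambda>n. flow_coeff x 0 n)" if "norm x \<le> 1/5632" for x
    using summable_norm_cancel[OF flow_summable(1)[of x 0 1]] that by simp
  have tail: "flow x 0 1 - x = (\<Sum>n. flow_coeff x 0 (n + 2))" if "norm x \<le> 1/5632" for x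
    using suminf_split_initial_segment[OF sm[OF that], of 2]
    by (simp add: flow_def numeral_2_eq_2 flow_coeff.simps)
  have sm2: "summable (\<lambda>n. flow_coeff x 0 (n + 2))" if "norm x \<le> 1/5632" for x
    using summable_ignore_initial_segment[OF sm[OF that], of 2] .
  have "(flow a 0 1 - a) - (flow b 0 1 - b) = (\<Sum>n. flow_coeff a 0 (n + 2) - flow_coeff b 0 (n + 2))"
    unfolding tail[OF a] tail[OF b] by (rule suminf_diff[OF sm2[OF a] sm2[OF b]])
  also have "norm \<dots> \<le> 2 * (1/4 * norm (a - b))"
  proof (rule suminf_geometric_shift_le(2)[of _ _ "1/88"])
    show "norm (flow_coeff a 0 (n + 2) - flow_coeff b 0 (n + 2)) \<le> 1/4 * norm (a - b) * (1/88) ^ n" for n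
      using norm_flow_coeff_diff[of 0 a "1/5632" b "Suc n"] a b by simp
  qed auto
  finally show ?thesis by simp
qed

text \<open>
The equation \<open>flow a 0 1 = q\<close> is solved by iterating \<open>a \<mapsto> q - (flow a 0 1 - a)\<close>.
\<close>

lemma flow_reaches_small_points:
  assumes q: "norm q \<le> 1/12000"
  obtains a where "norm a \<le> 1/6000" "flow a 0 1 = q"
proof -
  define f where "f a = q - (flow a 0 1 - a)" for a
  have lip: "norm (f a - f b) \<le> 1/2 * norm (a - b)" if "norm a \<le> 1/6000" "norm b \<le> 1/6000" for a b
    using flow_from_0_diff[of b a] that by (simp add: f_def norm_minus_commute algebra_simps)
  have "\<exists>!x\<in>cball 0 (1/6000). f x = x"
  proof (rule Banach_fix[where c = "1/2"])
    show "f ` cball 0 (1/6000) \<subseteq> cball 0 (1/6000)"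
    proof safe
      fix a assume a: "a \<in> cball (0::'a) (1/6000)"
      have "norm (f a) \<le> norm (f 0) + norm (f a - f 0)"
        using norm_triangle_ineq[of "f 0" "f a - f 0"] by simp
      also have "\<dots> \<le> 1/12000 + 1/2 * (1/6000)"
        using q a lip[of a 0] by (intro add_mono) (auto simp: f_def)
      finally show "f a \<in> cball 0 (1/6000)" by simp
    qed
    show "dist (f x) (f y) \<le> 1/2 * dist x y" if "x \<in> cball 0 (1/6000)" "y \<in> cball 0 (1/6000)" for x y
      using lip[of x y] that by (simp add: dist_norm)
  qed (auto simp: complete_eq_closed)
  then obtain a where "a \<in> cball 0 (1/6000)" "f a = a" by blast
  then show thesis using that[of a] by (simp add: f_def)
qed

text \<open>
Compositions of short flows.  The bound on \<open>a\<close> only has to be small enough for all estimates on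
the flow.
\<close>

inductive_set moves :: "('a \<Rightarrow> 'a) set" where
  moves_id: "(\<lambda>z. z) \<in> moves"
| moves_step: "h \<in> moves \<Longrightarrow> norm a \<le> 1/6000 \<Longrightarrow> (\<lambda>z. flow a (h z) 1) \<in> moves"

lemma moves_comp: "h \<in> moves \<Longrightarrow> k \<in> moves \<Longrightarrow> (\<lambda>z. h (k z)) \<in> moves"
  by (induction rule: moves.induct) (auto intro: moves.intros)

lemma moves_cball: "h \<in> moves \<Longrightarrow> norm z \<le> 1 \<Longrightarrow> norm (h z) \<le> 1"
  by (induction rule: moves.induct) (auto intro!: flow_in_cball)

lemma moves_ball: "h \<in> moves \<Longrightarrow> norm z < 1 \<Longrightarrow> norm (h z) < 1"
  by (induction rule: moves.induct) (auto intro!: flow_in_ball)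

lemma moves_continuous: "h \<in> moves \<Longrightarrow> continuous_on (cball 0 1) h"
proof (induction rule: moves.induct)
  case (moves_step h a)
  have a: "norm a \<le> 1/64" using moves_step by simp
  have "h ` cball 0 1 \<subseteq> ball 0 2" using moves_cball[OF moves_step(1)] by force
  then show ?case
    using continuous_on_compose2[OF flow_continuous[OF a] moves_step.IH] by blast
qed (rule continuous_on_id)

lemma moves_inverse:
  assumes "h \<in> moves"
  obtains k where "k \<in> moves" "\<And>z. norm z \<le> 1 \<Longrightarrow> k (h z) = z" "\<And>z. norm z \<le> 1 \<Longrightarrow> h (k z) = z"
proof -
  have "\<exists>k\<in>moves. \<forall>z. norm z \<le> 1 \<longrightarrow> k (h z) = z \<and> h (k z) = z"
    using assms
  proof (induction rule: moves.induct)
    case moves_id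
    then show ?case using moves.moves_id by fastforce
  next
    case (moves_step h a)
    then obtain k where k: "k \<in> moves" "\<And>z. norm z \<le> 1 \<Longrightarrow> k (h z) = z \<and> h (k z) = z" by blast
    have fl: "(\<lambda>z. flow (- a) z 1) \<in> moves"
      using moves.moves_step[OF moves.moves_id, of "- a"] moves_step by simp
    have "(\<lambda>z. k (flow (- a) z 1)) \<in> moves" by (rule moves_comp[OF k(1) fl])
    moreover have "k (flow (- a) (flow a (h z) 1) 1) = z \<and> flow a (h (k (flow (- a) z 1))) 1 = z"
      if z: "norm z \<le> 1" for z
    proof
      show "k (flow (- a) (flow a (h z) 1) 1) = z"
        using flow_inverse[of a "h z"] moves_cball[OF moves_step(1) z] k(2)[OF z] moves_step by simp
      have "norm (flow (- a) z 1) \<le> 1" using moves_step z by (intro flow_in_cball) auto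
      then show "flow a (h (k (flow (- a) z 1))) 1 = z"
        using k(2) flow_inverse[of "- a" z] moves_step z by simp
    qed
    ultimately show ?case by (intro bexI[of _ "\<lambda>z. k (flow (- a) z 1)"]) auto
  qed
  then show thesis using that by blast
qed

text \<open>
Euler's method along the segment from \<open>p\<close> to \<open>0\<close>.  With \<open>n\<close> steps the point \<open>h p\<close> follows the
segment up to an error that one step multiplies by at most \<open>1 + 8 A / n\<close> and increases by
\<open>O (1 / n\<^sup>2)\<close>; so the final error is \<open>O (1 / n)\<close>.
\<close>

lemma moves_approach_0:
  assumes p: "norm p < 1" and e: "0 < e"
  obtains h where "h \<in> moves" "norm (h p) < e"
proof -
  obtain A where A: "0 \<le> A" "\<And>s. s \<in> {0..1} \<Longrightarrow> \<exists>a. norm a \<le> A \<and> a - T (s *\<^sub>R p) a (s *\<^sub>R p) = p"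
    using radial_field[OF p] by blast
  define C where "C = exp (8 * A) * (1024 * A\<^sup>2)"
  obtain n :: nat where n: "real n > max 1 (max (6000 * A) (C / e))"
    using reals_Archimedean2 by blast
  then have n0: "real n > 0" "A / real n \<le> 1/6000" "C / real n < e"
    using e by (auto simp: field_simps)
  \<comment> \<open>an error bound that solves \<open>E (k + 1) \<ge> (1 + 8 A / n) E k + 1024 (A / n)\<^sup>2\<close>\<close>
  define E where "E k = real k * ((1 + 8 * A / n) ^ k * (1024 * (A / n)\<^sup>2))" for k
  have "k \<le> n \<Longrightarrow> \<exists>h\<in>moves. norm (h p - (1 - k / n) *\<^sub>R p) \<le> E k" for k
  proof (induction k)
    case 0
    show ?case by (rule bexI[OF _ moves_id]) (simp add: E_def)
  next
    case (Suc k)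
    then obtain h where h: "h \<in> moves" "norm (h p - (1 - k / n) *\<^sub>R p) \<le> E k" by auto
    define s where "s = 1 - k / n"
    define q where "q = h p"
    have q: "norm q < 1" unfolding q_def by (rule moves_ball[OF h(1) p])
    have "s \<in> {0..1}" using Suc.prems n0 by (auto simp: s_def field_simps)
    then obtain a where a: "norm a \<le> A" "a - T (s *\<^sub>R p) a (s *\<^sub>R p) = p" using A(2) by blast
    have sp: "norm (s *\<^sub>R p) \<le> 1" using \<open>s \<in> {0..1}\<close> p mult_mono[of s 1 "norm p" 1] by simp
    define b where "b = (- 1 / n) *\<^sub>R a"
    have b: "norm b \<le> A / n" using a n0 by (simp add: b_def divide_right_mono)
    have b6: "norm b \<le> 1/6000" using b n0 by linarith
    have Xb: "b - T (s *\<^sub>R p) b (s *\<^sub>R p) = (- 1 / n) *\<^sub>R p"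
      unfolding b_def T_scaleR(2) scaleR_diff_right[symmetric] a(2) ..
    define D where "D = q - s *\<^sub>R p"
    have "flow b q 1 - (1 - Suc k / n) *\<^sub>R p
        = (flow b q 1 - q - (b - T q b q)) + (D - (T D b q + T (s *\<^sub>R p) b D))"
    proof -
      have "(1 - Suc k / n) *\<^sub>R p = s *\<^sub>R p + (b - T (s *\<^sub>R p) b (s *\<^sub>R p))"
        unfolding Xb by (simp add: s_def add_divide_distrib algebra_simps)
      then show ?thesis by (simp add: D_def T_diff)
    qed
    also have "norm \<dots> \<le> 1024 * (norm b)\<^sup>2 + (norm D + 8 * norm b * norm D)"
    proof (intro norm_triangle_mono)
      show "norm (flow b q 1 - q - (b - T q b q)) \<le> 1024 * (norm b)\<^sup>2"
        using b6 q by (intro flow_second_order) auto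
      have "norm (T D b q) \<le> 4 * norm D * norm b * norm q" by (rule T_bound)
      also have "\<dots> \<le> 4 * norm D * norm b * 1" using q by (intro mult_left_mono) auto
      finally have 1: "norm (T D b q) \<le> 4 * norm b * norm D" by (simp add: mult_ac)
      have "norm (T (s *\<^sub>R p) b D) \<le> 4 * norm (s *\<^sub>R p) * norm b * norm D" by (rule T_bound)
      also have "\<dots> \<le> 4 * 1 * norm b * norm D" by (intro mult_right_mono mult_left_mono sp) auto
      finally have 2: "norm (T (s *\<^sub>R p) b D) \<le> 4 * norm b * norm D" by simp
      show "norm (D - (T D b q + T (s *\<^sub>R p) b D)) \<le> norm D + 8 * norm b * norm D"
        using norm_triangle_ineq4[of D "T D b q + T (s *\<^sub>R p) b D"]
          norm_triangle_mono[OF 1 2] by linarith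
    qed
    also have "\<dots> \<le> 1024 * (A / n)\<^sup>2 + (E k + 8 * (A / n) * E k)"
      using b h(2) n0 A(1) by (intro add_mono mult_left_mono mult_mono power_mono) (auto simp: D_def q_def s_def)
    also have "\<dots> \<le> E (Suc k)"
    proof -
      define x where "x = 1 + 8 * A / n"
      define y where "y = 1024 * (A / n)\<^sup>2"
      have x: "1 \<le> x" using A(1) n0 by (simp add: x_def)
      have y: "0 \<le> y" by (simp add: y_def)
      have "1 * y \<le> x ^ Suc k * y" using x y by (intro mult_right_mono one_le_power) auto
      then have "y + x * (real k * (x ^ k * y)) \<le> real (Suc k) * (x ^ Suc k * y)"
        by (simp add: algebra_simps)
      then show ?thesis by (simp add: E_def x_def[symmetric] y_def[symmetric])
          (simp add: x_def algebra_simps)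
    qed
    finally have "norm (flow b (h p) 1 - (1 - Suc k / n) *\<^sub>R p) \<le> E (Suc k)" by (simp add: q_def)
    then show ?case
      by (intro bexI[of _ "\<lambda>z. flow b (h z) 1"] moves_step[OF h(1) b6])
  qed
  then obtain h where h: "h \<in> moves" "norm (h p - (1 - n / n) *\<^sub>R p) \<le> E n" by blast
  then have "norm (h p) \<le> E n" using n0 by simp
  also have "E n \<le> C / n"
  proof -
    have "(1 + 8 * A / n) ^ n \<le> exp (8 * A)"
      using exp_ge_one_plus_x_over_n_power_n[of n "8 * A"] A(1) n0 by auto
    then have "E n \<le> real n * (exp (8 * A) * (1024 * (A / n)\<^sup>2))"
      unfolding E_def by (intro mult_left_mono mult_right_mono) auto
    also have "\<dots> = C / n" using n0 by (simp add: C_def power2_eq_square field_simps)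
    finally show ?thesis .
  qed
  finally have "norm (h p) < e" using n0 by linarith
  then show thesis using h(1) that by blast
qed

lemma moves_to_0:
  assumes p: "norm p < 1"
  obtains h where "h \<in> moves" "h p = 0"
proof -
  obtain h where h: "h \<in> moves" "norm (h p) < 1/12000"
    using moves_approach_0[OF p, of "1/12000"] by auto
  then obtain a where a: "norm a \<le> 1/6000" "flow a 0 1 = h p"
    using flow_reaches_small_points[of "h p"] by auto
  have "(\<lambda>z. flow (- a) (h z) 1) \<in> moves" using h a by (intro moves_step) auto
  moreover have "flow (- a) (h p) 1 = 0" using flow_inverse[of a 0] a by simp
  ultimately show thesis using that by blast
qed

end

section \<open>Automorphisms fixing the origin\<close>

lemma holo_on_cong:
  assumes "holo_on f S" "open S" "\<And>x. x \<in> S \<Longrightarrow> f x = g x"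
  shows "holo_on g S"
  unfolding holo_on_def
proof
  fix x assume x: "x \<in> S"
  then obtain D where D: "clinear D" "(f has_derivative D) (at x)"
    using assms(1) unfolding holo_on_def by blast
  have "(g has_derivative D) (at x)"
    by (rule has_derivative_transform_within_open[OF D(2) assms(2) x assms(3)])
  then show "\<exists>D. clinear D \<and> (g has_derivative D) (at x)" using D(1) by blast
qed

lemma holo_on_comp:
  assumes "holo_on f S" "holo_on g U" "f ` S \<subseteq> U"
  shows "holo_on (\<lambda>z. g (f z)) S"
  unfolding holo_on_def
proof
  fix x assume x: "x \<in> S"
  obtain D where D: "clinear D" "(f has_derivative D) (at x)"
    using assms(1) x unfolding holo_on_def by blast
  obtain E where E: "clinear E" "(g has_derivative E) (at (f x))"
    using assms(2,3) x unfolding holo_on_def by blast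
  have "clinear (\<lambda>h. E (D h))" using D E by (simp add: clinear_def)
  moreover have "((\<lambda>z. g (f z)) has_derivative (\<lambda>h. E (D h))) (at x)"
    by (rule has_derivative_compose[OF D(2) E(2)])
  ultimately show "\<exists>D. clinear D \<and> ((\<lambda>z. g (f z)) has_derivative D) (at x)" by blast
qed

lemma holo_on_diff:
  assumes "holo_on f S" "holo_on g S"
  shows "holo_on (\<lambda>z. f z - g z) S"
  unfolding holo_on_def
proof
  fix x assume x: "x \<in> S"
  obtain D where D: "clinear D" "(f has_derivative D) (at x)"
    using assms(1) x unfolding holo_on_def by blast
  obtain E where E: "clinear E" "(g has_derivative E) (at x)"
    using assms(2) x unfolding holo_on_def by blast
  have "clinear (\<lambda>h. D h - E h)" using D E by (simp add: clinear_def scaleC_diff_right)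
  moreover have "((\<lambda>z. f z - g z) has_derivative (\<lambda>h. D h - E h)) (at x)"
    by (rule has_derivative_diff[OF D(2) E(2)])
  ultimately show "\<exists>D. clinear D \<and> ((\<lambda>z. f z - g z) has_derivative D) (at x)" by blast
qed

lemma holo_on_linear:
  assumes "clinear f" "bounded_linear f"
  shows "holo_on f S"
  unfolding holo_on_def using assms bounded_linear_imp_has_derivative by blast

lemma holo_on_scaleC: "holo_on (\<lambda>z. c *\<^sub>C z) S"
  by (rule holo_on_linear[OF _ bounded_linear_scaleC_right])
    (simp add: clinear_def scaleC_add_right scaleC_scaleC mult.commute)

lemma holo_on_ident: "holo_on (\<lambda>z. z) S"
  by (rule holo_on_linear) (auto simp: clinear_def bounded_linear_ident)

lemma Aut_ballI:
  assumes "holo_on f (ball 0 1)" "holo_on k (ball 0 1)"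
    and "\<And>z. norm z < 1 \<Longrightarrow> norm (f z) < 1 \<and> norm (k z) < 1 \<and> k (f z) = z \<and> f (k z) = z"
  shows "restrict f (ball 0 1) \<in> Aut_ball"
proof -
  let ?B = "ball 0 1 :: 'a set" and ?f = "restrict f (ball 0 1)"
  have bij: "bij_betw ?f ?B ?B"
    by (rule bij_betw_byWitness[where f' = k]) (use assms(3) in auto)
  have "inv_into ?B ?f z = k z" if "z \<in> ?B" for z
    using bij assms(3)[of z] that
    by (intro inv_into_f_eq) (auto simp: bij_betw_def)
  then have "holo_on (inv_into ?B ?f) ?B"
    by (intro holo_on_cong[OF assms(2)]) auto
  moreover have "holo_on ?f ?B" by (rule holo_on_cong[OF assms(1)]) auto
  ultimately show ?thesis using bij by (auto simp: Aut_ball_def)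
qed

lemma Aut_ballE:
  assumes "g \<in> Aut_ball"
  obtains k where "holo_on g (ball 0 1)" "holo_on k (ball 0 1)"
    "\<And>z. norm z < 1 \<Longrightarrow> norm (g z) < 1 \<and> norm (k z) < 1 \<and> k (g z) = z \<and> g (k z) = z"
proof
  let ?B = "ball 0 1 :: 'a set"
  have bij: "bij_betw g ?B ?B" using assms by (simp add: Aut_ball_def)
  show "holo_on g ?B" "holo_on (inv_into ?B g) ?B" using assms by (auto simp: Aut_ball_def)
  show "norm (g z) < 1 \<and> norm (inv_into ?B g z) < 1 \<and> inv_into ?B g (g z) = z \<and> g (inv_into ?B g z) = z"
    if "norm z < 1" for z
  proof -
    have z: "z \<in> ?B" using that by simp
    have "g z \<in> ?B" "inv_into ?B g z \<in> ?B"
      using bij_betwE[OF bij] bij_betwE[OF bij_betw_inv_into[OF bij]] z by blast+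
    then show ?thesis
      using bij_betw_inv_into_left[OF bij z] bij_betw_inv_into_right[OF bij z] by simp
  qed
qed

lemma Aut_ball_comp:
  assumes "f \<in> Aut_ball" "g \<in> Aut_ball"
  shows "restrict (\<lambda>z. f (g z)) (ball 0 1) \<in> Aut_ball"
proof -
  obtain f' where f: "holo_on f (ball 0 1)" "holo_on f' (ball 0 1)"
    "\<And>z. norm z < 1 \<Longrightarrow> norm (f z) < 1 \<and> norm (f' z) < 1 \<and> f' (f z) = z \<and> f (f' z) = z"
    using Aut_ballE[OF assms(1)] by blast
  obtain g' where g: "holo_on g (ball 0 1)" "holo_on g' (ball 0 1)"
    "\<And>z. norm z < 1 \<Longrightarrow> norm (g z) < 1 \<and> norm (g' z) < 1 \<and> g' (g z) = z \<and> g (g' z) = z"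
    using Aut_ballE[OF assms(2)] by blast
  show ?thesis
  proof (rule Aut_ballI[where k = "\<lambda>z. g' (f' z)"])
    show "holo_on (\<lambda>z. f (g z)) (ball 0 1)" "holo_on (\<lambda>z. g' (f' z)) (ball 0 1)"
      using f(3) g(3) by (intro holo_on_comp[OF g(1) f(1)] holo_on_comp[OF f(2) g(2)]; auto)+
  qed (use f(3) g(3) in auto)
qed

text \<open>
A path that is continuous for uniform convergence on the ball is continuous for the topology of
locally uniform convergence, since the image of the neighbourhood filter of a time is a filter of
automorphisms that converges locally uniformly.
\<close>

lemma connected_component_of_Aut_top_path:
  fixes \<gamma> :: "real \<Rightarrow> 'a::complex_banach \<Rightarrow> 'a"
  assumes aut: "\<And>t. t \<in> {0..1} \<Longrightarrow> \<gamma> t \<in> Aut_ball"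
    and cont: "\<And>t e. t \<in> {0..1} \<Longrightarrow> 0 < e \<Longrightarrow>
      \<exists>d>0. \<forall>s\<in>{0..1}. \<bar>s - t\<bar> < d \<longrightarrow> (\<forall>z. norm z < 1 \<longrightarrow> norm (\<gamma> s z - \<gamma> t z) < e)"
  shows "connected_component_of Aut_top (\<gamma> 0) (\<gamma> 1)"
proof -
  have cm: "continuous_map (top_of_set {0..1}) Aut_top \<gamma>"
    unfolding continuous_map_def
  proof (intro conjI allI impI)
    show "\<gamma> \<in> topspace (top_of_set {0..1}) \<rightarrow> topspace Aut_top"
      using aut by (auto simp: topspace_Aut_top)
    fix U :: "('a \<Rightarrow> 'a) set" assume U: "openin Aut_top U"
    have "\<exists>d>0. \<forall>s\<in>{0..1}. dist s t < d \<longrightarrow> s \<in> {x \<in> {0..1}. \<gamma> x \<in> U}"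
      if t: "t \<in> {x \<in> {0..1}. \<gamma> x \<in> U}" for t
    proof -
      let ?N = "inf (nhds t) (principal {0..1})"
      let ?F = "filtermap \<gamma> ?N"
      have ev: "eventually P ?N \<longleftrightarrow> (\<exists>d>0. \<forall>s\<in>{0..1}. dist s t < d \<longrightarrow> P s)" for P
        unfolding eventually_inf_principal eventually_nhds_metric by auto
      have "\<forall>\<^sub>F h in ?F. h \<in> Aut_ball"
        unfolding eventually_filtermap ev using aut by (intro exI[of _ 1]) auto
      moreover have "locally_uniform_limit (ball 0 1) (\<lambda>h. h) (\<gamma> t) ?F"
        unfolding locally_uniform_limit_def
      proof
        fix x :: 'a
        have "uniform_limit (ball x 1 \<inter> ball 0 1) (\<lambda>h. h) (\<gamma> t) ?F"
          unfolding uniform_limit_iff eventually_filtermap ev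
          using cont[of t] t by (force simp: dist_norm)
        then show "\<exists>e>0. uniform_limit (ball x e \<inter> ball 0 1) (\<lambda>h. h) (\<gamma> t) ?F"
          by (intro exI[of _ 1]) auto
      qed
      ultimately have "\<forall>\<^sub>F h in ?F. h \<in> U"
        using U t unfolding openin_Aut_top by blast
      then show ?thesis unfolding eventually_filtermap ev by auto
    qed
    then show "openin (top_of_set {0..1}) {x \<in> topspace (top_of_set {0..1}). \<gamma> x \<in> U}"
      unfolding openin_euclidean_subtopology_iff by (auto simp: dist_commute)
  qed
  have "connectedin Aut_top (\<gamma> ` {0..1})"
    by (rule connectedin_continuous_map_image[OF cm]) (simp add: connectedin_subtopology)
  then show ?thesis
    unfolding connected_component_of_def by (intro exI[of _ "\<gamma> ` {0..1}"]) auto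
qed

lemma slice_has_field_derivative:
  fixes a b :: "'a::complex_banach"
  assumes "cfunctional \<phi>" "clinear D" "(F has_derivative D) (at (a + z *\<^sub>C b))"
  shows "((\<lambda>z. \<phi> (F (a + z *\<^sub>C b))) has_field_derivative \<phi> (D b)) (at z)"
proof -
  have bl: "bounded_linear (\<lambda>z. z *\<^sub>C b)"
    by (rule bounded_bilinear.bounded_linear_left[OF bounded_bilinear_scaleC])
  have "((\<lambda>z. a + z *\<^sub>C b) has_derivative (\<lambda>h. 0 + h *\<^sub>C b)) (at z)"
    by (intro has_derivative_add has_derivative_const bounded_linear_imp_has_derivative bl)
  then have "((\<lambda>z. F (a + z *\<^sub>C b)) has_derivative (\<lambda>h. D (0 + h *\<^sub>C b))) (at z)"
    by (rule has_derivative_compose[where g = F and g' = D]) (rule assms(3))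
  then have "((\<lambda>z. \<phi> (F (a + z *\<^sub>C b))) has_derivative (\<lambda>h. \<phi> (D (0 + h *\<^sub>C b)))) (at z)"
    by (rule bounded_linear.has_derivative[OF cfunctional_bounded_linear[OF assms(1)]])
  also have "(\<lambda>h. \<phi> (D (0 + h *\<^sub>C b))) = (*) (\<phi> (D b))"
    using assms(1,2) by (auto simp: clinear_def cfunctional_scaleC mult.commute)
  finally show ?thesis by (simp add: has_field_derivative_def)
qed

lemma slice_holomorphic:
  fixes a b :: "'a::complex_banach"
  assumes "cfunctional \<phi>" "holo_on F S" "\<And>z. z \<in> A \<Longrightarrow> a + z *\<^sub>C b \<in> S"
  shows "(\<lambda>z. \<phi> (F (a + z *\<^sub>C b))) holomorphic_on A"
  unfolding holomorphic_on_def field_differentiable_def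
proof
  fix z assume "z \<in> A"
  then obtain D where "clinear D" "(F has_derivative D) (at (a + z *\<^sub>C b))"
    using assms(2,3) unfolding holo_on_def by blast
  then show "\<exists>f'. ((\<lambda>z. \<phi> (F (a + z *\<^sub>C b))) has_field_derivative f') (at z within A)"
    using slice_has_field_derivative[OF assms(1)] has_field_derivative_at_within by blast
qed

text \<open>
Cauchy's estimate on the complex line through \<open>x\<close> in the direction \<open>h\<close>.
\<close>

lemma derivative_bound:
  fixes x h :: "'a::complex_banach" and E :: "'a \<Rightarrow> 'b::complex_banach"
  assumes E: "holo_on E S" "clinear D" "(E has_derivative D) (at x)" and r: "0 < r"
    and in_S: "\<And>z. cmod z \<le> r \<Longrightarrow> x + z *\<^sub>C h \<in> S"
    and B: "\<And>z. cmod z \<le> r \<Longrightarrow> norm (E (x + z *\<^sub>C h)) \<le> B"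
  shows "norm (D h) \<le> B / r"
proof (rule norm_le_by_functionals)
  fix \<phi> :: "'b \<Rightarrow> complex" assume \<phi>: "cfunctional \<phi>"
  define f where "f z = \<phi> (E (x + z *\<^sub>C h))" for z
  have hol: "f holomorphic_on cball 0 r"
    unfolding f_def by (rule slice_holomorphic[OF \<phi> E(1)]) (use in_S in auto)
  have "cmod ((deriv ^^ 1) f 0) \<le> fact 1 * B / r ^ 1"
  proof (rule Cauchy_inequality)
    show "f holomorphic_on ball 0 r" by (rule holomorphic_on_subset[OF hol]) auto
    show "continuous_on (cball 0 r) f" by (rule holomorphic_on_imp_continuous_on[OF hol])
    show "cmod (f z) \<le> B" if "cmod (0 - z) = r" for z
      unfolding f_def using order_trans[OF cfunctional_bound[OF \<phi>] B[of z]] that by simp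
  qed (rule r)
  moreover have "deriv f 0 = \<phi> (D h)"
    unfolding f_def using slice_has_field_derivative[OF \<phi> E(2), of E x 0 h] E(3)
    by (intro DERIV_imp_deriv) simp
  ultimately show "cmod (\<phi> (D h)) \<le> B / r" by simp
qed

lemma schwarz_bound:
  assumes hol: "f holomorphic_on ball 0 1" and M: "\<And>z. cmod z < 1 \<Longrightarrow> cmod (f z) \<le> M"
    and f0: "f 0 = 0" and z: "cmod z < 1"
  shows "cmod (f z) \<le> M * cmod z"
proof (rule field_le_epsilon)
  fix e :: real assume e: "0 < e"
  have M0: "0 \<le> M" using M[of 0] f0 by simp
  define c where "c = M + e"
  have c: "0 < c" "M < c" using M0 e by (simp_all add: c_def)
  define g where "g w = f w / of_real c" for w
  have "cmod (g z) \<le> cmod z"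
  proof (rule Schwarz_Lemma(1))
    show "g holomorphic_on ball 0 1" unfolding g_def using c by (intro holomorphic_intros hol) auto
    show "cmod (g w) < 1" if "cmod w < 1" for w
      using M[OF that] c by (simp add: g_def norm_divide)
  qed (use f0 z in \<open>auto simp: g_def\<close>)
  then have "cmod (f z) \<le> (M + e) * cmod z"
    using c by (simp add: g_def norm_divide field_simps flip: c_def)
  also have "\<dots> \<le> M * cmod z + e"
    using z e mult_left_le[of "cmod z" e] by (simp add: distrib_right)
  finally show "cmod (f z) \<le> M * cmod z + e" .
qed

text \<open>
Divide by \<open>z\<close> and use induction.  The hypothesis says that \<open>f\<close> vanishes to higher than
\<open>m\<close>-th order, and then it vanishes to order \<open>m + 1\<close>.
\<close>

lemma schwarz_bound_order:
  assumes "f holomorphic_on ball 0 1" "\<And>z. cmod z < 1 \<Longrightarrow> cmod (f z) \<le> M"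
    and "\<And>e. 0 < e \<Longrightarrow> \<exists>d>0. \<forall>z. cmod z < d \<longrightarrow> cmod (f z) \<le> e * cmod z ^ m" and "cmod z < 1"
  shows "cmod (f z) \<le> M * cmod z ^ Suc m"
  using assms
proof (induction m arbitrary: f z)
  case 0
  have "cmod (f 0) \<le> e" if "0 < e" for e
    using 0(3)[OF that] by auto
  then have "cmod (f 0) \<le> 0" by (rule field_le_epsilon) simp
  then show ?case using schwarz_bound[OF 0(1,2) _ 0(4)] by simp
next
  case (Suc m)
  define g where "g z = f z / z" for z
  obtain d0 where d0: "d0 > 0" "\<And>z. cmod z < d0 \<Longrightarrow> cmod (f z) \<le> 1 * cmod z ^ Suc m"
    using Suc.prems(3)[of 1] by auto
  have f0: "f 0 = 0" using d0(2)[of 0] d0(1) by simp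
  have der0: "(f has_field_derivative 0) (at 0)"
  proof -
    have "((\<lambda>y. f y / y) \<longlongrightarrow> 0) (at 0)"
      unfolding tendsto_iff
    proof (intro allI impI)
      fix e :: real assume e: "0 < e"
      obtain d where d: "d > 0" "\<And>z. cmod z < d \<Longrightarrow> cmod (f z) \<le> (e/2) * cmod z ^ Suc m"
        using Suc.prems(3)[of "e/2"] e by auto
      have "\<forall>\<^sub>F y in at 0. y \<in> ball 0 (min d 1) - {0::complex}"
        using d(1) by (intro eventually_at_in_open) auto
      then show "\<forall>\<^sub>F y in at 0. dist (f y / y) 0 < e"
      proof eventually_elim
        case (elim y)
        have "cmod (f y) \<le> (e/2) * (cmod y * cmod y ^ m)" using d(2)[of y] elim by simp
        also have "\<dots> \<le> (e/2) * (cmod y * 1)"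
          using e elim by (intro mult_left_mono power_le_one) auto
        finally have "cmod (f y) / cmod y \<le> e/2" using elim by (simp add: field_simps)
        moreover have "dist (f y / y) 0 = cmod (f y) / cmod y" by (simp add: norm_divide)
        ultimately show ?case using e by linarith
      qed
    qed
    then show ?thesis by (simp add: has_field_derivative_iff f0)
  qed
  have "g holomorphic_on ball 0 1"
    by (rule pole_theorem_open_0[of f _ 0])
      (use Suc.prems(1) f0 DERIV_imp_deriv[OF der0] in \<open>auto simp: g_def\<close>)
  moreover have gM: "cmod (g w) \<le> M" if "cmod w < 1" for w
  proof (cases "w = 0")
    case True
    have "0 \<le> M" using Suc.prems(2)[of 0] f0 by simp
    then show ?thesis using True by (simp add: g_def)
  next
    case False
    then show ?thesis using schwarz_bound[OF Suc.prems(1,2) f0 that]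
      by (simp add: g_def norm_divide field_simps)
  qed
  moreover have "\<exists>d>0. \<forall>z. cmod z < d \<longrightarrow> cmod (g z) \<le> e * cmod z ^ m" if e: "0 < e" for e
  proof -
    obtain d where d: "d > 0" "\<And>z. cmod z < d \<Longrightarrow> cmod (f z) \<le> e * cmod z ^ Suc m"
      using Suc.prems(3)[OF e] by auto
    have "cmod (g z) \<le> e * cmod z ^ m" if "cmod z < d" for z
      using d(2)[OF that] e by (cases "z = 0") (auto simp: g_def norm_divide field_simps)
    then show ?thesis using d(1) by blast
  qed
  ultimately have "cmod (g z) \<le> M * cmod z ^ Suc m" using Suc.IH Suc.prems(4) by blast
  then show ?case
    using f0 by (cases "z = 0") (auto simp: g_def norm_divide field_simps)
qed

text \<open>
The previous lemma on complex lines through \<open>0\<close>.  In this form an infinitesimal estimate at the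
origin becomes an estimate on the whole ball with a constant that only depends on the supremum.
\<close>

lemma vanishing_order_bound:
  fixes E :: "'a::complex_banach \<Rightarrow> 'a"
  assumes hol: "holo_on E (ball 0 1)" and M: "\<And>z. norm z < 1 \<Longrightarrow> norm (E z) \<le> M"
    and small: "\<And>e. 0 < e \<Longrightarrow> \<exists>d>0. \<forall>z. norm z < d \<longrightarrow> norm (E z) \<le> e * norm z ^ m"
    and z: "norm z < 1"
  shows "norm (E z) \<le> M * norm z ^ Suc m"
proof (cases "z = 0")
  case True
  have "norm (E 0) \<le> e" if e: "0 < e" for e
  proof -
    obtain d where d: "d > 0" "\<And>z. norm z < d \<Longrightarrow> norm (E z) \<le> e * norm z ^ m"
      using small[OF e] by blast
    have "norm (E 0) \<le> e * norm (0::'a) ^ m" by (rule d(2)) (use d(1) in simp)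
    also have "\<dots> \<le> e * 1" using e by (intro mult_left_mono power_le_one) auto
    finally show ?thesis by simp
  qed
  then have "norm (E 0) \<le> 0" by (rule field_le_epsilon) simp
  then show ?thesis using True by simp
next
  case False
  define b where "b = (1 / norm z) *\<^sub>R z"
  have b: "norm b = 1" and zb: "z = complex_of_real (norm z) *\<^sub>C b"
    using False by (auto simp: b_def scaleR_scaleC[symmetric])
  show ?thesis
  proof (rule norm_le_by_functionals)
    fix \<phi> :: "'a \<Rightarrow> complex" assume \<phi>: "cfunctional \<phi>"
    define f where "f w = \<phi> (E (0 + w *\<^sub>C b))" for w
    have nb: "norm (0 + w *\<^sub>C b) = cmod w" for w by (simp add: norm_scaleC b)
    have fE: "cmod (f w) \<le> norm (E (0 + w *\<^sub>C b))" for w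
      unfolding f_def by (rule cfunctional_bound[OF \<phi>])
    have "cmod (f (of_real (norm z))) \<le> M * cmod (of_real (norm z)) ^ Suc m"
    proof (rule schwarz_bound_order)
      show "f holomorphic_on ball 0 1"
        unfolding f_def by (rule slice_holomorphic[OF \<phi> hol]) (use nb in auto)
      show "cmod (f w) \<le> M" if "cmod w < 1" for w
        using order_trans[OF fE M] nb that by metis
      show "\<exists>d>0. \<forall>w. cmod w < d \<longrightarrow> cmod (f w) \<le> e * cmod w ^ m" if e: "0 < e" for e
      proof -
        obtain d where d: "d > 0" "\<And>z. norm z < d \<Longrightarrow> norm (E z) \<le> e * norm z ^ m"
          using small[OF e] by blast
        have "cmod (f w) \<le> e * cmod w ^ m" if "cmod w < d" for w
          using order_trans[OF fE d(2)[of "0 + w *\<^sub>C b"]] nb that by metis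
        then show ?thesis using d(1) by blast
      qed
    qed (use z in auto)
    then show "cmod (\<phi> (E z)) \<le> M * norm z ^ Suc m"
      unfolding f_def using zb by simp
  qed
qed

lemma schwarz_norm_le:
  fixes g :: "'a::complex_banach \<Rightarrow> 'a"
  assumes hol: "holo_on g (ball 0 1)" and maps: "\<And>z. norm z < 1 \<Longrightarrow> norm (g z) < 1"
    and g0: "g 0 = 0" and x: "norm x < 1"
  shows "norm (g x) \<le> norm x"
proof -
  have "norm (g x) \<le> 1 * norm x ^ Suc 0"
  proof (rule vanishing_order_bound[OF hol _ _ x])
    obtain D where "(g has_derivative D) (at 0)"
      using hol unfolding holo_on_def by (meson centre_in_ball zero_less_one)
    then have "isCont g 0" by (rule has_derivative_continuous)
    then show "\<exists>d>0. \<forall>z. norm z < d \<longrightarrow> norm (g z) \<le> e * norm z ^ 0" if e: "0 < e" for e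
    proof -
      obtain d where "d > 0" "\<And>z. norm z < d \<Longrightarrow> norm (g z) < e"
        using e g0 \<open>isCont g 0\<close> unfolding continuous_at_eps_delta by (auto simp: dist_norm)
      then show ?thesis by (intro exI[of _ d]) (auto intro: less_imp_le)
    qed
  qed (use maps in \<open>auto intro: less_imp_le\<close>)
  then show ?thesis by simp
qed

text \<open>
Let \<open>E = F - id\<close> and suppose \<open>norm (E x) \<le> 2 * norm x ^ m\<close>.  The iterates of \<open>F\<close>
map the ball into itself, so \<open>F^n - id\<close> satisfies the same bound with the same constant.  Near the
origin it equals \<open>n E\<close> up to terms of order \<open>2m - 1 > m\<close>.  Dividing by \<open>n\<close> and letting
\<open>n\<close> grow shows that \<open>E\<close> is of smaller order than \<open>m\<close>, so the bound holds with \<open>m + 1\<close>.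
\<close>

lemma cartan_uniqueness:
  fixes F :: "'a::complex_banach \<Rightarrow> 'a"
  assumes hol: "holo_on F (ball 0 1)" and maps: "\<And>z. norm z < 1 \<Longrightarrow> norm (F z) < 1"
    and F0: "F 0 = 0" and dF: "(F has_derivative (\<lambda>h. h)) (at 0)" and z: "norm z < 1"
  shows "F z = z"
proof -
  define E where "E z = F z - z" for z
  have holE: "holo_on E (ball 0 1)"
    unfolding E_def by (rule holo_on_diff[OF hol holo_on_ident])
  have Fle: "norm (F x) \<le> norm x" if "norm x < 1" for x
    by (rule schwarz_norm_le[OF hol maps F0 that])
  have itr: "norm ((F ^^ j) x) \<le> norm x" if "norm x < 1" for j x
  proof (induction j)
    case (Suc j)
    then show ?case using Fle[of "(F ^^ j) x"] that by simp
  qed simp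
  have hol_itr: "holo_on (\<lambda>x. (F ^^ j) x) (ball 0 1)" for j
  proof (induction j)
    case (Suc j)
    have "holo_on (\<lambda>x. F ((F ^^ j) x)) (ball 0 1)"
      by (rule holo_on_comp[OF Suc hol]) (auto intro!: le_less_trans[OF itr])
    then show ?case by simp
  qed (simp add: holo_on_ident)
  have telescope: "(F ^^ n) x - x = (\<Sum>j<n. E ((F ^^ j) x))" for n x
    by (induction n) (simp_all add: E_def algebra_simps)
  have bound: "\<forall>x. norm x < 1 \<longrightarrow> norm (E x) \<le> 2 * norm x ^ (m + 2)" for m
  proof (induction m)
    case 0
    have "norm (E x) \<le> 2 * norm x ^ Suc 1" if "norm x < 1" for x
    proof (rule vanishing_order_bound[OF holE _ _ that])
      show "norm (E w) \<le> 2" if "norm w < 1" for w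
        using norm_triangle_ineq4[of "F w" w] maps[OF that] that unfolding E_def by linarith
      show "\<exists>d>0. \<forall>w. norm w < d \<longrightarrow> norm (E w) \<le> e * norm w ^ 1" if e: "0 < e" for e
        using dF e unfolding has_derivative_at_alt by (auto simp: F0 E_def)
    qed
    then show ?case by (simp add: numeral_2_eq_2)
  next
    case (Suc m0)
    define m where "m = m0 + 2"
    have IH: "norm (E x) \<le> 2 * norm x ^ m" if "norm x < 1" for x
      using Suc that by (simp add: m_def)
    have Ej: "norm (E ((F ^^ j) x)) \<le> 2 * norm x ^ m" if "norm x < 1" for j x
    proof -
      have "norm ((F ^^ j) x) < 1" using itr[OF that, of j] that by simp
      then have "norm (E ((F ^^ j) x)) \<le> 2 * norm ((F ^^ j) x) ^ m" by (rule IH)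
      also have "\<dots> \<le> 2 * norm x ^ m" using itr[OF that] by (intro mult_left_mono power_mono) auto
      finally show ?thesis .
    qed
    have crude: "norm ((F ^^ n) x - x) \<le> real n * (2 * norm x ^ m)" if "norm x < 1" for n x
    proof -
      have "norm (\<Sum>j<n. E ((F ^^ j) x)) \<le> (\<Sum>j<n. 2 * norm x ^ m)"
        by (rule sum_norm_le) (use Ej[OF that] in auto)
      then show ?thesis by (simp add: telescope)
    qed
    have sharp: "norm ((F ^^ n) x - x) \<le> 2 * norm x ^ m" if x: "norm x < 1" for n x
    proof -
      have "norm ((F ^^ n) x - x) \<le> 2 * norm x ^ Suc (m - 1)"
      proof (rule vanishing_order_bound[OF holo_on_diff[OF hol_itr holo_on_ident] _ _ x])
        show "norm ((F ^^ n) w - w) \<le> 2" if "norm w < 1" for w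
          using norm_triangle_ineq4[of "(F ^^ n) w" w] itr[OF that, of n] that by linarith
        show "\<exists>d>0. \<forall>w. norm w < d \<longrightarrow> norm ((F ^^ n) w - w) \<le> e * norm w ^ (m - 1)" if e: "0 < e" for e
        proof (intro exI[of _ "min 1 (e / (2 * real n + 1))"] conjI allI impI)
          fix w :: 'a assume w: "norm w < min 1 (e / (2 * real n + 1))"
          have "norm ((F ^^ n) w - w) \<le> real n * (2 * norm w ^ m)" by (rule crude) (use w in simp)
          also have "\<dots> = (2 * real n * norm w) * norm w ^ (m - 1)"
            by (simp add: m_def)
          also have "\<dots> \<le> e * norm w ^ (m - 1)"
          proof (rule mult_right_mono)
            have "(2 * real n) * norm w \<le> (2 * real n + 1) * norm w" by (intro mult_right_mono) auto
            also have "\<dots> \<le> e" using w by (simp add: field_simps)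
            finally show "2 * real n * norm w \<le> e" .
          qed simp
          finally show "norm ((F ^^ n) w - w) \<le> e * norm w ^ (m - 1)" .
        qed (use e in auto)
      qed
      then show ?thesis by (simp add: m_def)
    qed
    define C where "C = 4 * (2 * 2 ^ m :: real)"
    have lip: "norm (E x - E y) \<le> (2 * 2 ^ m * r ^ (m - 1)) * norm (x - y)"
      if r: "0 < r" "r \<le> 1/4" and xy: "norm x \<le> r" "norm y \<le> r" for x y r
    proof -
      have "\<forall>w\<in>cball 0 r. \<exists>D. clinear D \<and> (E has_derivative D) (at w)"
        using holE r unfolding holo_on_def by auto
      then obtain E' where E': "\<And>w. w \<in> cball 0 r \<Longrightarrow> clinear (E' w) \<and> (E has_derivative E' w) (at w)"
        by metis
      show ?thesis
      proof (rule differentiable_bound[of "cball 0 r"])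
        fix w :: 'a assume w: "w \<in> cball 0 r"
        show "(E has_derivative E' w) (at w within cball 0 r)"
          using E'[OF w] has_derivative_at_withinI by blast
        have bl: "linear (E' w)" using E'[OF w] has_derivative_linear by blast
        have unit: "norm (E' w h) \<le> 2 * 2 ^ m * r ^ (m - 1)" if h: "norm h = 1" for h
        proof -
          have "norm (E' w h) \<le> (2 * (2 * r) ^ m) / r"
          proof (rule derivative_bound[OF holE conjunct1[OF E'[OF w]] conjunct2[OF E'[OF w]] r(1)])
            fix \<zeta> :: complex assume "cmod \<zeta> \<le> r"
            then have n: "norm (w + \<zeta> *\<^sub>C h) \<le> 2 * r"
              using norm_triangle_ineq[of w "\<zeta> *\<^sub>C h"] w h by (simp add: norm_scaleC)
            have l: "norm (w + \<zeta> *\<^sub>C h) < 1" using n r by linarith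
            then show "w + \<zeta> *\<^sub>C h \<in> ball 0 1" by simp
            have "2 * norm (w + \<zeta> *\<^sub>C h) ^ m \<le> 2 * (2 * r) ^ m"
              by (intro mult_left_mono power_mono n) auto
            then show "norm (E (w + \<zeta> *\<^sub>C h)) \<le> 2 * (2 * r) ^ m"
              using IH[OF l] by linarith
          qed
          also have "\<dots> = 2 * 2 ^ m * r ^ (m - 1)"
            using r by (simp add: m_def power_mult_distrib)
          finally show ?thesis .
        qed
        show "onorm (E' w) \<le> 2 * 2 ^ m * r ^ (m - 1)"
        proof (rule onorm_bound)
          fix h
          show "norm (E' w h) \<le> 2 * 2 ^ m * r ^ (m - 1) * norm h"
          proof (cases "h = 0")
            case True
            then show ?thesis using linear_0[OF bl] by simp
          next
            case False
            have "E' w h = norm h *\<^sub>R E' w ((1 / norm h) *\<^sub>R h)"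
              using False by (simp add: linear_cmul[OF bl])
            then have "norm (E' w h) = norm h * norm (E' w ((1 / norm h) *\<^sub>R h))"
              by (metis norm_scaleR abs_norm_cancel)
            also have "\<dots> \<le> norm h * (2 * 2 ^ m * r ^ (m - 1))"
              using False by (intro mult_left_mono unit) auto
            finally show ?thesis by (simp add: mult_ac)
          qed
        qed (use r in simp)
      qed (use xy in auto)
    qed
    have key: "norm (E x) \<le> (2 / real n + real n * C * norm x) * norm x ^ m"
      if x: "norm x \<le> 1/4" and n: "0 < n" for x and n :: nat
    proof (cases "x = 0")
      case True
      then show ?thesis by (simp add: E_def F0)
    next
      case False
      define r where "r = norm x"
      have r: "0 < r" "r \<le> 1/4" using False x by (auto simp: r_def)
      have x1: "norm x < 1" using x by simp
      have each: "norm (E ((F ^^ j) x) - E x) \<le> real n * C / 2 * (r ^ (m - 1) * r ^ m)" if "j < n" for j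
      proof -
        have "norm (E ((F ^^ j) x) - E x) \<le> (2 * 2 ^ m * r ^ (m - 1)) * norm ((F ^^ j) x - x)"
          by (rule lip[OF r]) (use itr[OF x1] in \<open>auto simp: r_def\<close>)
        also have "\<dots> \<le> (2 * 2 ^ m * r ^ (m - 1)) * (real j * (2 * r ^ m))"
          using crude[OF x1, of j] r by (intro mult_left_mono) (auto simp: r_def)
        also have "\<dots> \<le> (2 * 2 ^ m * r ^ (m - 1)) * (real n * (2 * r ^ m))"
          using that r by (intro mult_left_mono mult_right_mono) auto
        finally show ?thesis by (simp add: C_def mult_ac)
      qed
      have "real n *\<^sub>R E x = ((F ^^ n) x - x) - (\<Sum>j<n. E ((F ^^ j) x) - E x)"
        by (simp add: telescope sum_subtractf scaleR_conv_of_real sum_constant_scaleR)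
      then have "norm (real n *\<^sub>R E x) \<le> norm ((F ^^ n) x - x) + norm (\<Sum>j<n. E ((F ^^ j) x) - E x)"
        by (metis norm_triangle_ineq4)
      also have "\<dots> \<le> 2 * r ^ m + (\<Sum>j<n. real n * C / 2 * (r ^ (m - 1) * r ^ m))"
        using sharp[OF x1, of n] each by (intro add_mono sum_norm_le) (auto simp: r_def)
      also have "\<dots> = 2 * r ^ m + real n * (real n * C / 2 * (r ^ (m - 1) * r ^ m))" by simp
      finally have "real n * norm (E x) \<le> 2 * r ^ m + real n * (real n * C / 2 * (r ^ (m - 1) * r ^ m))"
        by simp
      also have "\<dots> \<le> 2 * r ^ m + real n * (real n * C * (r * r ^ m))"
      proof -
        have "r ^ (m - 1) \<le> r ^ 1" using r by (intro power_decreasing) (auto simp: m_def)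
        then have "r ^ (m - 1) * r ^ m \<le> r * r ^ m" using r by (intro mult_right_mono) auto
        moreover have "0 \<le> C" by (simp add: C_def)
        ultimately have "real n * C / 2 * (r ^ (m - 1) * r ^ m) \<le> real n * C * (r * r ^ m)"
          using r by (intro mult_mono) auto
        then show ?thesis by (intro add_left_mono mult_left_mono) auto
      qed
      also have "\<dots> = real n * ((2 / real n + real n * C * r) * r ^ m)"
        using n by (simp add: field_simps)
      finally show ?thesis using n by (simp add: r_def)
    qed
    have "norm (E x) \<le> 2 * norm x ^ Suc m" if x: "norm x < 1" for x
    proof (rule vanishing_order_bound[OF holE _ _ x])
      show "norm (E w) \<le> 2" if "norm w < 1" for w
        using norm_triangle_ineq4[of "F w" w] maps[OF that] that unfolding E_def by linarith
      show "\<exists>d>0. \<forall>w. norm w < d \<longrightarrow> norm (E w) \<le> e * norm w ^ m" if e: "0 < e" for e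
      proof -
        obtain n :: nat where n: "real n > max 1 (4 / e)" using reals_Archimedean2 by blast
        then have n0: "0 < n" "2 / real n \<le> e / 2" using e by (auto simp: field_simps)
        have C: "0 < C" by (simp add: C_def)
        show ?thesis
        proof (intro exI[of _ "min (1/4) (e / (2 * real n * C))"] conjI allI impI)
          fix w :: 'a assume w: "norm w < min (1/4) (e / (2 * real n * C))"
          have "real n * C * norm w \<le> e / 2" using w n0 C by (simp add: field_simps)
          then have "(2 / real n + real n * C * norm w) * norm w ^ m \<le> e * norm w ^ m"
            using n0(2) by (intro mult_right_mono) auto
          then show "norm (E w) \<le> e * norm w ^ m"
            using key[of w n] w n0 by simp
        qed (use e n0 C in auto)
      qed
    qed
    then show ?case by (simp add: m_def)
  qed
  have "(\<lambda>m. 2 * norm z ^ (m + 2)) \<longlonglongrightarrow> 0"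
    using z by (intro tendsto_mult_right_zero LIMSEQ_ignore_initial_segment LIMSEQ_power_zero) auto
  then have "norm (E z) \<le> 0"
    by (rule LIMSEQ_le_const) (use bound z in blast)
  then show ?thesis by (simp add: E_def)
qed

text \<open>
By Schwarz's lemma the derivatives at \<open>0\<close> of \<open>f\<close> and of its inverse are contractions, so
the inverse \<open>B\<close> of the derivative can be composed with \<open>f\<close>; the map \<open>B f\<close> has derivative the identity
and is the identity by Cartan's uniqueness theorem.
\<close>

lemma Aut_ball_fixing_0_linear:
  assumes "f \<in> Aut_ball" "f 0 = 0"
  obtains A where "bounded_linear A" "\<And>z. norm (A z) \<le> norm z" "\<And>z. norm z < 1 \<Longrightarrow> f z = A z"
proof -
  obtain k where f: "holo_on f (ball 0 1)" "holo_on k (ball 0 1)"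
    "\<And>z. norm z < 1 \<Longrightarrow> norm (f z) < 1 \<and> norm (k z) < 1 \<and> k (f z) = z \<and> f (k z) = z"
    using Aut_ballE[OF assms(1)] by blast
  have k0: "k 0 = 0" using f(3)[of 0] assms(2) by simp
  have le: "norm (D h) \<le> norm h" if g: "holo_on g (ball 0 1)" "\<And>z. norm z < 1 \<Longrightarrow> norm (g z) < 1" "g 0 = 0"
    and D: "clinear D" "(g has_derivative D) (at 0)" for g D :: "'a \<Rightarrow> 'a" and h :: 'a
  proof -
    have gle: "norm (g x) \<le> norm x" if "norm x < 1" for x
      by (rule schwarz_norm_le[OF g that])
    define r where "r = 1 / (norm h + 1)"
    have h1: "0 < norm h + 1" using norm_ge_zero[of h] by linarith
    have r: "0 < r" using h1 by (simp add: r_def)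
    have rh: "r * norm h < 1" using h1 by (simp add: r_def divide_less_eq_1_pos)
    have "norm (D h) \<le> (r * norm h) / r"
    proof (rule derivative_bound[OF g(1) D r])
      fix z :: complex assume "cmod z \<le> r"
      then have n: "norm (0 + z *\<^sub>C h) \<le> r * norm h" by (simp add: norm_scaleC mult_right_mono)
      then have "norm (0 + z *\<^sub>C h) < 1" using rh by linarith
      then show "0 + z *\<^sub>C h \<in> ball 0 1" by simp
      show "norm (g (0 + z *\<^sub>C h)) \<le> r * norm h"
        using gle[OF \<open>norm (0 + z *\<^sub>C h) < 1\<close>] n by linarith
    qed
    then show ?thesis using r by simp
  qed
  have z0: "(0::'a) \<in> ball 0 1" by simp
  obtain A where A: "clinear A" "(f has_derivative A) (at 0)" using f(1) z0 unfolding holo_on_def by blast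
  obtain B where B: "clinear B" "(k has_derivative B) (at 0)" using f(2) z0 unfolding holo_on_def by blast
  have Ale: "norm (A h) \<le> norm h" for h using le[OF f(1) _ assms(2) A] f(3) by blast
  have Ble: "norm (B h) \<le> norm h" for h using le[OF f(2) _ k0 B] f(3) by blast
  have BA: "(\<lambda>h. B (A h)) = (\<lambda>h. h)"
  proof (rule has_derivative_unique)
    show "((\<lambda>z. k (f z)) has_derivative (\<lambda>h. B (A h))) (at 0)"
      using has_derivative_compose[OF A(2), of k B] B(2) assms(2) by simp
    show "((\<lambda>z. k (f z)) has_derivative (\<lambda>h. h)) (at 0)"
      by (rule has_derivative_transform_within_open[OF has_derivative_ident open_ball z0]) (use f(3) in auto)
  qed
  have AB: "(\<lambda>h. A (B h)) = (\<lambda>h. h)"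
  proof (rule has_derivative_unique)
    show "((\<lambda>z. f (k z)) has_derivative (\<lambda>h. A (B h))) (at 0)"
      using has_derivative_compose[OF B(2), of f A] A(2) k0 by simp
    show "((\<lambda>z. f (k z)) has_derivative (\<lambda>h. h)) (at 0)"
      by (rule has_derivative_transform_within_open[OF has_derivative_ident open_ball z0]) (use f(3) in auto)
  qed
  have blB: "bounded_linear B" by (rule has_derivative_bounded_linear[OF B(2)])
  have BFz: "B (f z) = z" if z: "norm z < 1" for z
  proof (rule cartan_uniqueness[where F = "\<lambda>z. B (f z)"])
    show "holo_on (\<lambda>z. B (f z)) (ball 0 1)"
      by (rule holo_on_comp[OF f(1) holo_on_linear[OF B(1) blB, of UNIV]]) simp
    show "norm (B (f w)) < 1" if "norm w < 1" for w
      using Ble[of "f w"] f(3)[OF that] by linarith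
    show "B (f 0) = 0" using Ble[of "f 0"] assms(2) by simp
    have "((\<lambda>z. B (f z)) has_derivative (\<lambda>h. B (A h))) (at 0)"
      by (rule bounded_linear.has_derivative[OF blB A(2)])
    then show "((\<lambda>z. B (f z)) has_derivative (\<lambda>h. h)) (at 0)" by (simp add: BA)
  qed (rule z)
  have "f z = A z" if "norm z < 1" for z
    using fun_cong[OF AB, of "f z"] BFz[OF that] by simp
  then show thesis using that[of A] Ale has_derivative_bounded_linear[OF A(2)] by blast
qed

section \<open>Orbits of boundary points\<close>

text \<open>
The average \<open>h z\<close> of \<open>G\<close> over the points \<open>\<omega>^k z v\<close>, with \<open>\<omega>\<close> an \<open>n\<close>-th root of unity, is holomorphic in \<open>z\<close>,
has the value \<open>G 0\<close> at \<open>0\<close> and is invariant under multiplication by \<open>\<omega>\<close>.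
For large \<open>n\<close> invariance and uniform continuity make it almost constant on the unit circle, so by the maximum
modulus principle \<open>G 0\<close> is close to \<open>h 1\<close>, a convex combination of boundary values.
\<close>

lemma mean_value_in_convex_hull:
  fixes G :: "'a::complex_banach \<Rightarrow> 'a"
  assumes cont: "continuous_on (cball 0 1) G" and hol: "holo_on G (ball 0 1)" and v: "norm v = 1"
  shows "G 0 \<in> closure (convex hull (range (\<lambda>\<theta>. G (cis \<theta> *\<^sub>C v))))"
  unfolding closure_approachable
proof (intro allI impI)
  fix e :: real assume e: "0 < e"
  let ?S = "convex hull (range (\<lambda>\<theta>. G (cis \<theta> *\<^sub>C v)))"
  define H where "H z = G (z *\<^sub>C v)" for z
  have nv: "norm (z *\<^sub>C v) = cmod z" for z by (simp add: norm_scaleC v)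
  have "continuous_on (cball 0 1) (\<lambda>z. z *\<^sub>C v)"
    by (intro linear_continuous_on bounded_bilinear.bounded_linear_left[OF bounded_bilinear_scaleC])
  then have Hcont: "continuous_on (cball 0 1) H"
    unfolding H_def by (rule continuous_on_compose2[OF cont]) (auto simp: nv)
  then have "uniformly_continuous_on (cball 0 1) H"
    by (rule compact_uniformly_continuous) simp
  then obtain \<delta> where \<delta>: "0 < \<delta>" "\<And>z w. z \<in> cball 0 1 \<Longrightarrow> w \<in> cball 0 1 \<Longrightarrow> dist w z < \<delta> \<Longrightarrow> dist (H w) (H z) < e/2"
    unfolding uniformly_continuous_on_def using e by (metis half_gt_zero)
  have "isCont cis 0"
    unfolding cis_conv_exp[abs_def] by (intro continuous_intros)
  then obtain \<eta> where \<eta>: "0 < \<eta>" "\<And>s. \<bar>s\<bar> < \<eta> \<Longrightarrow> cmod (cis s - 1) < \<delta>"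
    using \<delta>(1) unfolding continuous_at_eps_delta by (auto simp: dist_norm)
  obtain n :: nat where n: "real n > max 1 (2 * pi / \<eta>)" using reals_Archimedean2 by blast
  then have n0: "0 < n" and n\<eta>: "2 * pi / real n < \<eta>" using \<eta>(1) by (auto simp: field_simps)
  define \<omega> where "\<omega> = cis (2 * pi / real n)"
  have \<omega>n: "\<omega> ^ n = 1" unfolding \<omega>_def Complex.DeMoivre using n0 by simp
  have n\<omega>: "cmod (\<omega> ^ k) = 1" for k by (simp add: \<omega>_def norm_power)
  define h where "h z = (1 / real n) *\<^sub>R (\<Sum>k<n. H (\<omega> ^ k * z))" for z
  have rot: "h (\<omega> * z) = h z" for z
  proof -
    have "H (\<omega> ^ 0 * z) + (\<Sum>k<n. H (\<omega> ^ Suc k * z)) = (\<Sum>k<n. H (\<omega> ^ k * z)) + H (\<omega> ^ n * z)"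
      using sum.lessThan_Suc_shift[of "\<lambda>k. H (\<omega> ^ k * z)" n] by simp
    then have "(\<Sum>k<n. H (\<omega> ^ Suc k * z)) = (\<Sum>k<n. H (\<omega> ^ k * z))" using \<omega>n by simp
    then show ?thesis by (simp add: h_def mult_ac)
  qed
  have rotj: "h (\<omega> ^ j * z) = h z" for j z
    by (induction j) (simp_all add: rot mult.assoc)
  have near: "norm (h z - h 1) \<le> e/2" if z: "cmod z = 1" for z
  proof -
    \<comment> \<open>a nonnegative argument of \<open>z\<close>, so that the number \<open>j\<close> of rotations is a natural number\<close>
    define \<alpha> where "\<alpha> = Arg z + 2 * pi"
    have "z \<noteq> 0" using z by auto
    then have "cis (Arg z) = z" using cis_Arg[of z] z by (simp add: sgn_eq)
    then have z\<alpha>: "z = cis \<alpha>" by (simp add: \<alpha>_def flip: cis_mult)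
    have \<alpha>: "0 \<le> \<alpha>" using Arg_bounded[of z] pi_gt_zero unfolding \<alpha>_def by linarith
    define c where "c = 2 * pi / real n"
    have c: "0 < c" using n0 by (simp add: c_def)
    define j where "j = nat \<lfloor>\<alpha> / c\<rfloor>"
    define s where "s = \<alpha> - real j * c"
    have "real j \<le> \<alpha> / c" "\<alpha> / c < real j + 1"
      using \<alpha> c unfolding j_def by (auto simp: of_nat_nat floor_less_iff intro!: of_int_floor_le)
    then have s: "0 \<le> s" "s < c" using c by (auto simp: s_def field_simps)
    have "z = \<omega> ^ j * cis s"
      unfolding z\<alpha> \<omega>_def Complex.DeMoivre cis_mult s_def c_def by simp
    then have "h z - h 1 = h (cis s) - h 1" using rotj by simp
    also have "\<dots> = (1 / real n) *\<^sub>R (\<Sum>k<n. H (\<omega> ^ k * cis s) - H (\<omega> ^ k * 1))"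
      by (simp add: h_def sum_subtractf scaleR_diff_right)
    finally have "norm (h z - h 1) = 1 / real n * norm (\<Sum>k<n. H (\<omega> ^ k * cis s) - H (\<omega> ^ k * 1))"
      by simp
    also have "\<dots> \<le> 1 / real n * (\<Sum>k<n. e/2)"
    proof (intro mult_left_mono sum_norm_le)
      fix k
      have "dist (\<omega> ^ k * cis s) (\<omega> ^ k * 1) = cmod (\<omega> ^ k) * cmod (cis s - 1)"
        by (simp only: dist_norm right_diff_distrib[symmetric] norm_mult)
      also have "\<dots> < \<delta>" using \<eta>(2)[of s] s n\<eta> n\<omega> by (simp add: c_def)
      finally have "dist (\<omega> ^ k * cis s) (\<omega> ^ k * 1) < \<delta>" .
      then have "dist (H (\<omega> ^ k * cis s)) (H (\<omega> ^ k * 1)) < e/2"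
        by (intro \<delta>(2)) (auto simp: norm_mult n\<omega>)
      then show "norm (H (\<omega> ^ k * cis s) - H (\<omega> ^ k * 1)) \<le> e/2" by (simp add: dist_norm)
    qed simp
    also have "\<dots> = e/2" using n0 by simp
    finally show ?thesis .
  qed
  have "norm (G 0 - h 1) \<le> e/2"
  proof (rule norm_le_by_functionals)
    fix \<phi> :: "'a \<Rightarrow> complex" assume \<phi>: "cfunctional \<phi>"
    have bl: "bounded_linear \<phi>" by (rule cfunctional_bounded_linear[OF \<phi>])
    define f where "f z = \<phi> (h z - h 1)" for z
    have hcont: "continuous_on (cball 0 1) h"
      unfolding h_def
      by (intro continuous_on_scaleR continuous_on_const continuous_on_sum
          continuous_on_compose2[OF Hcont] continuous_on_mult continuous_on_id) (auto simp: norm_mult n\<omega>)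
    have feq: "f z = (1 / of_nat n) * (\<Sum>k<n. \<phi> (G (0 + z *\<^sub>C (\<omega> ^ k *\<^sub>C v)))) - \<phi> (h 1)" for z
    proof -
      have "\<phi> (h z) = (1 / real n) *\<^sub>R (\<Sum>k<n. \<phi> (H (\<omega> ^ k * z)))"
        unfolding h_def using bl
        by (simp add: bounded_linear.linear linear_cmul linear_sum)
      then show ?thesis
        using bl by (simp add: f_def bounded_linear.linear linear_diff H_def scaleC_scaleC
            scaleR_conv_of_real mult.commute)
    qed
    have fhol: "f holomorphic_on ball 0 1"
      unfolding feq[abs_def]
      by (intro holomorphic_intros slice_holomorphic[OF \<phi> hol]) (auto simp: norm_scaleC n\<omega> v)
    have fcont: "continuous_on (cball 0 1) f"
      unfolding f_def
      by (intro bounded_linear.continuous_on[OF bl] continuous_on_diff hcont continuous_on_const)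
    have fbound: "cmod (f z) \<le> e/2" if "z \<in> frontier (cball 0 1)" for z
    proof -
      have "cmod z = 1" using that by (simp add: sphere_def)
      then show ?thesis
        unfolding f_def by (rule order_trans[OF cfunctional_bound[OF \<phi>] near])
    qed
    have "cmod (f 0) \<le> e/2"
      by (rule maximum_modulus_frontier[of f "cball 0 1", OF _ _ _ fbound]) (use fhol fcont in simp_all)
    moreover have "h 0 = G 0" using n0 by (simp add: h_def H_def sum_constant_scaleR)
    ultimately show "cmod (\<phi> (G 0 - h 1)) \<le> e/2" by (simp add: f_def)
  qed
  moreover have "h 1 \<in> ?S"
  proof -
    have "h 1 = (\<Sum>k<n. (1 / real n) *\<^sub>R H (\<omega> ^ k * 1))" by (simp add: h_def scaleR_sum_right)
    also have "\<dots> \<in> ?S"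
    proof (rule convex_sum)
      fix k
      have "H (\<omega> ^ k * 1) = G (cis (real k * (2 * pi / real n)) *\<^sub>C v)"
        by (simp add: H_def \<omega>_def Complex.DeMoivre)
      then show "H (\<omega> ^ k * 1) \<in> ?S" by (intro hull_inc) auto
    qed (use n0 in \<open>auto simp: convex_convex_hull\<close>)
    finally show ?thesis .
  qed
  ultimately show "\<exists>y\<in>?S. dist y (G 0) < e"
    using e by (intro bexI[of _ "h 1"]) (auto simp: dist_norm norm_minus_commute)
qed

lemma cball_ext_eq:
  assumes cont: "continuous_on (cball 0 1) G" and eq: "\<And>z. norm z < 1 \<Longrightarrow> g z = G z"
    and v: "norm v = 1"
  shows "cball_ext g v = G v"
proof -
  have lp: "v islimpt ball 0 1"
    using v closure_ball[of 1 "0::'a"] by (force simp: closure_def)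
  have "(G \<longlongrightarrow> G v) (at v within cball 0 1)"
    using cont v by (simp add: continuous_on)
  then have "(G \<longlongrightarrow> G v) (at v within ball 0 1)"
    by (rule tendsto_within_subset) auto
  then have "(g \<longlongrightarrow> G v) (at v within ball 0 1)"
    by (rule Lim_transform_eventually) (auto simp: eventually_at_filter eq)
  then have "Lim (at v within ball 0 1) g = G v"
    using lp by (intro tendsto_Lim) (auto simp: trivial_limit_within)
  then show ?thesis using v by (simp add: cball_ext_def)
qed

context jb_star_triple
begin

lemma flow_holo: "norm a \<le> 1/64 \<Longrightarrow> holo_on (\<lambda>z. flow a z 1) (ball 0 1)"
  unfolding holo_on_def
proof
  fix z :: 'a assume a: "norm a \<le> 1/64" and "z \<in> ball 0 1"
  then have "norm z < 2" by simp
  from flow_has_derivative[OF a this]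
  show "\<exists>D. clinear D \<and> ((\<lambda>z. flow a z 1) has_derivative D) (at z)" by metis
qed

lemma flow_Aut: "norm a \<le> 1/64 \<Longrightarrow> restrict (\<lambda>z. flow a z 1) (ball 0 1) \<in> Aut_ball"
proof (rule Aut_ballI[where k = "\<lambda>z. flow (- a) z 1"])
  assume a: "norm a \<le> 1/64"
  show "holo_on (\<lambda>z. flow a z 1) (ball 0 1)" "holo_on (\<lambda>z. flow (- a) z 1) (ball 0 1)"
    using a by (auto intro: flow_holo)
  show "norm (flow a z 1) < 1 \<and> norm (flow (- a) z 1) < 1 \<and> flow (- a) (flow a z 1) 1 = z
      \<and> flow a (flow (- a) z 1) 1 = z" if "norm z < 1" for z
    using a that flow_in_ball[of a z] flow_in_ball[of "- a" z] flow_inverse[of a z] flow_inverse[of "- a" z]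
    by simp
qed

lemma moves_holo: "h \<in> moves \<Longrightarrow> holo_on h (ball 0 1)"
proof (induction rule: moves.induct)
  case moves_id
  show ?case by (rule holo_on_ident)
next
  case (moves_step h a)
  show ?case
    by (rule holo_on_comp[OF moves_step.IH flow_holo]) (use moves_step moves_ball in auto)
qed

text \<open>
Along the construction of \<open>h\<close>, each flow is switched on gradually by scaling its field; the
rotation itself is joined to the identity by turning the angle to \<open>0\<close>.
\<close>

lemma moves_rotation_in_Aut_0:
  assumes "h \<in> moves"
  shows "restrict (\<lambda>z. h (cis \<theta> *\<^sub>C z)) (ball 0 1) \<in> Aut_ball_0"
  using assms
proof (induction rule: moves.induct)
  case moves_id
  define \<gamma> where "\<gamma> t = restrict (\<lambda>z::'a. cis (t * \<theta>) *\<^sub>C z) (ball 0 1)" for t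
  have "connected_component_of Aut_top (\<gamma> 0) (\<gamma> 1)"
  proof (rule connected_component_of_Aut_top_path)
    fix t :: real
    have inv: "cis (- x) *\<^sub>C (cis x *\<^sub>C z) = z" "cis x *\<^sub>C (cis (- x) *\<^sub>C z) = z" for x and z :: 'a
      by (simp_all add: scaleC_scaleC cis_mult scaleC_one)
    show "\<gamma> t \<in> Aut_ball"
      unfolding \<gamma>_def
      by (rule Aut_ballI[where k = "\<lambda>z. cis (- (t * \<theta>)) *\<^sub>C z"])
        (simp_all only: holo_on_scaleC inv norm_scaleC norm_cis mult_1 simp_thms)
    fix e :: real assume e: "0 < e"
    have "isCont (\<lambda>s. cis (s * \<theta>)) t"
      unfolding cis_conv_exp by (intro continuous_intros)
    then obtain d where d: "0 < d" "\<And>s. \<bar>s - t\<bar> < d \<Longrightarrow> cmod (cis (s * \<theta>) - cis (t * \<theta>)) < e"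
      using e unfolding continuous_at_eps_delta by (auto simp: dist_norm)
    have "norm (\<gamma> s z - \<gamma> t z) < e" if "\<bar>s - t\<bar> < d" "norm z < 1" for s and z :: 'a
    proof -
      have "\<gamma> s z - \<gamma> t z = (cis (s * \<theta>) - cis (t * \<theta>)) *\<^sub>C z"
        using that scaleC_add_left[of "cis (s * \<theta>) - cis (t * \<theta>)" "cis (t * \<theta>)" z] by (simp add: \<gamma>_def)
      then have "norm (\<gamma> s z - \<gamma> t z) = cmod (cis (s * \<theta>) - cis (t * \<theta>)) * norm z"
        by (simp add: norm_scaleC)
      also have "\<dots> \<le> cmod (cis (s * \<theta>) - cis (t * \<theta>)) * 1"
        using that by (intro mult_left_mono) auto
      also have "\<dots> < e" using d(2)[OF that(1)] by simp
      finally show ?thesis .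
    qed
    then show "\<exists>d>0. \<forall>s\<in>{0..1}. \<bar>s - t\<bar> < d \<longrightarrow> (\<forall>z. norm z < 1 \<longrightarrow> norm (\<gamma> s z - \<gamma> t z) < e)"
      using d(1) by blast
  qed
  moreover have "\<gamma> 0 = restrict id (ball 0 1)" by (auto simp: \<gamma>_def scaleC_one restrict_def)
  moreover have "\<gamma> 1 = restrict (\<lambda>z. cis \<theta> *\<^sub>C z) (ball 0 1)" by (simp only: \<gamma>_def mult_1)
  ultimately show ?case unfolding Aut_ball_0_def by (simp only: mem_Collect_eq)
next
  case (moves_step h a)
  define w where "w z = h (cis \<theta> *\<^sub>C z)" for z
  have w: "norm (w z) < 1" if "norm z < 1" for z
    unfolding w_def using that by (intro moves_ball[OF moves_step(1)]) (simp add: norm_scaleC)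
  have wA: "restrict w (ball 0 1) \<in> Aut_ball_0"
    using moves_step.IH unfolding w_def[abs_def] .
  then have wAut: "restrict w (ball 0 1) \<in> Aut_ball"
    using connected_component_of_subset_topspace[of Aut_top "restrict id (ball 0 1)"]
    unfolding Aut_ball_0_def topspace_Aut_top by blast
  define \<gamma> where "\<gamma> t = restrict (\<lambda>z. flow (t *\<^sub>R a) (w z) 1) (ball 0 1)" for t
  have ta: "norm (t *\<^sub>R a) \<le> 1/6000" if "t \<in> {0..1}" for t
    using that moves_step(2) mult_mono[of t 1 "norm a" "1/6000"] by simp
  have "connected_component_of Aut_top (\<gamma> 0) (\<gamma> 1)"
  proof (rule connected_component_of_Aut_top_path)
    fix t :: real assume t: "t \<in> {0..1}"
    have "restrict (\<lambda>z. restrict (\<lambda>z. flow (t *\<^sub>R a) z 1) (ball 0 1) (restrict w (ball 0 1) z)) (ball 0 1) \<in> Aut_ball"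
      by (rule Aut_ball_comp[OF flow_Aut wAut]) (use ta[OF t] in simp)
    also have "restrict (\<lambda>z. restrict (\<lambda>z. flow (t *\<^sub>R a) z 1) (ball 0 1) (restrict w (ball 0 1) z)) (ball 0 1) = \<gamma> t"
      unfolding \<gamma>_def using w by (intro restrict_ext) auto
    finally show "\<gamma> t \<in> Aut_ball" .
    fix e :: real assume e: "0 < e"
    define d where "d = e / (44 * norm a + 1)"
    have p: "0 < 44 * norm a + 1" using norm_ge_zero[of a] by linarith
    have "norm (\<gamma> s z - \<gamma> t z) < e" if s: "s \<in> {0..1}" "\<bar>s - t\<bar> < d" and z: "norm z < 1" for s z
    proof -
      have "norm (\<gamma> s z - \<gamma> t z) = norm (flow (s *\<^sub>R a) (w z) 1 - flow (t *\<^sub>R a) (w z) 1)"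
        using z by (simp add: \<gamma>_def)
      also have "\<dots> \<le> 44 * norm (s *\<^sub>R a - t *\<^sub>R a)"
        using ta[OF s(1)] ta[OF t] w[OF z] by (intro flow_diff) auto
      also have "\<dots> = \<bar>s - t\<bar> * (44 * norm a)" by (simp flip: scaleR_left_diff_distrib)
      also have "\<dots> \<le> \<bar>s - t\<bar> * (44 * norm a + 1)" by (intro mult_left_mono) auto
      also have "\<dots> < d * (44 * norm a + 1)" using s(2) p by (intro mult_strict_right_mono)
      also have "\<dots> = e" using p by (simp add: d_def)
      finally show ?thesis .
    qed
    moreover have "0 < d" using e p by (simp add: d_def)
    ultimately show "\<exists>d>0. \<forall>s\<in>{0..1}. \<bar>s - t\<bar> < d \<longrightarrow> (\<forall>z. norm z < 1 \<longrightarrow> norm (\<gamma> s z - \<gamma> t z) < e)"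
      by blast
  qed
  moreover have "\<gamma> 0 = restrict w (ball 0 1)" by (simp add: \<gamma>_def)
  moreover have "\<gamma> 1 = restrict (\<lambda>z. flow a (h (cis \<theta> *\<^sub>C z)) 1) (ball 0 1)"
    by (simp only: \<gamma>_def w_def scaleR_one)
  moreover have "connected_component_of Aut_top (restrict id (ball 0 1)) (restrict w (ball 0 1))"
    using wA unfolding Aut_ball_0_def by (rule CollectD)
  ultimately show ?case
    unfolding Aut_ball_0_def mem_Collect_eq by (metis connected_component_of_trans)
qed

lemma ball_subset_closed_hull_orbit_0:
  fixes v :: 'a
  assumes v: "norm v = 1"
  shows "ball 0 1 \<subseteq> closure (convex hull (orbit_0 v))"
proof
  fix p :: 'a assume "p \<in> ball 0 1"
  then have p: "norm p < 1" by simp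
  obtain h where h: "h \<in> moves" "h p = 0" using moves_to_0[OF p] .
  obtain k where k: "k \<in> moves" "\<And>z. norm z \<le> 1 \<Longrightarrow> k (h z) = z"
    using moves_inverse[OF h(1)] by metis
  have k0: "k 0 = p" using k(2)[of p] h(2) p by simp
  have "k (cis \<theta> *\<^sub>C v) \<in> orbit_0 v" for \<theta>
  proof -
    let ?g = "restrict (\<lambda>z. k (cis \<theta> *\<^sub>C z)) (ball 0 1)"
    have "continuous_on (cball 0 1) (\<lambda>z. k (cis \<theta> *\<^sub>C z))"
      by (rule continuous_on_compose2[OF moves_continuous[OF k(1)]
            linear_continuous_on[OF bounded_linear_scaleC_right]]) (auto simp: norm_scaleC)
    then have "cball_ext ?g v = k (cis \<theta> *\<^sub>C v)"
      by (rule cball_ext_eq) (use v in auto)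
    then show ?thesis
      using moves_rotation_in_Aut_0[OF k(1), of \<theta>]
      unfolding orbit_0_def by (intro CollectI exI[of _ ?g]) simp
  qed
  then have "convex hull (range (\<lambda>\<theta>. k (cis \<theta> *\<^sub>C v))) \<subseteq> convex hull (orbit_0 v)"
    by (intro hull_mono) blast
  then show "p \<in> closure (convex hull (orbit_0 v))"
    using mean_value_in_convex_hull[OF moves_continuous[OF k(1)] moves_holo[OF k(1)] v]
      closure_mono unfolding k0 by blast
qed

text \<open>
After composition with a map \<open>h\<close> that takes \<open>g 0\<close> back to \<open>0\<close>, the automorphism \<open>g\<close> becomes linear, so \<open>g\<close>
itself is a composition of maps that are continuous on the closed ball.
\<close>

lemma orbit_subset_cball:
  fixes v :: 'a
  assumes v: "norm v = 1"
  shows "orbit v \<subseteq> cball 0 1"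
proof
  fix x assume "x \<in> orbit v"
  then obtain g where g: "g \<in> Aut_ball" "x = cball_ext g v" unfolding orbit_def by blast
  have gb: "norm (g z) < 1" if "norm z < 1" for z
    using Aut_ballE[OF g(1)] that by metis
  obtain h where h: "h \<in> moves" "h (g 0) = 0" using moves_to_0[OF gb[of 0]] by auto
  obtain k where k: "k \<in> moves" "\<And>z. norm z \<le> 1 \<Longrightarrow> k (h z) = z" "\<And>z. norm z \<le> 1 \<Longrightarrow> h (k z) = z"
    using moves_inverse[OF h(1)] by metis
  have "restrict h (ball 0 1) \<in> Aut_ball"
    by (rule Aut_ballI[OF moves_holo[OF h(1)] moves_holo[OF k(1)]])
      (use moves_ball[OF h(1)] moves_ball[OF k(1)] k(2,3) in auto)
  from Aut_ball_comp[OF this g(1)]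
  have f: "restrict (\<lambda>z. restrict h (ball 0 1) (g z)) (ball 0 1) \<in> Aut_ball" (is "?f \<in> _") .
  have "?f 0 = 0" using h(2) gb[of 0] by simp
  then obtain A where A: "bounded_linear A" "\<And>z. norm (A z) \<le> norm z" "\<And>z. norm z < 1 \<Longrightarrow> ?f z = A z"
    using Aut_ball_fixing_0_linear[OF f] by metis
  have A1: "norm (A z) \<le> 1" if "norm z \<le> 1" for z using A(2)[of z] that by linarith
  have "g z = k (A z)" if z: "norm z < 1" for z
    using A(3)[OF z] z gb[OF z] k(2)[of "g z"] by simp
  moreover have "continuous_on (cball 0 1) (\<lambda>z. k (A z))"
    by (rule continuous_on_compose2[OF moves_continuous[OF k(1)] linear_continuous_on[OF A(1)]])
      (use A1 in auto)
  ultimately have "cball_ext g v = k (A v)" using v by (intro cball_ext_eq)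
  then show "x \<in> cball 0 1" using g(2) moves_cball[OF k(1) A1[of v]] v by simp
qed

end

theorem corollary3p2:
  fixes T :: "'a::complex_banach \<Rightarrow> 'a \<Rightarrow> 'a \<Rightarrow> 'a" and v :: 'a
  assumes "jb_star_triple T"
    and "v \<in> frontier (ball 0 1)"
  shows "closure (ball 0 1) = closure (convex hull (orbit_0 v))
       \<and> closure (convex hull (orbit_0 v)) = closure (convex hull (orbit v))"
proof -
  interpret jb_star_triple T by (rule assms(1))
  have v: "norm v = 1" using assms(2) by (simp add: sphere_def)
  have "Aut_ball_0 \<subseteq> (Aut_ball :: ('a \<Rightarrow> 'a) set)"
    using connected_component_of_subset_topspace[of Aut_top "restrict id (ball (0::'a) 1)"]
    unfolding Aut_ball_0_def topspace_Aut_top .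
  then have "orbit_0 v \<subseteq> orbit v" unfolding orbit_def orbit_0_def by blast
  then have 1: "closure (convex hull (orbit_0 v)) \<subseteq> closure (convex hull (orbit v))"
    by (intro closure_mono hull_mono)
  have 2: "closure (ball 0 1) \<subseteq> closure (convex hull (orbit_0 v))"
    by (rule closure_minimal[OF ball_subset_closed_hull_orbit_0[OF v]]) simp
  have "convex hull (orbit v) \<subseteq> cball 0 1"
    by (rule hull_minimal[OF orbit_subset_cball[OF v]]) (rule convex_cball)
  then have 3: "closure (convex hull (orbit v)) \<subseteq> closure (ball 0 1)"
    by (simp add: closure_minimal)
  show ?thesis using 1 2 3 by blast
qed

end
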